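(* Let $V$ be a finite dimensional vector space over an algebraically closed field $k$ and let $G$ be a finite subgroup of $GL(V)$ possessing a $1$-dimensional invariant subspace in $V$. Then $S(V^* )^G$ is a polynomial ring if and only if $G$ is generated by pseudoreflections and, for every nonzero linear subspace $W\subseteq V$, the pointwise stabilizer of $W$ in $G$ has a polynomial ring of invariants.
   Context: The field $k$ may have any characteristic. $S(V^* )$ is the symmetric algebra of the dual space $V^*$, i.e. the algebra of polynomial functions on $V$. A linear map $g\colon V\to V$ is a pseudoreflection if it has finite order and the set of points fixed by $g$ is a hyperplane. "Polynomial ring (of invariants)" means that the ring is generated as a $k$-algebra by algebraically independent elements. The displayed equivalence is what the paper calls the "Kemper-Malle conjecture" for $G$. *)

theory Defs
  imports
    "HOL-Library.Poly_Mapping"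
    "HOL-Computational_Algebra.Polynomial"
    "HOL-Algebra.Generated_Groups"
begin

text \<open>
  The vector space \<open>V\<close> is the type \<open>'v\<close> with scalar multiplication \<open>scale\<close>.
  Subsets of \<open>'v \<Rightarrow> 'k\<close> are treated as \<open>'k\<close>-algebras under the pointwise operations.
\<close>

inductive_set generated_algebra :: "('v \<Rightarrow> 'k::field) set \<Rightarrow> ('v \<Rightarrow> 'k) set"
  for F :: "('v \<Rightarrow> 'k) set" where
  const: "(\<lambda>_. c) \<in> generated_algebra F"
| gen: "f \<in> F \<Longrightarrow> f \<in> generated_algebra F"
| add: "f \<in> generated_algebra F \<Longrightarrow> g \<in> generated_algebra F \<Longrightarrow>
    (\<lambda>x. f x + g x) \<in> generated_algebra F"
| mult: "f \<in> generated_algebra F \<Longrightarrow> g \<in> generated_algebra F \<Longrightarrow>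
    (\<lambda>x. f x * g x) \<in> generated_algebra F"

text \<open>
  \<open>(('i \<Rightarrow>\<^sub>0 nat) \<Rightarrow>\<^sub>0 'k)\<close> is the polynomial ring over \<open>'k\<close> with variables indexed by \<open>'i\<close>.
  For algebraic independence of a set of functions the variables are indexed by
  the functions themselves, and only polynomials in variables from \<open>F\<close> are considered.
\<close>

definition mpoly_eval :: "('i \<Rightarrow> 'k::field) \<Rightarrow> (('i \<Rightarrow>\<^sub>0 nat) \<Rightarrow>\<^sub>0 'k) \<Rightarrow> 'k" where
  "mpoly_eval a p =
    (\<Sum>m\<in>Poly_Mapping.keys p. Poly_Mapping.lookup p m * (\<Prod>i\<in>Poly_Mapping.keys m. a i ^ Poly_Mapping.lookup m i))"

definition algebraically_independent :: "('v \<Rightarrow> 'k::field) set \<Rightarrow> bool" where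
  "algebraically_independent F \<longleftrightarrow>
    (\<forall>p :: (('v \<Rightarrow> 'k) \<Rightarrow>\<^sub>0 nat) \<Rightarrow>\<^sub>0 'k.
      (\<forall>m\<in>Poly_Mapping.keys p. Poly_Mapping.keys m \<subseteq> F) \<and> (\<forall>x. mpoly_eval (\<lambda>f. f x) p = 0) \<longrightarrow> p = 0)"

definition is_polynomial_ring :: "('v \<Rightarrow> 'k::field) set \<Rightarrow> bool" where
  "is_polynomial_ring A \<longleftrightarrow>
    (\<exists>F. algebraically_independent F \<and> generated_algebra F = A)"

text \<open>
  \<open>S(V\<^sup>*)\<close>: the functions on \<open>V\<close> generated as an algebra by the linear forms. Over an infinite
  field, in particular over an algebraically closed one, this algebra of functions is the
  symmetric algebra of the dual space.
\<close>

definition polynomial_functions ::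
  "('k::field \<Rightarrow> 'v::ab_group_add \<Rightarrow> 'v) \<Rightarrow> ('v \<Rightarrow> 'k) set" where
  "polynomial_functions scale = generated_algebra {f. Vector_Spaces.linear scale (*) f}"

text \<open>
  A group \<open>G\<close> acts on functions by \<open>(g \<cdot> f) v = f (g\<^sup>-\<^sup>1 v)\<close>; as \<open>g\<close> ranges over all of \<open>G\<close>, the
  inverse may be dropped in the definition of the invariants.
\<close>

definition invariants ::
  "('k::field \<Rightarrow> 'v::ab_group_add \<Rightarrow> 'v) \<Rightarrow> ('v \<Rightarrow> 'v) set \<Rightarrow> ('v \<Rightarrow> 'k) set" where
  "invariants scale G =
    {f \<in> polynomial_functions scale. \<forall>g\<in>G. \<forall>v. f (g v) = f v}"

definition GL :: "('k::field \<Rightarrow> 'v::ab_group_add \<Rightarrow> 'v) \<Rightarrow> ('v \<Rightarrow> 'v) monoid" where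
  "GL scale = \<lparr>carrier = {g. Vector_Spaces.linear scale scale g \<and> bij g}, mult = (\<circ>), one = id\<rparr>"

lemma group_GL:
  assumes "vector_space scale"
  shows "group (GL scale)"
proof -
  interpret vector_space scale by fact
  interpret vector_space_pair scale scale ..
  show ?thesis
  proof (rule groupI)
    fix g assume "g \<in> carrier (GL scale)"
    then have g: "Vector_Spaces.linear scale scale g" "bij g" by (auto simp: GL_def)
    have "Vector_Spaces.linear scale scale (inv_into UNIV g)"
    proof -
      obtain h where h: "Vector_Spaces.linear scale scale h" "h \<circ> g = id"
        using linear_injective_left_inverse[OF g(1)] g(2) by (auto simp: bij_def)
      have "h = inv_into UNIV g"
      proof
        fix y
        obtain x where "y = g x" using g(2) by (meson bij_pointE)
        with h(2) g(2) show "h y = inv_into UNIV g y"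
          by (metis bij_is_inj comp_apply id_apply inv_f_f)
      qed
      with h show ?thesis by simp
    qed
    with g show "\<exists>h\<in>carrier (GL scale). h \<otimes>\<^bsub>GL scale\<^esub> g = \<one>\<^bsub>GL scale\<^esub>"
      by (intro bexI[of _ "inv_into UNIV g"]) (auto simp: GL_def bij_imp_bij_inv bij_is_inj)
  qed (auto simp: GL_def comp_assoc linear_id bij_comp intro: Vector_Spaces.linear_compose)
qed

definition is_hyperplane ::
  "('k::field \<Rightarrow> 'v::ab_group_add \<Rightarrow> 'v) \<Rightarrow> 'v set \<Rightarrow> bool" where
  "is_hyperplane scale H \<longleftrightarrow>
    module.subspace scale H \<and> vector_space.dim scale H + 1 = vector_space.dim scale UNIV"

definition pseudoreflection ::
  "('k::field \<Rightarrow> 'v::ab_group_add \<Rightarrow> 'v) \<Rightarrow> ('v \<Rightarrow> 'v) \<Rightarrow> bool" where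
  "pseudoreflection scale g \<longleftrightarrow>
    Vector_Spaces.linear scale scale g \<and>
    (\<exists>n>0. g ^^ n = id) \<and>
    is_hyperplane scale {v. g v = v}"

definition pointwise_stabilizer :: "('v \<Rightarrow> 'v) set \<Rightarrow> 'v set \<Rightarrow> ('v \<Rightarrow> 'v) set" where
  "pointwise_stabilizer G W = {g \<in> G. \<forall>w\<in>W. g w = w}"

end

theory Submission
  imports Defs "Jordan_Normal_Form.Determinant"
begin

text \<open>
  Let \<open>f\<^sub>1, \<dots>, f\<^sub>n\<close> generate \<open>S\<^sup>G\<close>, \<open>n = dim V\<close>, and let \<open>J\<close> be their Jacobian determinant. It
  divides a product of nonzero linear forms; in particular \<open>J \<noteq> 0\<close>, so that any \<open>n\<close> generators are
  algebraically independent. Euler's formula for the trace shows that \<open>\<Sum>\<^sub>g s(gv)/J(gv)\<close> is a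
  polynomial for every \<open>s \<in> S\<close>. If a subgroup \<open>W\<close> contains
  all pseudoreflections of \<open>G\<close>, then \<open>\<Sum>\<^sub>w s(wv)/J(wv)\<close>, summed over \<open>W\<close>, is a polynomial as well, because
  \<open>G\<close> and \<open>W\<close> have the same ramification in codimension one; for \<open>s\<close> of degree less than \<open>deg J\<close> it
  is \<open>0\<close>, and this forces \<open>S\<^sup>W = S\<^sup>G\<close>, hence \<open>W = G\<close>.

  For a point \<open>w\<close> with stabilizer \<open>H\<close>, the invariants of \<open>G\<close> and \<open>H\<close> agree at \<open>w\<close> up to any order,
  so the functions \<open>f\<^sub>i(w + v) - f\<^sub>i(w)\<close> span \<open>M/M\<^sup>2\<close> for the ideal \<open>M\<close> of \<open>H\<close>-invariants vanishing at the
  origin, and by the graded Nakayama lemma \<open>S\<^sup>H\<close> has \<open>n\<close> homogeneous generators.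

  Conversely, let \<open>H\<close> be the pointwise stabilizer of the invariant line. Then \<open>G/H\<close> embeds in \<open>k\<^sup>*\<close>,
  so its order is prime to the characteristic and \<open>S\<^sup>H\<close> has homogeneous generators \<open>f\<^sub>i\<close> that are
  eigenvectors of \<open>G\<close>. A pseudoreflection moves at most one of them, therefore \<open>S\<^sup>G\<close> is generated
  by powers of the \<open>f\<^sub>i\<close>.
\<close>

text \<open>The characteristic may divide the order of \<open>G\<close>. Averaging over
  \<open>G\<close> is then impossible, and a polynomial can have zero derivatives without being
  constant. So partial derivatives are replaced by difference quotients \<open>a i j y v\<close>,
  polynomials in two points such that \<open>f i y - f i v\<close> is the sum over \<open>j\<close>
  of \<open>a i j y v * (x j y - x j v)\<close>. Their determinant \<open>Delta\<close> is the
  Jacobian on the diagonal, but it also vanishes at two different points of one orbit. A sum over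
  the orbit of a generic \<open>v\<close> with weights \<open>Delta v\<close> therefore has a single
  nonzero term, and this is how a function is recovered from a trace. Where an invariant with
  prescribed behaviour along an orbit is needed, orbit products and sums over cosets take the place
  of averages. Since \<open>S\<close> consists of functions on an infinite vector space, no fraction
  field is formed: identities between quotients are checked at points where the denominators are
  nonzero and then extended by density, and degrees are read off on lines through the
  origin.\<close>

lemma poly_eq_if_infinite:
  fixes p q :: "'k::field poly"
  assumes "infinite T" "\<And>t. t \<in> T \<Longrightarrow> poly p t = poly q t"
  shows "p = q"
proof (rule ccontr)
  assume "p \<noteq> q"
  then have "p - q \<noteq> 0" by simp
  then have "finite {t. poly (p - q) t = 0}" by (rule poly_roots_finite)
  moreover have "T \<subseteq> {t. poly (p - q) t = 0}" using assms(2) by auto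
  ultimately show False using assms(1) finite_subset by blast
qed

text \<open>Gaussian elimination: equation \<open>r\<close> is solved for an unknown
  \<open>s\<close> with nonzero coefficient, and \<open>A'\<close> is the system left after
  substitution.\<close>

lemma underdetermined_system:
  fixes A :: "'a \<Rightarrow> 'b \<Rightarrow> 'k::field"
  assumes "finite R" "finite T" "card R < card T"
  shows "\<exists>c. (\<exists>t\<in>T. c t \<noteq> 0) \<and> (\<forall>r\<in>R. (\<Sum>t\<in>T. c t * A t r) = 0)"
  using assms
proof (induction R arbitrary: T A rule: finite_induct)
  case empty
  then obtain t where "t \<in> T" by fastforce
  then show ?case by (intro exI[of _ "\<lambda>_. 1"]) auto
next
  case (insert r R)
  show ?case
  proof (cases "\<forall>t\<in>T. A t r = 0")
    case True
    from insert.IH[of T A] insert.prems insert.hyps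
    obtain c where "\<exists>t\<in>T. c t \<noteq> 0" "\<forall>r\<in>R. (\<Sum>t\<in>T. c t * A t r) = 0" by auto
    with True show ?thesis by (intro exI[of _ c]) auto
  next
    case False
    then obtain s where s: "s \<in> T" "A s r \<noteq> 0" by blast
    define T' where "T' = T - {s}"
    define A' where "A' t q = A t q - A t r / A s r * A s q" for t q
    have "card R < card T'" "finite T'"
      using insert s by (auto simp: T'_def)
    from insert.IH[OF this(2,1), of A']
    obtain c where c: "\<exists>t\<in>T'. c t \<noteq> 0" "\<forall>q\<in>R. (\<Sum>t\<in>T'. c t * A' t q) = 0" by auto
    define c' where "c' t = (if t = s then - (\<Sum>t\<in>T'. c t * A t r) / A s r else c t)" for t
    have T: "T = insert s T'" "s \<notin> T'" using s by (auto simp: T'_def)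
    have *: "(\<Sum>t\<in>T. c' t * A t q) = (\<Sum>t\<in>T'. c t * A' t q)" for q
    proof -
      have "(\<Sum>t\<in>T. c' t * A t q) = c' s * A s q + (\<Sum>t\<in>T'. c' t * A t q)"
        using T \<open>finite T'\<close> by simp
      also have "(\<Sum>t\<in>T'. c' t * A t q) = (\<Sum>t\<in>T'. c t * A t q)"
        using T by (intro sum.cong) (auto simp: c'_def)
      also have "c' s * A s q = - (\<Sum>t\<in>T'. c t * (A t r / A s r * A s q))"
        by (simp add: c'_def sum_distrib_right sum_divide_distrib mult.assoc)
      finally show ?thesis
        by (simp add: A'_def algebra_simps sum_subtractf)
    qed
    have "A' t r = 0" for t using s by (simp add: A'_def)
    then have "(\<Sum>t\<in>T. c' t * A t q) = 0" if "q \<in> insert r R" for q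
      using that c(2) * by auto
    moreover have "\<exists>t\<in>T. c' t \<noteq> 0" using c(1) T by (auto simp: c'_def)
    ultimately show ?thesis by blast
  qed
qed

section \<open>Polynomial functions\<close>

text \<open>Over an infinite field a polynomial function determines its polynomial on every line, so
  functions can stand for formal polynomials.\<close>

locale polynomial_space = finite_dimensional_vector_space scale Basis
  for scale :: "'k::field \<Rightarrow> 'v::ab_group_add \<Rightarrow> 'v" (infixr \<open>*s\<close> 75) and Basis :: "'v set" +
  assumes infinite_field: "infinite (UNIV :: 'k set)"
begin

abbreviation "n \<equiv> card Basis"
abbreviation "lform \<equiv> Vector_Spaces.linear (*s) ((*) :: 'k \<Rightarrow> 'k \<Rightarrow> 'k)"
abbreviation "lmap \<equiv> Vector_Spaces.linear (*s) (*s)"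
abbreviation "S \<equiv> polynomial_functions (*s)"

lemma vector_space_field: "vector_space ((*) :: 'k \<Rightarrow> 'k \<Rightarrow> 'k)"
  by unfold_locales (auto simp: algebra_simps)

lemma lform_iff: "lform f \<longleftrightarrow> (\<forall>x y. f (x + y) = f x + f y) \<and> (\<forall>c x. f (c *s x) = c * f x)"
  using vector_space_field vector_space_axioms by (auto simp: Vector_Spaces.linear_iff)

lemma lmap_iff: "lmap f \<longleftrightarrow> (\<forall>x y. f (x + y) = f x + f y) \<and> (\<forall>c x. f (c *s x) = c *s f x)"
  using vector_space_axioms by (auto simp: Vector_Spaces.linear_iff)

lemma lform_add: "lform f \<Longrightarrow> f (x + y) = f x + f y"
  and lform_scale: "lform f \<Longrightarrow> f (c *s x) = c * f x"
  by (auto simp: lform_iff)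

lemma lform_zero: "lform f \<Longrightarrow> f 0 = 0"
  using lform_scale[of f 0 0] by simp

lemma lform_uminus: "lform f \<Longrightarrow> f (- x) = - f x"
  using lform_scale[of f "-1" x] by simp

lemma lform_diff: "lform f \<Longrightarrow> f (x - y) = f x - f y"
  using lform_add[of f x "- y"] lform_uminus[of f y] by simp

lemma lform_sum: "lform f \<Longrightarrow> f (\<Sum>i\<in>I. h i) = (\<Sum>i\<in>I. f (h i))"
  by (induction I rule: infinite_finite_induct) (auto simp: lform_zero lform_add)

lemma lmap_add: "lmap f \<Longrightarrow> f (x + y) = f x + f y"
  and lmap_scale: "lmap f \<Longrightarrow> f (c *s x) = c *s f x"
  by (auto simp: lmap_iff)

lemma lmap_zero: "lmap f \<Longrightarrow> f 0 = 0"
  using lmap_scale[of f 0 0] by simp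

lemma lmap_uminus: "lmap f \<Longrightarrow> f (- x) = - f x"
  using lmap_scale[of f "-1" x] by simp

lemma lmap_diff: "lmap f \<Longrightarrow> f (x - y) = f x - f y"
  using lmap_add[of f x "- y"] lmap_uminus[of f y] by simp

lemma lform_compose: "lform f \<Longrightarrow> lmap g \<Longrightarrow> lform (\<lambda>v. f (g v))"
  by (auto simp: lform_iff lmap_iff)

lemma S_const [intro, simp]: "(\<lambda>_. c) \<in> S"
  and S_add [intro]: "f \<in> S \<Longrightarrow> g \<in> S \<Longrightarrow> (\<lambda>v. f v + g v) \<in> S"
  and S_mult [intro]: "f \<in> S \<Longrightarrow> g \<in> S \<Longrightarrow> (\<lambda>v. f v * g v) \<in> S"
  and S_lform [intro]: "lform f \<Longrightarrow> f \<in> S"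
  by (auto simp: polynomial_functions_def intro: generated_algebra.intros)

lemma S_induct [consumes 1, case_names const lform add mult]:
  assumes "f \<in> S"
    and "\<And>c. P (\<lambda>_. c)"
    and "\<And>f. lform f \<Longrightarrow> P f"
    and "\<And>f g. f \<in> S \<Longrightarrow> P f \<Longrightarrow> g \<in> S \<Longrightarrow> P g \<Longrightarrow> P (\<lambda>v. f v + g v)"
    and "\<And>f g. f \<in> S \<Longrightarrow> P f \<Longrightarrow> g \<in> S \<Longrightarrow> P g \<Longrightarrow> P (\<lambda>v. f v * g v)"
  shows "P f"
  using assms(1) unfolding polynomial_functions_def
  by (induction rule: generated_algebra.induct)
    (use assms in \<open>auto simp: polynomial_functions_def\<close>)

lemma S_cmult [intro]: "f \<in> S \<Longrightarrow> (\<lambda>v. c * f v) \<in> S"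
  using S_mult[OF S_const, of f c] by simp

lemma S_uminus [intro]: "f \<in> S \<Longrightarrow> (\<lambda>v. - f v) \<in> S"
  using S_cmult[of f "-1"] by simp

lemma S_diff [intro]: "f \<in> S \<Longrightarrow> g \<in> S \<Longrightarrow> (\<lambda>v. f v - g v) \<in> S"
  using S_add[of f "\<lambda>v. - g v"] S_uminus[of g] by simp

lemma S_sum [intro]: "(\<And>i. i \<in> I \<Longrightarrow> f i \<in> S) \<Longrightarrow> (\<lambda>v. \<Sum>i\<in>I. f i v) \<in> S"
  by (induction I rule: infinite_finite_induct) auto

lemma S_prod [intro]: "(\<And>i. i \<in> I \<Longrightarrow> f i \<in> S) \<Longrightarrow> (\<lambda>v. \<Prod>i\<in>I. f i v) \<in> S"
  by (induction I rule: infinite_finite_induct) auto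

lemma S_power [intro]: "f \<in> S \<Longrightarrow> (\<lambda>v. f v ^ d) \<in> S"
  by (induction d) auto

lemma S_lmap: "f \<in> S \<Longrightarrow> lmap g \<Longrightarrow> (\<lambda>v. f (g v)) \<in> S"
  by (induction f rule: S_induct) (auto simp: lform_compose)

lemma S_translate: "f \<in> S \<Longrightarrow> (\<lambda>v. f (w + v)) \<in> S"
proof (induction f rule: S_induct)
  case (lform f)
  then have "(\<lambda>v. f (w + v)) = (\<lambda>v. f w + f v)" by (auto simp: lform_add)
  then show ?case using lform by auto
qed auto

text \<open>Restriction to such curves reduces questions about \<open>S\<close> to polynomials in
  one variable.\<close>

definition polycurve :: "('k \<Rightarrow> 'v) \<Rightarrow> bool" where
  "polycurve \<gamma> \<longleftrightarrow> (\<forall>f. lform f \<longrightarrow> (\<exists>p. \<forall>t. f (\<gamma> t) = poly p t))"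

lemma polycurve_line: "polycurve (\<lambda>t. u + t *s v)"
  unfolding polycurve_def
proof (intro allI impI)
  fix f assume "lform f"
  then show "\<exists>p. \<forall>t. f (u + t *s v) = poly p t"
    by (intro exI[of _ "[:f u, f v:]"]) (auto simp: lform_add lform_scale)
qed

lemma polycurve_ray: "polycurve (\<lambda>t. t *s v)"
  using polycurve_line[of 0 v] by simp

lemma S_polycurve:
  assumes "f \<in> S" "polycurve \<gamma>"
  obtains p where "\<And>t. f (\<gamma> t) = poly p t"
proof -
  from assms(1) have "\<exists>p. \<forall>t. f (\<gamma> t) = poly p t"
  proof (induction f rule: S_induct)
    case (const c) then show ?case by (intro exI[of _ "[:c:]"]) auto
  next
    case (lform f) then show ?case using assms(2) by (auto simp: polycurve_def)
  next
    case (add f g)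
    then obtain p q where "\<forall>t. f (\<gamma> t) = poly p t" "\<forall>t. g (\<gamma> t) = poly q t" by blast
    then show ?case by (intro exI[of _ "p + q"]) auto
  next
    case (mult f g)
    then obtain p q where "\<forall>t. f (\<gamma> t) = poly p t" "\<forall>t. g (\<gamma> t) = poly q t" by blast
    then show ?case by (intro exI[of _ "p * q"]) auto
  qed
  then show ?thesis using that by blast
qed

lemma infinite_diff: "finite X \<Longrightarrow> infinite (UNIV - X :: 'k set)"
  using infinite_field by simp

lemma infinite_nonzero: "infinite {t :: 'k. t \<noteq> 0}"
proof -
  have "{t :: 'k. t \<noteq> 0} = UNIV - {0}" by auto
  then show ?thesis using infinite_diff[of "{0}"] by simp
qed

text \<open>Irreducibility of a linear subspace. The line joining a point that suits
  \<open>I\<close> to one that suits \<open>j\<close> stays in \<open>U\<close>, and on it every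
  \<open>f i\<close> is a nonzero polynomial in one variable, hence has finitely many roots.\<close>

lemma generic_point:
  assumes "finite I" "subspace U"
    and "\<And>i. i \<in> I \<Longrightarrow> f i \<in> S" "\<And>i. i \<in> I \<Longrightarrow> \<exists>u\<in>U. f i u \<noteq> 0"
  shows "\<exists>u\<in>U. \<forall>i\<in>I. f i u \<noteq> 0"
  using assms
proof (induction I rule: finite_induct)
  case empty
  then show ?case using subspace_0 by auto
next
  case (insert j I)
  from insert obtain u where u: "u \<in> U" "\<forall>i\<in>I. f i u \<noteq> 0" by auto
  from insert.prems obtain w where w: "w \<in> U" "f j w \<noteq> 0" by auto
  let ?\<gamma> = "\<lambda>t. u + t *s (w - u)"
  have "\<exists>p. \<forall>t. f i (?\<gamma> t) = poly p t" if "i \<in> insert j I" for i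
    using S_polycurve[OF _ polycurve_line] insert.prems(2)[OF that] by metis
  then obtain p where p: "\<And>i t. i \<in> insert j I \<Longrightarrow> f i (?\<gamma> t) = poly (p i) t" by metis
  have "p i \<noteq> 0" if "i \<in> insert j I" for i
  proof (cases "i = j")
    case True then show ?thesis using p[of j 1] w by auto
  next
    case False then show ?thesis using p[of i 0] that u by auto
  qed
  then have "finite (\<Union>i\<in>insert j I. {t. poly (p i) t = 0})"
    using insert.hyps by (intro finite_UN_I) (auto simp: poly_roots_finite)
  then obtain t where "t \<notin> (\<Union>i\<in>insert j I. {t. poly (p i) t = 0})"
    using infinite_field by (meson UNIV_I ex_new_if_finite)
  then have "\<forall>i\<in>insert j I. f i (?\<gamma> t) \<noteq> 0" using p by auto
  moreover have "?\<gamma> t \<in> U"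
    using u w insert.prems by (intro subspace_add subspace_scale subspace_diff) auto
  ultimately show ?case by blast
qed

lemma generic_point_UNIV:
  assumes "finite I" "\<And>i. i \<in> I \<Longrightarrow> f i \<in> S" "\<And>i. i \<in> I \<Longrightarrow> \<exists>u. f i u \<noteq> 0"
  shows "\<exists>u. \<forall>i\<in>I. f i u \<noteq> 0"
  using generic_point[OF assms(1) subspace_UNIV, of f] assms by auto

text \<open>If \<open>f\<close> were nonzero somewhere, \<open>f\<close> and \<open>g\<close> would
  be nonzero at a common point. This allows denominators to be avoided when identities are
  checked.\<close>

lemma S_zero_if_generic:
  assumes "f \<in> S" "g \<in> S" "g w \<noteq> 0" "\<And>v. g v \<noteq> 0 \<Longrightarrow> f v = 0"
  shows "f v = 0"
proof (rule ccontr)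
  assume "f v \<noteq> 0"
  then have "\<exists>u. \<forall>i\<in>{True, False}. (if i then f else g) u \<noteq> 0"
    using assms by (intro generic_point_UNIV) auto
  then show False using assms(4) by auto
qed

lemma S_eq_if_generic:
  assumes "f \<in> S" "h \<in> S" "g \<in> S" "g w \<noteq> 0" "\<And>v. g v \<noteq> 0 \<Longrightarrow> f v = h v"
  shows "f v = h v"
  using S_zero_if_generic[of "\<lambda>v. f v - h v" g w v] assms by auto

text \<open>With ?\<pi> the projection onto the kernel of \<open>l\<close> along \<open>u\<close>,
  the difference of \<open>f\<close> and its composition with ?\<pi> is divisible by
  \<open>l\<close> for every \<open>f\<close> in \<open>S\<close>; the composition is zero when
  \<open>f\<close> vanishes on the kernel.\<close>

lemma lform_dvd_if_vanishes:
  assumes l: "lform l" "l u \<noteq> 0" and f: "f \<in> S" "\<And>v. l v = 0 \<Longrightarrow> f v = 0"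
  obtains s where "s \<in> S" "\<And>v. f v = l v * s v"
proof -
  let ?u = "inverse (l u) *s u"
  have u: "l ?u = 1" using l by (simp add: lform_scale)
  let ?\<pi> = "\<lambda>v. v - l v *s ?u"
  have lp: "lmap ?\<pi>"
    using l by (auto simp: lmap_iff lform_add lform_scale algebra_simps)
  have "\<exists>s\<in>S. \<forall>v. f v - f (?\<pi> v) = l v * s v"
    using f(1)
  proof (induction f rule: S_induct)
    case (const c) show ?case by (intro bexI[of _ "\<lambda>_. 0"]) auto
  next
    case (lform f) then show ?case
      by (intro bexI[of _ "\<lambda>_. f ?u"]) (auto simp: lform_diff lform_scale)
  next
    case (add f g)
    then obtain s t where "s \<in> S" "t \<in> S" "\<forall>v. f v - f (?\<pi> v) = l v * s v"
      "\<forall>v. g v - g (?\<pi> v) = l v * t v" by blast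
    moreover have "f v + g v - (f (?\<pi> v) + g (?\<pi> v)) = (f v - f (?\<pi> v)) + (g v - g (?\<pi> v))" for v
      by simp
    ultimately show ?case
      by (intro bexI[of _ "\<lambda>v. s v + t v"]) (auto simp only: distrib_left intro: S_add)
  next
    case (mult f g)
    then obtain s t where st: "s \<in> S" "t \<in> S" "\<forall>v. f v - f (?\<pi> v) = l v * s v"
      "\<forall>v. g v - g (?\<pi> v) = l v * t v" by blast
    have "f v * g v - f w * g w = l v * (s v * g v + f w * t v)" if "w = ?\<pi> v" for v w
    proof -
      have "f v * g v - f w * g w = (f v - f w) * g v + f w * (g v - g w)" by (simp add: algebra_simps)
      then show ?thesis using st(3,4)[rule_format, of v, folded that] by (simp add: algebra_simps)
    qed
    then have "\<forall>v. f v * g v - f (?\<pi> v) * g (?\<pi> v) = l v * (s v * g v + f (?\<pi> v) * t v)" by blast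
    moreover have "(\<lambda>v. s v * g v + f (?\<pi> v) * t v) \<in> S"
      using S_add[OF S_mult[OF st(1) mult.hyps(2)] S_mult[OF S_lmap[OF mult.hyps(1) lp] st(2)]] .
    ultimately show ?case by (rule bexI)
  qed
  then obtain s where s: "s \<in> S" "\<And>v. f v - f (?\<pi> v) = l v * s v" by blast
  have "l (?\<pi> v) = 0" for v using u l by (simp add: lform_diff lform_scale)
  then have "f (?\<pi> v) = 0" for v using f(2) by blast
  then show ?thesis using that s by auto
qed

lemma subspace_lform_kernel: "lform l \<Longrightarrow> subspace {v. l v = 0}"
  by (auto simp: subspace_def lform_zero lform_add lform_scale)

end

lemma base_expansion_inj:
  fixes B :: nat
  assumes "\<forall>j<N. a j < B" "\<forall>j<N. b j < B" "(\<Sum>j<N. a j * B ^ j) = (\<Sum>j<N. b j * B ^ j)" "j < N"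
  shows "a j = b j"
  using assms
proof (induction N arbitrary: a b j)
  case (Suc N)
  have eq: "(\<Sum>j<Suc N. c j * B ^ j) = c 0 + B * (\<Sum>j<N. c (Suc j) * B ^ j)" for c
    by (subst sum.lessThan_Suc_shift) (simp add: sum_distrib_left mult_ac)
  have lt: "a 0 < B" "b 0 < B" using Suc.prems by auto
  have e: "a 0 + B * (\<Sum>j<N. a (Suc j) * B ^ j) = b 0 + B * (\<Sum>j<N. b (Suc j) * B ^ j)"
    using Suc.prems(3) unfolding eq .
  then have "(a 0 + B * (\<Sum>j<N. a (Suc j) * B ^ j)) mod B = (b 0 + B * (\<Sum>j<N. b (Suc j) * B ^ j)) mod B"
    by simp
  then have 0: "a 0 = b 0" using lt by simp
  with e lt have "(\<Sum>j<N. a (Suc j) * B ^ j) = (\<Sum>j<N. b (Suc j) * B ^ j)" by simp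
  with Suc.IH[of "\<lambda>j. a (Suc j)" "\<lambda>j. b (Suc j)"] Suc.prems have "\<forall>j<N. a (Suc j) = b (Suc j)" by auto
  with 0 Suc.prems(4) show ?case by (cases j) auto
qed simp

text \<open>By Kronecker substitution.\<close>

lemma mpoly_eq_0_if_eval_eq_0:
  fixes p :: "('i \<Rightarrow>\<^sub>0 nat) \<Rightarrow>\<^sub>0 'k::field"
  assumes inf: "infinite (UNIV :: 'k set)" and ev: "\<And>a. mpoly_eval a p = 0"
  shows "p = 0"
proof (rule ccontr)
  assume "p \<noteq> 0"
  then obtain m0 where m0: "m0 \<in> Poly_Mapping.keys p" by fastforce
  let ?l = "Poly_Mapping.lookup"
  define F where "F = (\<Union>m\<in>Poly_Mapping.keys p. Poly_Mapping.keys m)"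
  have F: "finite F" by (simp add: F_def)
  obtain e where e: "bij_betw e {0..<card F} F" using ex_bij_betw_nat_finite[OF F] by blast
  define idx where "idx = the_inv_into {0..<card F} e"
  have idx: "idx (e j) = j" if "j < card F" for j
    using e that by (auto simp: idx_def bij_betw_def the_inv_into_f_f)
  \<comment> \<open>\<open>B\<close> exceeds every exponent in \<open>p\<close>, so the exponents of
    a monomial are the base \<open>B\<close> digits of \<open>w m\<close>, and distinct monomials
    become distinct powers of \<open>t\<close>.\<close>
  define B where "B = Suc (\<Sum>m\<in>Poly_Mapping.keys p. \<Sum>i\<in>F. ?l m i)"
  have B: "?l m i < B" if "m \<in> Poly_Mapping.keys p" "i \<in> F" for m i
  proof -
    have "?l m i \<le> (\<Sum>i\<in>F. ?l m i)" using that F by (intro member_le_sum) auto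
    also have "\<dots> \<le> (\<Sum>m\<in>Poly_Mapping.keys p. \<Sum>i\<in>F. ?l m i)"
      using that by (intro member_le_sum) auto
    finally show ?thesis by (simp add: B_def)
  qed
  define w where "w m = (\<Sum>j<card F. ?l m (e j) * B ^ j)" for m :: "'i \<Rightarrow>\<^sub>0 nat"
  have w_inj: "m = m'" if m: "m \<in> Poly_Mapping.keys p" "m' \<in> Poly_Mapping.keys p" and eq: "w m = w m'" for m m'
  proof (rule poly_mapping_eqI)
    fix i
    show "?l m i = ?l m' i"
    proof (cases "i \<in> F")
      case True
      then have "i \<in> e ` {0..<card F}" using e by (simp add: bij_betw_def)
      then obtain j where j: "j < card F" "i = e j" by auto
      have "\<forall>j<card F. e j \<in> F" using e by (auto simp: bij_betw_def)
      with B m have "\<forall>j<card F. ?l m (e j) < B" "\<forall>j<card F. ?l m' (e j) < B" by auto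
      from base_expansion_inj[OF this eq[unfolded w_def] j(1)] j show ?thesis by simp
    next
      case False
      then have "i \<notin> Poly_Mapping.keys m" "i \<notin> Poly_Mapping.keys m'" using m by (auto simp: F_def)
      then show ?thesis by (simp add: in_keys_iff)
    qed
  qed
  define q where "q = (\<Sum>m\<in>Poly_Mapping.keys p. monom (?l p m) (w m))"
  have "poly q t = mpoly_eval (\<lambda>i. t ^ (B ^ idx i)) p" for t
  proof -
    have "(\<Prod>i\<in>Poly_Mapping.keys m. (t ^ (B ^ idx i)) ^ ?l m i) = t ^ w m" if "m \<in> Poly_Mapping.keys p" for m
    proof -
      have "(\<Prod>i\<in>Poly_Mapping.keys m. (t ^ (B ^ idx i)) ^ ?l m i) = (\<Prod>i\<in>F. (t ^ (B ^ idx i)) ^ ?l m i)"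
        using F that by (intro prod.mono_neutral_left) (auto simp: F_def in_keys_iff)
      also have "\<dots> = t ^ (\<Sum>i\<in>F. ?l m i * B ^ idx i)"
        by (simp add: power_sum power_mult[symmetric] mult.commute)
      also have "(\<Sum>i\<in>F. ?l m i * B ^ idx i) = (\<Sum>j=0..<card F. ?l m (e j) * B ^ idx (e j))"
        by (rule sum.reindex_bij_betw[OF e, symmetric])
      also have "\<dots> = w m" by (simp add: w_def idx atLeast0LessThan)
      finally show ?thesis .
    qed
    then show ?thesis by (simp add: q_def poly_sum poly_monom mpoly_eval_def)
  qed
  then have "poly q t = poly 0 t" for t using ev by simp
  then have "q = 0" using poly_eq_if_infinite[OF inf] by blast
  moreover have "coeff q (w m0) = (\<Sum>m\<in>Poly_Mapping.keys p. if m = m0 then ?l p m else 0)"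
    unfolding q_def coeff_sum using w_inj m0 by (intro sum.cong) auto
  then have "coeff q (w m0) = ?l p m0" using m0 by simp
  ultimately show False using m0 by (simp add: in_keys_iff)
qed

lemma generated_algebra_subset:
  assumes "F \<subseteq> generated_algebra F'"
  shows "generated_algebra F \<subseteq> generated_algebra F'"
proof
  fix f assume "f \<in> generated_algebra F"
  then show "f \<in> generated_algebra F'"
    by (induction rule: generated_algebra.induct) (use assms in \<open>auto intro: generated_algebra.intros\<close>)
qed

text \<open>Pads with the zero function to exactly \<open>n\<close> generators, so that the Jacobian
  matrix is square.\<close>

lemma indexed_generators:
  fixes F :: "('v \<Rightarrow> 'k::field) set"
  assumes "finite F" "card F \<le> n"
  obtains f where "F \<subseteq> f ` {..<n}" "f ` {..<n} \<subseteq> insert (\<lambda>_. 0) F"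
    "generated_algebra (f ` {..<n}) = generated_algebra F"
proof -
  obtain e where e: "bij_betw e {0..<card F} F" using ex_bij_betw_nat_finite[OF assms(1)] by blast
  define f where "f i = (if i < card F then e i else (\<lambda>_. 0))" for i
  have 1: "F \<subseteq> f ` {..<n}"
  proof
    fix y assume "y \<in> F"
    then have "y \<in> e ` {0..<card F}" using e by (simp add: bij_betw_def)
    then obtain i where "i < card F" "y = e i" by auto
    then show "y \<in> f ` {..<n}" using assms(2) by (intro image_eqI[of _ _ i]) (auto simp: f_def)
  qed
  have 2: "f ` {..<n} \<subseteq> insert (\<lambda>_. 0) F" using e by (auto simp: f_def bij_betw_def)
  have "insert (\<lambda>_. 0) F \<subseteq> generated_algebra F"
    by (auto intro: generated_algebra.intros)
  with 2 have "f ` {..<n} \<subseteq> generated_algebra F" by (rule order_trans)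
  moreover have "F \<subseteq> generated_algebra (f ` {..<n})" using 1 by (auto intro: generated_algebra.intros)
  ultimately have "generated_algebra (f ` {..<n}) = generated_algebra F"
    using generated_algebra_subset by blast
  then show ?thesis using that 1 2 by blast
qed

section \<open>Coordinates and generic linear forms\<close>

context polynomial_space
begin

definition coords :: "(nat \<Rightarrow> 'v \<Rightarrow> 'k) \<Rightarrow> (nat \<Rightarrow> 'v) \<Rightarrow> bool" where
  "coords x b \<longleftrightarrow> (\<forall>j<n. lform (x j)) \<and> (\<forall>v. (\<Sum>j<n. x j v *s b j) = v) \<and>
    (\<forall>i<n. \<forall>j<n. x i (b j) = (if i = j then 1 else 0))"

lemma coords_lform: "coords x b \<Longrightarrow> j < n \<Longrightarrow> lform (x j)"
  and coords_sum: "coords x b \<Longrightarrow> (\<Sum>j<n. x j v *s b j) = v"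
  and coords_basis: "coords x b \<Longrightarrow> i < n \<Longrightarrow> j < n \<Longrightarrow> x i (b j) = (if i = j then 1 else 0)"
  by (auto simp: coords_def)

lemma coords_eqI: "coords x b \<Longrightarrow> (\<And>j. j < n \<Longrightarrow> x j u = x j v) \<Longrightarrow> u = v"
  using coords_sum[of x b u] coords_sum[of x b v] by (metis (no_types, lifting) lessThan_iff sum.cong)

lemma coords_combination: "coords x b \<Longrightarrow> i < n \<Longrightarrow> x i (\<Sum>j<n. c j *s b j) = c i"
  by (simp add: lform_sum coords_lform lform_scale coords_basis if_distrib[of "(*) _"] cong: if_cong)

lemma coords_lform_expand: "coords x b \<Longrightarrow> lform f \<Longrightarrow> f v = (\<Sum>j<n. x j v * f (b j))"
  using lform_sum[of f "\<lambda>j. x j v *s b j" "{..<n}"] coords_sum[of x b v] by (simp add: lform_scale)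

lemma coords_exist: "\<exists>x b. coords x b"
proof -
  obtain e where e: "bij_betw e {0..<n} Basis" using ex_bij_betw_nat_finite[OF finite_Basis] by blast
  define x where "x j v = representation Basis v (e j)" for j v
  have e': "e j \<in> Basis" if "j < n" for j using e that by (auto simp: bij_betw_def)
  have "(\<Sum>j<n. x j v *s e j) = v" for v
  proof -
    have "(\<Sum>j<n. x j v *s e j) = (\<Sum>j=0..<n. representation Basis v (e j) *s e j)"
      by (simp add: x_def atLeast0LessThan)
    also have "\<dots> = (\<Sum>u\<in>Basis. representation Basis v u *s u)"
      by (rule sum.reindex_bij_betw[OF e])
    also have "\<dots> = v"
      using independent_Basis span_Basis finite_Basis by (intro sum_representation_eq) auto
    finally show ?thesis .
  qed
  moreover have "lform (x j)" for j
    using independent_Basis span_Basis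
    by (auto simp: lform_iff x_def representation_add representation_scale)
  moreover have "x i (e j) = (if i = j then 1 else 0)" if "i < n" "j < n" for i j
  proof -
    have "e i = e j \<longleftrightarrow> i = j" using e that by (auto simp: bij_betw_def inj_on_def)
    then show ?thesis using e' that independent_Basis
      by (auto simp: x_def representation_basis)
  qed
  ultimately show ?thesis by (intro exI[of _ x] exI[of _ e]) (auto simp: coords_def)
qed

text \<open>\<open>T\<close> sends \<open>v\<close> to the vector with coordinates
  \<open>y j v\<close>. It is injective, hence surjective, and the preimages of the old basis form
  the basis dual to \<open>y\<close>.\<close>

lemma coords_of_lforms:
  assumes y: "\<And>j. j < n \<Longrightarrow> lform (y j)" and inj: "\<And>v. (\<And>j. j < n \<Longrightarrow> y j v = 0) \<Longrightarrow> v = 0"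
  obtains b where "coords y b"
proof -
  obtain x e where x: "coords x e" using coords_exist by blast
  define T where "T v = (\<Sum>j<n. y j v *s e j)" for v
  have T: "lmap T"
    using y by (auto simp: lmap_iff T_def lform_add lform_scale scale_left_distrib sum.distrib scale_sum_right)
  have yT: "y j v = x j (T v)" if "j < n" for j v
    using coords_combination[OF x that] by (simp add: T_def)
  have "inj T"
  proof (rule injI)
    fix u v assume "T u = T v"
    then have "y j (u - v) = 0" if "j < n" for j using that y yT by (simp add: lform_diff)
    then show "u = v" using inj[of "u - v"] by simp
  qed
  then have "surj T" using linear_inj_imp_surj T by blast
  define b where "b j = inv_into UNIV T (e j)" for j
  have Tb: "T (b j) = e j" for j using \<open>surj T\<close> by (simp add: b_def surj_f_inv_f)
  have yb: "y i (b j) = (if i = j then 1 else 0)" if "i < n" "j < n" for i j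
    using that by (simp add: yT Tb coords_basis[OF x])
  have "(\<Sum>j<n. y j v *s b j) - v = 0" for v
  proof (rule inj)
    fix i assume i: "i < n"
    have "y i (\<Sum>j<n. y j v *s b j) = (\<Sum>j<n. y j v * (if i = j then 1 else 0))"
      using i y yb by (simp add: lform_sum lform_scale)
    then show "y i ((\<Sum>j<n. y j v *s b j) - v) = 0" using i y
      by (simp add: lform_diff if_distrib[of "(*) _"] cong: if_cong)
  qed
  then show ?thesis using y yb by (intro that[of b]) (simp add: coords_def)
qed

text \<open>The forms \<open>v \<mapsto> \<Sum>\<^sub>j t\<^sup>j x\<^sub>j(v)\<close> for \<open>n\<close> distinct values of \<open>t\<close> are a basis of \<open>V\<^sup>*\<close> (Vandermonde).\<close>

lemma generic_coords:
  assumes "finite X" "0 \<notin> X"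
  obtains x b where "coords x b" "\<And>j v. j < n \<Longrightarrow> v \<in> X \<Longrightarrow> x j v \<noteq> 0"
proof -
  obtain x b where x: "coords x b" using coords_exist by blast
  define p where "p v = (\<Sum>j<n. monom (x j v) j)" for v
  have coeff_p: "coeff (p v) j = (if j < n then x j v else 0)" for v j
    by (simp add: p_def coeff_sum if_distrib cong: if_cong)
  have p0: "v = 0" if "p v = 0" for v
  proof (rule coords_eqI[OF x])
    fix j assume j: "j < n"
    then have "x j v = coeff (p v) j" by (simp add: coeff_p)
    then show "x j v = x j 0" using j that lform_zero[OF coords_lform[OF x]] by simp
  qed
  have "finite (\<Union>v\<in>X. {t. poly (p v) t = 0})"
    using assms p0 by (intro finite_UN_I poly_roots_finite) auto
  then have "infinite (UNIV - (\<Union>v\<in>X. {t. poly (p v) t = 0}))" by (rule infinite_diff)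
  \<comment> \<open>Parameters that are roots of no \<open>p v\<close> give forms that vanish
    nowhere on \<open>X\<close>.\<close>
  then obtain T where T: "finite T" "card T = n" "T \<subseteq> UNIV - (\<Union>v\<in>X. {t. poly (p v) t = 0})"
    by (meson infinite_arbitrarily_large)
  obtain e where e: "bij_betw e {0..<n} T" using ex_bij_betw_nat_finite[OF T(1)] T(2) by auto
  define y where "y j v = poly (p v) (e j)" for j v
  have y: "y j v = (\<Sum>i<n. x i v * e j ^ i)" for j v by (simp add: y_def p_def poly_sum poly_monom)
  have "y j (u + v) = y j u + y j v" "y j (c *s v) = c * y j v" for j u v c
    unfolding y sum_distrib_left sum.distrib[symmetric]
    by (intro sum.cong; simp add: lform_add[OF coords_lform[OF x]] lform_scale[OF coords_lform[OF x]]
        distrib_right)+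
  then have "lform (y j)" for j by (simp add: lform_iff)
  \<comment> \<open>A nonzero common zero \<open>v\<close> would give the nonzero polynomial
    \<open>p v\<close>, of degree less than \<open>n\<close>, all \<open>n\<close> elements of
    \<open>T\<close> as roots.\<close>
  moreover have "v = 0" if v: "\<And>j. j < n \<Longrightarrow> y j v = 0" for v
  proof (rule ccontr)
    assume "v \<noteq> 0"
    then have "p v \<noteq> 0" using p0 by blast
    have "T \<subseteq> {t. poly (p v) t = 0}" using v e by (auto simp: y_def bij_betw_def)
    from card_mono[OF poly_roots_finite[OF \<open>p v \<noteq> 0\<close>] this]
    have "n \<le> card {t. poly (p v) t = 0}" by (simp add: T(2))
    also have "\<dots> \<le> degree (p v)" using \<open>p v \<noteq> 0\<close> by (rule card_poly_roots_bound)
    finally have "coeff (p v) (degree (p v)) = 0" by (simp add: coeff_p)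
    then show False using \<open>p v \<noteq> 0\<close> by simp
  qed
  ultimately obtain c where "coords y c" using coords_of_lforms by blast
  moreover have "y j v \<noteq> 0" if "j < n" "v \<in> X" for j v
  proof -
    have "e j \<in> T" using e that by (auto simp: bij_betw_def)
    then show ?thesis using T(3) that by (auto simp: y_def)
  qed
  ultimately show ?thesis using that by blast
qed

lemma separating_lform:
  fixes X :: "'v set"
  assumes "finite X" "0 \<notin> X"
  obtains l where "lform l" "\<And>v. v \<in> X \<Longrightarrow> l v \<noteq> 0"
proof -
  obtain x b where x: "coords x b" "\<And>j v. j < n \<Longrightarrow> v \<in> X \<Longrightarrow> x j v \<noteq> 0"
    using generic_coords[OF assms] by blast
  show ?thesis
  proof (cases "n = 0")
    case True
    then have "v = 0" for v :: 'v using coords_sum[OF x(1), of v] by simp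
    then have "X = {}" using assms(2) by (metis ex_in_conv)
    moreover have "lform (\<lambda>_. 0)" by (auto simp: lform_iff)
    ultimately show ?thesis using that by blast
  next
    case False
    then show ?thesis using that[of "x 0"] x coords_lform[OF x(1)] by auto
  qed
qed

text \<open>\<open>D\<close> bounds each exponent separately, not the total degree: the monomials
  are then indexed by a box, whose size is a plain power.\<close>

inductive_set monomial_span :: "(nat \<Rightarrow> 'v \<Rightarrow> 'k) \<Rightarrow> nat \<Rightarrow> ('v \<Rightarrow> 'k) set" for x D where
  monomial: "(\<And>j. j < n \<Longrightarrow> \<kappa> j \<le> D) \<Longrightarrow> (\<lambda>v. c * (\<Prod>j<n. x j v ^ \<kappa> j)) \<in> monomial_span x D"
| add: "f \<in> monomial_span x D \<Longrightarrow> g \<in> monomial_span x D \<Longrightarrow> (\<lambda>v. f v + g v) \<in> monomial_span x D"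

lemma monomial_span_const: "(\<lambda>_. c) \<in> monomial_span x D"
  using monomial_span.monomial[of "\<lambda>_. 0" D c x] by simp

lemma monomial_span_mono: "f \<in> monomial_span x D \<Longrightarrow> D \<le> E \<Longrightarrow> f \<in> monomial_span x E"
  by (induction rule: monomial_span.induct) (auto intro!: monomial_span.intros intro: order_trans)

lemma monomial_span_mult:
  assumes "f \<in> monomial_span x D" "g \<in> monomial_span x E"
  shows "(\<lambda>v. f v * g v) \<in> monomial_span x (D + E)"
  using assms(1)
proof (induction rule: monomial_span.induct)
  case (monomial \<kappa> c)
  note k = this
  show ?case using assms(2)
  proof (induction rule: monomial_span.induct)
    case (monomial \<mu> d)
    have "(\<lambda>v. c * (\<Prod>j<n. x j v ^ \<kappa> j) * (d * (\<Prod>j<n. x j v ^ \<mu> j)))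
      = (\<lambda>v. c * d * (\<Prod>j<n. x j v ^ (\<kappa> j + \<mu> j)))"
      by (simp add: power_add prod.distrib mult_ac)
    also have "\<dots> \<in> monomial_span x (D + E)"
      using k monomial by (intro monomial_span.monomial) (simp add: add_mono)
    finally show ?case .
  next
    case (add f g)
    then show ?case using monomial_span.add by (fastforce simp: distrib_left)
  qed
next
  case (add f g)
  then show ?case using monomial_span.add by (fastforce simp: distrib_right)
qed

lemma monomial_span_power: "f \<in> monomial_span x D \<Longrightarrow> (\<lambda>v. f v ^ k) \<in> monomial_span x (k * D)"
proof (induction k)
  case 0 then show ?case using monomial_span_const[of 1 x] by simp
next
  case (Suc k)
  then show ?case using monomial_span_mult[of f x D "\<lambda>v. f v ^ k"] by simp
qed

lemma monomial_span_prod: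
  assumes "finite I" "\<And>i. i \<in> I \<Longrightarrow> f i \<in> monomial_span x D"
  shows "(\<lambda>v. \<Prod>i\<in>I. f i v) \<in> monomial_span x (card I * D)"
  using assms
proof (induction I rule: finite_induct)
  case empty then show ?case using monomial_span_const[of 1 x] by simp
next
  case (insert i I)
  then show ?case using monomial_span_mult[of "f i" x D "\<lambda>v. \<Prod>i\<in>I. f i v" "card I * D"] by simp
qed

lemma S_monomial_span:
  assumes x: "coords x b" and "f \<in> S"
  obtains D where "f \<in> monomial_span x D"
proof -
  from assms(2) have "\<exists>D. f \<in> monomial_span x D"
  proof (induction f rule: S_induct)
    case (const c) show ?case using monomial_span_const by blast
  next
    case (lform f)
    have "(\<lambda>v. \<Sum>i\<in>I. f (b i) * x i v) \<in> monomial_span x 1" if "finite I" "I \<subseteq> {..<n}" for I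
      using that
    proof (induction I rule: finite_induct)
      case empty show ?case using monomial_span_const[of 0] by simp
    next
      case (insert i I)
      then have i: "i < n" by simp
      have "x i v ^ 1 = (\<Prod>j<n. x j v ^ (if j = i then 1 else 0))" for v
      proof -
        have "(\<Prod>j<n. x j v ^ (if j = i then 1 else 0)) = (\<Prod>j<n. if j = i then x j v else 1)"
          by (intro prod.cong) auto
        then show ?thesis using i by simp
      qed
      then have "(\<lambda>v. f (b i) * x i v) \<in> monomial_span x 1"
        using monomial_span.monomial[of "\<lambda>j. if j = i then 1 else 0" 1 "f (b i)" x] by simp
      then show ?case using insert monomial_span.add by fastforce
    qed
    then have "(\<lambda>v. \<Sum>i<n. f (b i) * x i v) \<in> monomial_span x 1" by simp
    moreover have "f = (\<lambda>v. \<Sum>i<n. f (b i) * x i v)"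
      by (rule ext, subst coords_lform_expand[OF x lform]) (rule sum.cong, simp_all add: mult.commute)
    ultimately show ?case by (intro exI[of _ 1]) simp
  next
    case (add f g)
    then obtain D E where "f \<in> monomial_span x D" "g \<in> monomial_span x E" by blast
    then have "f \<in> monomial_span x (D + E)" "g \<in> monomial_span x (D + E)"
      using monomial_span_mono le_add1 le_add2 by blast+
    then show ?case using monomial_span.add by blast
  next
    case (mult f g)
    then show ?case using monomial_span_mult by blast
  qed
  then show ?thesis using that by blast
qed

lemma monomial_span_coeffs:
  assumes "f \<in> monomial_span x D"
  shows "\<exists>c. \<forall>v. f v = (\<Sum>\<kappa>\<in>{..<n} \<rightarrow>\<^sub>E {..D}. c \<kappa> * (\<Prod>j<n. x j v ^ \<kappa> j))"
  using assms
proof (induction rule: monomial_span.induct)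
  case (monomial \<kappa> c)
  let ?k = "restrict \<kappa> {..<n}"
  let ?P = "{..<n} \<rightarrow>\<^sub>E {..D}"
  have k: "?k \<in> ?P" "finite ?P" using monomial by (auto intro: finite_PiE)
  have "(\<Sum>\<mu>\<in>?P. (if \<mu> = ?k then c else 0) * (\<Prod>j<n. x j v ^ \<mu> j)) = c * (\<Prod>j<n. x j v ^ \<kappa> j)" for v
  proof -
    have "(\<Sum>\<mu>\<in>?P. (if \<mu> = ?k then c else 0) * (\<Prod>j<n. x j v ^ \<mu> j))
        = (\<Sum>\<mu>\<in>?P. if \<mu> = ?k then c * (\<Prod>j<n. x j v ^ \<mu> j) else 0)"
      by (intro sum.cong) auto
    also have "\<dots> = c * (\<Prod>j<n. x j v ^ ?k j)" using k by simp
    finally show ?thesis by simp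
  qed
  then show ?case by (intro exI[of _ "\<lambda>\<mu>. if \<mu> = ?k then c else 0"]) simp
next
  case (add f g)
  then obtain c d where "\<forall>v. f v = (\<Sum>\<kappa>\<in>{..<n} \<rightarrow>\<^sub>E {..D}. c \<kappa> * (\<Prod>j<n. x j v ^ \<kappa> j))"
    "\<forall>v. g v = (\<Sum>\<kappa>\<in>{..<n} \<rightarrow>\<^sub>E {..D}. d \<kappa> * (\<Prod>j<n. x j v ^ \<kappa> j))" by blast
  then show ?case by (intro exI[of _ "\<lambda>\<kappa>. c \<kappa> + d \<kappa>"]) (simp add: distrib_right sum.distrib)
qed

text \<open>
  Among the products of powers with exponents \<open>< N\<close> of \<open>n + 1\<close> polynomials of degree \<open>D\<close> there is a
  linear relation for large \<open>N\<close>, as there are \<open>N\<^sup>n\<^sup>+\<^sup>1\<close> of them in a space of dimension \<open>O(N\<^sup>n)\<close>.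
\<close>

lemma algebraically_independent_card_le:
  assumes "F \<subseteq> S" "algebraically_independent F"
  shows "finite F" "card F \<le> n"
proof -
  have "\<not> (\<exists>F'\<subseteq>F. finite F' \<and> card F' = Suc n)"
  proof
    assume "\<exists>F'\<subseteq>F. finite F' \<and> card F' = Suc n"
    then obtain F' where F': "F' \<subseteq> F" "finite F'" "card F' = Suc n" by blast
    obtain x b where x: "coords x b" using coords_exist by blast
    have "\<exists>D. f \<in> monomial_span x D" if "f \<in> F'" for f
      using S_monomial_span[OF x] F'(1) assms(1) that by (meson subsetD)
    then obtain d where d: "\<And>f. f \<in> F' \<Longrightarrow> f \<in> monomial_span x (d f)" by metis
    define D where "D = (\<Sum>f\<in>F'. d f)"
    have D: "f \<in> monomial_span x D" if "f \<in> F'" for f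
      using d[OF that] by (rule monomial_span_mono) (use that F' in \<open>auto simp: D_def intro: member_le_sum\<close>)
    \<comment> \<open>The products in question have coordinate exponents at most \<open>E\<close>,
      and \<open>Suc E \<le> N * K\<close>. So they lie in the span of at most
      \<open>N ^ n * K ^ n\<close> monomials, which is less than their number
      \<open>N ^ Suc n\<close> because \<open>N\<close> exceeds \<open>K ^ n\<close>.\<close>
    define K where "K = Suc n * D + 1"
    define N where "N = Suc (K ^ n)"
    define E where "E = Suc n * (N * D)"
    define \<phi> where "\<phi> \<alpha> = Abs_poly_mapping (\<lambda>f. if f \<in> F' then \<alpha> f else (0::nat))" for \<alpha> :: "('v \<Rightarrow> 'k) \<Rightarrow> nat"
    have \<phi>: "Poly_Mapping.lookup (\<phi> \<alpha>) f = (if f \<in> F' then \<alpha> f else 0)" for \<alpha> f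
      unfolding \<phi>_def using F'(2) by (subst lookup_Abs_poly_mapping) (auto intro: finite_subset[of _ F'])
    define P where "P = F' \<rightarrow>\<^sub>E {..<N}"
    define T where "T = \<phi> ` P"
    have "inj_on \<phi> P"
    proof (rule inj_onI)
      fix \<alpha> \<beta> assume "\<alpha> \<in> P" "\<beta> \<in> P" "\<phi> \<alpha> = \<phi> \<beta>"
      moreover have "\<alpha> f = \<beta> f" if "f \<in> F'" for f
        using \<phi>[of \<alpha> f] \<phi>[of \<beta> f] \<open>\<phi> \<alpha> = \<phi> \<beta>\<close> that by simp
      ultimately show "\<alpha> = \<beta>" unfolding P_def by (blast intro: PiE_ext)
    qed
    then have cT: "finite T" "card T = N ^ Suc n"
      using F' by (auto simp: T_def P_def card_image card_PiE intro: finite_PiE)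
    let ?R = "{..<n} \<rightarrow>\<^sub>E {..E}"
    have cR: "finite ?R" "card ?R = Suc E ^ n" by (auto simp: card_PiE intro: finite_PiE)
    have "Suc E \<le> N * K" by (simp add: E_def K_def N_def algebra_simps)
    then have "Suc E ^ n \<le> N ^ n * K ^ n" by (metis power_mono power_mult_distrib zero_le)
    also have "\<dots> < N ^ n * N" by (simp add: N_def)
    finally have lt: "card ?R < card T" using cR cT by (simp add: mult.commute)
    have "\<exists>c. \<forall>v. (\<Prod>f\<in>F'. f v ^ Poly_Mapping.lookup m f) = (\<Sum>\<kappa>\<in>?R. c \<kappa> * (\<Prod>j<n. x j v ^ \<kappa> j))"
      if "m \<in> T" for m
    proof (rule monomial_span_coeffs)
      have "Poly_Mapping.lookup m f \<le> N" if "f \<in> F'" for f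
        using \<open>m \<in> T\<close> that by (auto simp: T_def \<phi> P_def PiE_iff intro: less_imp_le)
      then have "(\<lambda>v. f v ^ Poly_Mapping.lookup m f) \<in> monomial_span x (N * D)" if "f \<in> F'" for f
        using monomial_span_mono[OF monomial_span_power[OF D[OF that]]] that by (meson mult_le_mono1)
      from monomial_span_prod[OF F'(2) this] F'(3)
      show "(\<lambda>v. \<Prod>f\<in>F'. f v ^ Poly_Mapping.lookup m f) \<in> monomial_span x E" by (simp add: E_def)
    qed
    then have "\<forall>m\<in>T. \<exists>c. \<forall>v. (\<Prod>f\<in>F'. f v ^ Poly_Mapping.lookup m f) = (\<Sum>\<kappa>\<in>?R. c \<kappa> * (\<Prod>j<n. x j v ^ \<kappa> j))"
      by blast
    from bchoice[OF this] obtain A where A: "\<And>m v. m \<in> T \<Longrightarrow>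
        (\<Prod>f\<in>F'. f v ^ Poly_Mapping.lookup m f) = (\<Sum>\<kappa>\<in>?R. A m \<kappa> * (\<Prod>j<n. x j v ^ \<kappa> j))" by blast
    obtain c where c: "\<exists>m\<in>T. c m \<noteq> 0" "\<And>\<kappa>. \<kappa> \<in> ?R \<Longrightarrow> (\<Sum>m\<in>T. c m * A m \<kappa>) = 0"
      using underdetermined_system[OF cR(1) cT(1) lt, of A] by blast
    define p where "p = Abs_poly_mapping (\<lambda>m. if m \<in> T then c m else 0)"
    have p: "Poly_Mapping.lookup p m = (if m \<in> T then c m else 0)" for m
      unfolding p_def using cT(1) by (subst lookup_Abs_poly_mapping) (auto intro: finite_subset[of _ T])
    have keys_p: "Poly_Mapping.keys p \<subseteq> T" by (auto simp: in_keys_iff p split: if_splits)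
    have keys_m: "Poly_Mapping.keys m \<subseteq> F'" if "m \<in> T" for m
      using that by (auto simp: T_def in_keys_iff \<phi> split: if_splits)
    have "mpoly_eval (\<lambda>f. f v) p = 0" for v
    proof -
      have "mpoly_eval (\<lambda>f. f v) p
        = (\<Sum>m\<in>T. c m * (\<Prod>f\<in>Poly_Mapping.keys m. f v ^ Poly_Mapping.lookup m f))"
        unfolding mpoly_eval_def using keys_p cT(1)
        by (intro sum.mono_neutral_cong_left) (auto simp: p in_keys_iff)
      also have "\<dots> = (\<Sum>m\<in>T. c m * (\<Prod>f\<in>F'. f v ^ Poly_Mapping.lookup m f))"
      proof (intro sum.cong refl arg_cong[where f = "(*) _"])
        fix m assume "m \<in> T"
        then show "(\<Prod>f\<in>Poly_Mapping.keys m. f v ^ Poly_Mapping.lookup m f) = (\<Prod>f\<in>F'. f v ^ Poly_Mapping.lookup m f)"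
          using keys_m F'(2) by (intro prod.mono_neutral_left) (auto simp: in_keys_iff)
      qed
      also have "\<dots> = (\<Sum>m\<in>T. \<Sum>\<kappa>\<in>?R. c m * A m \<kappa> * (\<Prod>j<n. x j v ^ \<kappa> j))"
        by (simp add: A sum_distrib_left mult.assoc)
      also have "\<dots> = (\<Sum>\<kappa>\<in>?R. (\<Sum>m\<in>T. c m * A m \<kappa>) * (\<Prod>j<n. x j v ^ \<kappa> j))"
        by (subst sum.swap) (simp add: sum_distrib_right)
      also have "\<dots> = 0" using c(2) by simp
      finally show ?thesis .
    qed
    moreover have "\<forall>m\<in>Poly_Mapping.keys p. Poly_Mapping.keys m \<subseteq> F" using keys_p keys_m F'(1) by blast
    ultimately have "p = 0" using assms(2) unfolding algebraically_independent_def by blast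
    moreover obtain m where "m \<in> T" "c m \<noteq> 0" using c(1) by blast
    ultimately show False using p[of m] by simp
  qed
  then show "finite F" "card F \<le> n"
    by (metis infinite_arbitrarily_large, metis card.infinite le0 not_less_eq_eq obtain_subset_with_card_n)
qed

text \<open>The polynomial functions of a pair of points, the home of the difference quotients. They
  are curried, so that each argument separately gives elements of \<open>S\<close>.\<close>

inductive_set bipoly :: "('v \<Rightarrow> 'v \<Rightarrow> 'k) set" where
  left: "f \<in> S \<Longrightarrow> (\<lambda>y v. f y) \<in> bipoly"
| right: "f \<in> S \<Longrightarrow> (\<lambda>y v. f v) \<in> bipoly"
| add: "F \<in> bipoly \<Longrightarrow> F' \<in> bipoly \<Longrightarrow> (\<lambda>y v. F y v + F' y v) \<in> bipoly"
| mult: "F \<in> bipoly \<Longrightarrow> F' \<in> bipoly \<Longrightarrow> (\<lambda>y v. F y v * F' y v) \<in> bipoly"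

lemma bipoly_const: "(\<lambda>y v. c) \<in> bipoly"
  using bipoly.left[OF S_const] .

lemma bipoly_diff:
  assumes "F \<in> bipoly" "F' \<in> bipoly"
  shows "(\<lambda>y v. F y v - F' y v) \<in> bipoly"
  using bipoly.add[OF assms(1) bipoly.mult[OF bipoly_const[of "-1"] assms(2)]] by simp

lemma bipoly_sum: "(\<And>i. i \<in> I \<Longrightarrow> F i \<in> bipoly) \<Longrightarrow> (\<lambda>y v. \<Sum>i\<in>I. F i y v) \<in> bipoly"
  by (induction I rule: infinite_finite_induct) (auto intro: bipoly_const bipoly.add)

lemma bipoly_prod: "(\<And>i. i \<in> I \<Longrightarrow> F i \<in> bipoly) \<Longrightarrow> (\<lambda>y v. \<Prod>i\<in>I. F i y v) \<in> bipoly"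
  by (induction I rule: infinite_finite_induct) (auto intro: bipoly_const bipoly.mult)

lemma bipoly_diag: "F \<in> bipoly \<Longrightarrow> (\<lambda>v. F v v) \<in> S"
  by (induction rule: bipoly.induct) auto

lemma bipoly_S_left: "F \<in> bipoly \<Longrightarrow> (\<lambda>y. F y v) \<in> S"
  by (induction rule: bipoly.induct) auto

lemma bipoly_S_right: "F \<in> bipoly \<Longrightarrow> (\<lambda>v. F y v) \<in> S"
  by (induction rule: bipoly.induct) auto

text \<open>A normal form for \<open>bipoly\<close>, suited to statements that are additive in the
  function and let factors depending on the second point pass through a sum.\<close>

inductive_set tensors :: "('v \<Rightarrow> 'v \<Rightarrow> 'k) set" where
  tensor: "f \<in> S \<Longrightarrow> g \<in> S \<Longrightarrow> (\<lambda>y v. f y * g v) \<in> tensors"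
| add: "F \<in> tensors \<Longrightarrow> F' \<in> tensors \<Longrightarrow> (\<lambda>y v. F y v + F' y v) \<in> tensors"

lemma tensors_mult:
  assumes "F \<in> tensors" "F' \<in> tensors"
  shows "(\<lambda>y v. F y v * F' y v) \<in> tensors"
  using assms(1)
proof (induction rule: tensors.induct)
  case (tensor f g)
  note fg = this
  show ?case using assms(2)
  proof (induction rule: tensors.induct)
    case (tensor f' g')
    have "(\<lambda>y v. f y * g v * (f' y * g' v)) = (\<lambda>y v. (f y * f' y) * (g v * g' v))"
      by (simp add: mult_ac)
    then show ?case using tensors.tensor[OF S_mult[OF fg(1) tensor(1)] S_mult[OF fg(2) tensor(2)]] by simp
  next
    case (add F F')
    then show ?case using tensors.add[OF add.IH] by (simp add: distrib_left)
  qed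
next
  case (add F F')
  then show ?case using tensors.add[OF add.IH] by (simp add: distrib_right)
qed

lemma bipoly_tensors: "F \<in> bipoly \<Longrightarrow> F \<in> tensors"
proof (induction rule: bipoly.induct)
  case (left f) then show ?case using tensors.tensor[OF left S_const[of 1]] by simp
next
  case (right f) then show ?case using tensors.tensor[OF S_const[of 1] right] by simp
qed (auto intro: tensors.add tensors_mult)

lemma bipoly_det:
  assumes "\<And>i j. i < m \<Longrightarrow> j < m \<Longrightarrow> F i j \<in> bipoly"
  shows "(\<lambda>y v. det (mat m m (\<lambda>(i, j). F i j y v))) \<in> bipoly"
proof -
  let ?P = "{p. p permutes {0..<m}}"
  have "det (mat m m (\<lambda>(i, j). F i j y v)) = (\<Sum>p\<in>?P. signof p * (\<Prod>i=0..<m. F i (p i) y v))" for y v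
    unfolding det_def
    by (auto intro!: sum.cong prod.cong simp: permutes_in_image[of _ "{0..<m}", simplified])
  moreover have "(\<lambda>y v. \<Sum>p\<in>?P. signof p * (\<Prod>i=0..<m. F i (p i) y v)) \<in> bipoly"
    by (intro bipoly_sum bipoly.mult bipoly_const bipoly_prod assms)
      (auto simp: permutes_in_image[of _ "{0..<m}", simplified])
  ultimately show ?thesis by simp
qed

section \<open>Homogeneous parts\<close>

text \<open>Elements of \<open>S\<close> are bare functions. Their homogeneous components are the
  coefficients of \<open>f (t *s v)\<close> as a polynomial in \<open>t\<close>, which is unique
  since the field is infinite.\<close>

definition ray :: "('v \<Rightarrow> 'k) \<Rightarrow> 'v \<Rightarrow> 'k poly" where
  "ray f v = (THE p. \<forall>t. poly p t = f (t *s v))"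

definition hpart :: "nat \<Rightarrow> ('v \<Rightarrow> 'k) \<Rightarrow> 'v \<Rightarrow> 'k" where
  "hpart d f v = coeff (ray f v) d"

definition homogeneous :: "nat \<Rightarrow> ('v \<Rightarrow> 'k) \<Rightarrow> bool" where
  "homogeneous d f \<longleftrightarrow> f \<in> S \<and> (\<forall>t v. f (t *s v) = t ^ d * f v)"

lemma ray_eqI: "(\<And>t. poly p t = f (t *s v)) \<Longrightarrow> ray f v = p"
  unfolding ray_def by (rule the_equality) (auto intro: poly_eq_if_infinite[OF infinite_field])

lemma poly_ray: "f \<in> S \<Longrightarrow> poly (ray f v) t = f (t *s v)"
  by (metis S_polycurve polycurve_ray ray_eqI)

lemma ray_add: "f \<in> S \<Longrightarrow> g \<in> S \<Longrightarrow> ray (\<lambda>v. f v + g v) v = ray f v + ray g v"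
  and ray_mult: "f \<in> S \<Longrightarrow> g \<in> S \<Longrightarrow> ray (\<lambda>v. f v * g v) v = ray f v * ray g v"
  and ray_const: "ray (\<lambda>_. c) v = [:c:]"
  and ray_lform: "lform f \<Longrightarrow> ray f v = [:0, f v:]"
  by (auto intro!: ray_eqI simp: poly_ray lform_scale)

lemma hpart_add: "f \<in> S \<Longrightarrow> g \<in> S \<Longrightarrow> hpart d (\<lambda>v. f v + g v) = (\<lambda>v. hpart d f v + hpart d g v)"
  and hpart_mult: "f \<in> S \<Longrightarrow> g \<in> S \<Longrightarrow>
    hpart d (\<lambda>v. f v * g v) = (\<lambda>v. \<Sum>i\<le>d. hpart i f v * hpart (d - i) g v)"
  and hpart_const: "hpart d (\<lambda>_. c) = (\<lambda>_. if d = 0 then c else 0)"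
  and hpart_lform: "lform f \<Longrightarrow> hpart d f = (if d = 1 then f else (\<lambda>_. 0))"
  by (auto simp: hpart_def fun_eq_iff ray_add ray_mult ray_const ray_lform coeff_mult coeff_pCons
      split: nat.splits)

lemma hpart_cmult: "f \<in> S \<Longrightarrow> hpart d (\<lambda>v. c * f v) = (\<lambda>v. c * hpart d f v)"
  unfolding hpart_def by (auto simp: fun_eq_iff ray_mult ray_const)

lemma hpart_sum:
  "(\<And>i. i \<in> I \<Longrightarrow> f i \<in> S) \<Longrightarrow> hpart d (\<lambda>v. \<Sum>i\<in>I. f i v) = (\<lambda>v. \<Sum>i\<in>I. hpart d (f i) v)"
  by (induction I rule: infinite_finite_induct) (auto simp: hpart_const hpart_add S_sum)

lemma hpart_S: "f \<in> S \<Longrightarrow> hpart d f \<in> S"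
proof (induction f arbitrary: d rule: S_induct)
  case (mult f g)
  show ?case unfolding hpart_mult[OF mult.hyps] by (intro S_sum S_mult mult.IH)
qed (auto simp: hpart_const hpart_lform hpart_add)

lemma hpart_homogeneous: "f \<in> S \<Longrightarrow> homogeneous d (hpart d f)"
proof -
  assume f: "f \<in> S"
  have "ray f (t *s v) = pcompose (ray f v) [:0, t:]" for t v
    by (rule ray_eqI) (simp add: poly_pcompose poly_ray f mult.commute)
  then show ?thesis using hpart_S[OF f]
    by (simp add: homogeneous_def hpart_def coeff_pcompose_linear)
qed

lemma homogeneous_S: "homogeneous d f \<Longrightarrow> f \<in> S"
  by (simp add: homogeneous_def)

lemma hpart_of_homogeneous: "homogeneous d f \<Longrightarrow> hpart i f = (if i = d then f else (\<lambda>_. 0))"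
proof -
  assume f: "homogeneous d f"
  have "ray f v = monom (f v) d" for v
    by (rule ray_eqI) (use f in \<open>simp add: homogeneous_def poly_monom\<close>)
  then show ?thesis by (auto simp: hpart_def)
qed

lemma hpart_expansion:
  assumes "f \<in> S"
  obtains D where "\<And>d. D < d \<Longrightarrow> hpart d f = (\<lambda>_. 0)" "\<And>t v. f (t *s v) = (\<Sum>d\<le>D. t ^ d * hpart d f v)"
    "\<And>v. f v = (\<Sum>d\<le>D. hpart d f v)"
proof -
  \<comment> \<open>The bound on the degrees has to be uniform in \<open>v\<close>.\<close>
  have "\<exists>D. \<forall>v. degree (ray f v) \<le> D"
    using assms
  proof (induction f rule: S_induct)
    case (const c) show ?case by (simp add: ray_const)
  next
    case (lform f) then show ?case by (intro exI[of _ 1]) (simp add: ray_lform)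
  next
    case (add f g)
    then obtain D E where "\<forall>v. degree (ray f v) \<le> D" "\<forall>v. degree (ray g v) \<le> E" by blast
    then have "degree (ray f v + ray g v) \<le> max D E" for v
      by (intro degree_add_le) (auto intro: max.coboundedI1 max.coboundedI2)
    then show ?case using add.hyps by (auto simp: ray_add)
  next
    case (mult f g)
    then obtain D E where DE: "\<forall>v. degree (ray f v) \<le> D" "\<forall>v. degree (ray g v) \<le> E" by blast
    have "degree (ray f v * ray g v) \<le> D + E" for v
      using order_trans[OF degree_mult_le add_mono] DE by blast
    then show ?case using mult.hyps by (auto simp: ray_mult)
  qed
  then obtain D where D: "\<And>v. degree (ray f v) \<le> D" by blast
  have 1: "hpart d f = (\<lambda>_. 0)" if "D < d" for d
  proof
    fix v
    show "hpart d f v = 0" using D[of v] that by (simp add: hpart_def coeff_eq_0)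
  qed
  have "f (t *s v) = (\<Sum>d\<le>D. t ^ d * hpart d f v)" for t v
  proof -
    have "f (t *s v) = poly (ray f v) t" using assms by (simp add: poly_ray)
    also have "\<dots> = (\<Sum>i\<le>degree (ray f v). coeff (ray f v) i * t ^ i)" by (rule poly_altdef)
    also have "\<dots> = (\<Sum>i\<le>D. coeff (ray f v) i * t ^ i)"
      using D[of v] by (intro sum.mono_neutral_left) (auto simp: coeff_eq_0)
    finally show ?thesis by (simp add: hpart_def mult.commute)
  qed
  then show ?thesis using that[OF 1] by (metis (no_types, lifting) mult_1 power_one scale_one sum.cong)
qed

lemma hpart_0: "f \<in> S \<Longrightarrow> hpart 0 f v = f 0"
  using poly_ray[of f v 0] by (simp add: hpart_def poly_0_coeff_0)

text \<open>Membership in the \<open>d\<close>-th power of the maximal ideal of the origin in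
  \<open>S\<close>.\<close>

definition vanishes_to_order :: "nat \<Rightarrow> ('v \<Rightarrow> 'k) \<Rightarrow> bool" where
  "vanishes_to_order d f \<longleftrightarrow> f \<in> S \<and> (\<forall>i<d. hpart i f = (\<lambda>_. 0))"

lemma vanishes_to_order_mult:
  assumes "vanishes_to_order d f" "vanishes_to_order e g"
  shows "vanishes_to_order (d + e) (\<lambda>v. f v * g v)"
proof -
  have S: "f \<in> S" "g \<in> S" using assms by (auto simp: vanishes_to_order_def)
  have "hpart j f v * hpart (i - j) g v = 0" if "i < d + e" "j \<le> i" for i j v
  proof -
    have "j < d \<or> i - j < e" using that by linarith
    then show ?thesis using assms by (auto simp: vanishes_to_order_def)
  qed
  then have "hpart i (\<lambda>v. f v * g v) = (\<lambda>_. 0)" if "i < d + e" for i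
    unfolding hpart_mult[OF S] using that by (intro ext sum.neutral ballI) simp
  then show ?thesis using S by (auto simp: vanishes_to_order_def)
qed

lemma vanishes_to_order_0: "f \<in> S \<Longrightarrow> vanishes_to_order 0 f"
  by (simp add: vanishes_to_order_def)

lemma vanishes_to_order_mult_left: "vanishes_to_order d f \<Longrightarrow> g \<in> S \<Longrightarrow> vanishes_to_order d (\<lambda>v. g v * f v)"
  using vanishes_to_order_mult[of 0 g d f] by (simp add: vanishes_to_order_0)

lemma vanishes_to_order_power: "f \<in> S \<Longrightarrow> f 0 = 0 \<Longrightarrow> vanishes_to_order d (\<lambda>v. f v ^ d)"
proof (induction d)
  case (Suc d)
  have "vanishes_to_order 1 f" using Suc.prems by (auto simp: vanishes_to_order_def fun_eq_iff hpart_0)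
  from vanishes_to_order_mult[OF this Suc.IH[OF Suc.prems]] show ?case by simp
qed (simp add: vanishes_to_order_def)

lemma vanishes_to_order_add:
  "vanishes_to_order d f \<Longrightarrow> vanishes_to_order d g \<Longrightarrow> vanishes_to_order d (\<lambda>v. f v + g v)"
  by (auto simp: vanishes_to_order_def hpart_add)

lemma vanishes_to_order_sum:
  "(\<And>i. i \<in> I \<Longrightarrow> vanishes_to_order d (f i)) \<Longrightarrow> vanishes_to_order d (\<lambda>v. \<Sum>i\<in>I. f i v)"
  by (simp add: vanishes_to_order_def hpart_sum S_sum)

lemma vanishes_to_order_lmap:
  assumes "vanishes_to_order d f" "lmap g"
  shows "vanishes_to_order d (\<lambda>v. f (g v))"
proof -
  have f: "f \<in> S" using assms(1) by (simp add: vanishes_to_order_def)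
  have "ray (\<lambda>v. f (g v)) v = ray f (g v)" for v
    by (rule ray_eqI) (simp add: poly_ray f lmap_scale[OF assms(2)])
  then show ?thesis using assms S_lmap[OF f assms(2)] by (simp add: vanishes_to_order_def hpart_def fun_eq_iff)
qed

text \<open>Difference quotients that are homogeneous of degree \<open>d - 1\<close> in both points
  jointly, which will make the Jacobian homogeneous. The induction treats all \<open>d\<close> at
  once, as a component of a product involves all components of its factors. The clause for
  \<open>d = 0\<close> repairs truncated subtraction: a factor of degree 0 must contribute a zero
  quotient, since \<open>d - 1\<close> would otherwise count it wrongly.\<close>

lemma homogeneous_difference_coeffs:
  assumes x: "coords x b" and "f \<in> S"
  shows "\<exists>a. (\<forall>j. a j \<in> bipoly) \<and>
    (\<forall>y v. hpart d f y - hpart d f v = (\<Sum>j<n. a j y v * (x j y - x j v))) \<and>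
    (\<forall>j t y v. a j (t *s y) (t *s v) = t ^ (d - 1) * a j y v) \<and> (d = 0 \<longrightarrow> a = (\<lambda>_ _ _. 0))"
    (is "\<exists>a. ?P d f a")
  using assms(2)
proof (induction f arbitrary: d rule: S_induct)
  case (const c)
  show ?case by (intro exI[of _ "\<lambda>_ _ _. 0"]) (auto simp: hpart_const bipoly_const)
next
  case (lform f)
  show ?case
  proof (cases "d = 1")
    case True
    have "f y - f v = (\<Sum>j<n. f (b j) * (x j y - x j v))" for y v
      using coords_lform_expand[OF x lform, of y] coords_lform_expand[OF x lform, of v]
      by (simp add: algebra_simps sum_subtractf)
    then show ?thesis using True lform
      by (intro exI[of _ "\<lambda>j _ _. f (b j)"]) (auto simp: hpart_lform bipoly_const)
  next
    case False
    then show ?thesis using lform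
      by (intro exI[of _ "\<lambda>_ _ _. 0"]) (auto simp: hpart_lform bipoly_const)
  qed
next
  case (add f g)
  obtain a where a: "?P d f a" using add.IH by meson
  obtain c where c: "?P d g c" using add.IH by meson
  have "hpart d f y + hpart d g y - (hpart d f v + hpart d g v)
      = (\<Sum>j<n. (a j y v + c j y v) * (x j y - x j v))" for y v
  proof -
    have "hpart d f y + hpart d g y - (hpart d f v + hpart d g v)
      = (hpart d f y - hpart d f v) + (hpart d g y - hpart d g v)" by simp
    also have "\<dots> = (\<Sum>j<n. a j y v * (x j y - x j v)) + (\<Sum>j<n. c j y v * (x j y - x j v))"
      using a c by metis
    finally show ?thesis by (simp add: distrib_right sum.distrib)
  qed
  moreover have "\<forall>j. (\<lambda>y v. a j y v + c j y v) \<in> bipoly" using a c bipoly.add by blast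
  moreover have "a j (t *s y) (t *s v) = t ^ (d - 1) * a j y v" "c j (t *s y) (t *s v) = t ^ (d - 1) * c j y v"
    for j t y v using a c by blast+
  then have "\<forall>j t y v. a j (t *s y) (t *s v) + c j (t *s y) (t *s v) = t ^ (d - 1) * (a j y v + c j y v)"
    by (simp only: distrib_left simp_thms)
  moreover have "d = 0 \<longrightarrow> (\<lambda>j y v. a j y v + c j y v) = (\<lambda>_ _ _. 0)" using a c by auto
  ultimately show ?case unfolding hpart_add[OF add.hyps]
    by (intro exI[of _ "\<lambda>j y v. a j y v + c j y v"] conjI allI) simp_all
next
  case (mult f g)
  from choice[OF allI[OF mult.IH(1)]] obtain a where "\<forall>i. ?P i f (a i)" ..
  then have a: "a i j \<in> bipoly" "hpart i f y - hpart i f v = (\<Sum>j<n. a i j y v * (x j y - x j v))"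
    "a i j (t *s y) (t *s v) = t ^ (i - 1) * a i j y v" "a 0 = (\<lambda>_ _ _. 0)" for i j t y v by blast+
  from choice[OF allI[OF mult.IH(2)]] obtain c where "\<forall>i. ?P i g (c i)" ..
  then have c: "c i j \<in> bipoly" "hpart i g y - hpart i g v = (\<Sum>j<n. c i j y v * (x j y - x j v))"
    "c i j (t *s y) (t *s v) = t ^ (i - 1) * c i j y v" "c 0 = (\<lambda>_ _ _. 0)" for i j t y v by blast+
  \<comment> \<open>From f(y)g(y) - f(v)g(v) = f(y)(g(y) - g(v)) + (f(y) - f(v))g(v), taken degree
    by degree.\<close>
  define e where "e j y v = (\<Sum>i\<le>d. hpart i f y * c (d - i) j y v + a i j y v * hpart (d - i) g v)" for j y v
  have "e j \<in> bipoly" for j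
    unfolding e_def
    by (intro bipoly_sum bipoly.add bipoly.mult bipoly.left bipoly.right hpart_S a(1) c(1) mult.hyps)
  moreover have "hpart d (\<lambda>v. f v * g v) y - hpart d (\<lambda>v. f v * g v) v
      = (\<Sum>j<n. e j y v * (x j y - x j v))" for y v
  proof -
    have "hpart d (\<lambda>v. f v * g v) y - hpart d (\<lambda>v. f v * g v) v
      = (\<Sum>i\<le>d. hpart i f y * (hpart (d - i) g y - hpart (d - i) g v)
           + (hpart i f y - hpart i f v) * hpart (d - i) g v)"
      by (simp add: hpart_mult mult.hyps sum_subtractf[symmetric] algebra_simps)
    also have "\<dots> = (\<Sum>i\<le>d. \<Sum>j<n. (hpart i f y * c (d - i) j y v + a i j y v * hpart (d - i) g v) * (x j y - x j v))"
    proof (rule sum.cong[OF refl])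
      fix i
      show "hpart i f y * (hpart (d - i) g y - hpart (d - i) g v)
           + (hpart i f y - hpart i f v) * hpart (d - i) g v
        = (\<Sum>j<n. (hpart i f y * c (d - i) j y v + a i j y v * hpart (d - i) g v) * (x j y - x j v))"
        unfolding a(2) c(2) sum_distrib_left sum_distrib_right sum.distrib[symmetric]
        by (rule sum.cong) (simp_all add: algebra_simps)
    qed
    also have "\<dots> = (\<Sum>j<n. e j y v * (x j y - x j v))"
      by (subst sum.swap) (simp add: e_def sum_distrib_right)
    finally show ?thesis .
  qed
  moreover have "e j (t *s y) (t *s v) = t ^ (d - 1) * e j y v" for j t y v
    unfolding e_def sum_distrib_left
  proof (rule sum.cong[OF refl])
    fix i assume "i \<in> {..d}"
    then have i: "i \<le> d" by simp
    have h: "hpart k f (t *s u) = t ^ k * hpart k f u" "hpart k g (t *s u) = t ^ k * hpart k g u" for k u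
      using hpart_homogeneous mult.hyps by (auto simp: homogeneous_def)
    have "hpart i f (t *s y) * c (d - i) j (t *s y) (t *s v) = t ^ (d - 1) * (hpart i f y * c (d - i) j y v)"
    proof (cases "d - i = 0")
      case True then show ?thesis by (simp add: c(4))
    next
      case False
      then have "d - 1 = i + (d - i - 1)" using i by simp
      then have "t ^ (d - 1) = t ^ i * t ^ (d - i - 1)" by (metis power_add)
      then show ?thesis using c(3)[of "d - i"] h by (simp add: mult_ac)
    qed
    moreover have "a i j (t *s y) (t *s v) * hpart (d - i) g (t *s v) = t ^ (d - 1) * (a i j y v * hpart (d - i) g v)"
    proof (cases "i = 0")
      case True then show ?thesis by (simp add: a(4))
    next
      case False
      then have "d - 1 = (i - 1) + (d - i)" using i by simp
      then have "t ^ (d - 1) = t ^ (i - 1) * t ^ (d - i)" by (metis power_add)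
      then show ?thesis using a(3)[of i] h by (simp add: mult_ac)
    qed
    ultimately show "hpart i f (t *s y) * c (d - i) j (t *s y) (t *s v) + a i j (t *s y) (t *s v) * hpart (d - i) g (t *s v)
      = t ^ (d - 1) * (hpart i f y * c (d - i) j y v + a i j y v * hpart (d - i) g v)"
      by (simp add: distrib_left)
  qed
  moreover have "e = (\<lambda>_ _ _. 0)" if "d = 0"
    using that by (simp add: e_def fun_eq_iff a(4) c(4))
  ultimately show ?case by (intro exI[of _ e] conjI allI impI)
qed

section \<open>Finite linear groups and their invariants\<close>

text \<open>Elementwise form of a finite subgroup of \<open>GL\<close>; the two are identified in
  \<open>subgroup_GL_iff\<close>.\<close>

definition linear_group :: "('v \<Rightarrow> 'v) set \<Rightarrow> bool" where
  "linear_group G \<longleftrightarrow> finite G \<and> id \<in> G \<and> (\<forall>g\<in>G. \<forall>h\<in>G. g \<circ> h \<in> G) \<and>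
    (\<forall>g\<in>G. lmap g \<and> (\<exists>h\<in>G. h \<circ> g = id \<and> g \<circ> h = id))"

abbreviation "Inv G \<equiv> invariants (*s) G"

lemma linear_groupD:
  assumes "linear_group G"
  shows "finite G" "id \<in> G" "g \<in> G \<Longrightarrow> h \<in> G \<Longrightarrow> g \<circ> h \<in> G" "g \<in> G \<Longrightarrow> lmap g"
  using assms by (auto simp: linear_group_def)

lemma linear_group_inverse:
  assumes "linear_group G" "g \<in> G"
  obtains h where "h \<in> G" "h \<circ> g = id" "g \<circ> h = id" "\<And>v. h (g v) = v" "\<And>v. g (h v) = v"
proof -
  obtain h where h: "h \<in> G" "h \<circ> g = id" "g \<circ> h = id" using assms by (auto simp: linear_group_def)
  then show ?thesis using that by (metis comp_apply id_apply)
qed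

lemma linear_group_right_bij:
  assumes "linear_group G" "g \<in> G"
  shows "bij_betw (\<lambda>h. h \<circ> g) G G"
proof -
  obtain g' where g': "g' \<in> G" "g' \<circ> g = id" "g \<circ> g' = id" using linear_group_inverse[OF assms] .
  then show ?thesis using assms
    by (intro bij_betw_byWitness[where f' = "\<lambda>h. h \<circ> g'"]) (auto simp: comp_assoc linear_groupD)
qed

lemma sum_linear_group_right:
  assumes "linear_group G" "g \<in> G"
  shows "(\<Sum>h\<in>G. F (h (g v))) = (\<Sum>h\<in>G. F (h v))"
  using sum.reindex_bij_betw[OF linear_group_right_bij[OF assms], of "\<lambda>h. F (h v)"] by simp

lemma prod_linear_group_right:
  assumes "linear_group G" "g \<in> G"
  shows "(\<Prod>h\<in>G. F (h (g v))) = (\<Prod>h\<in>G. F (h v))"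
  using prod.reindex_bij_betw[OF linear_group_right_bij[OF assms], of "\<lambda>h. F (h v)"] by simp

lemma Inv_iff: "f \<in> Inv G \<longleftrightarrow> f \<in> S \<and> (\<forall>g\<in>G. \<forall>v. f (g v) = f v)"
  by (simp add: invariants_def)

lemma Inv_S: "f \<in> Inv G \<Longrightarrow> f \<in> S" and Inv_apply: "f \<in> Inv G \<Longrightarrow> g \<in> G \<Longrightarrow> f (g v) = f v"
  by (auto simp: Inv_iff)

lemma Inv_const: "(\<lambda>_. c) \<in> Inv G"
  and Inv_add: "f \<in> Inv G \<Longrightarrow> f' \<in> Inv G \<Longrightarrow> (\<lambda>v. f v + f' v) \<in> Inv G"
  and Inv_mult: "f \<in> Inv G \<Longrightarrow> f' \<in> Inv G \<Longrightarrow> (\<lambda>v. f v * f' v) \<in> Inv G"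
  by (auto simp: Inv_iff)

lemma Inv_cmult: "f \<in> Inv G \<Longrightarrow> (\<lambda>v. c * f v) \<in> Inv G"
  by (auto simp: Inv_iff)

lemma Inv_hpart:
  assumes "linear_group G" "f \<in> Inv G"
  shows "hpart d f \<in> Inv G"
proof -
  have "ray f (g v) = ray f v" if "g \<in> G" for g v
    using assms that
    by (intro ray_eqI) (auto simp: poly_ray Inv_S Inv_apply lmap_scale[OF linear_groupD(4), symmetric])
  then show ?thesis using assms hpart_S by (simp add: Inv_iff hpart_def)
qed

lemma Inv_orbit_prod:
  assumes "linear_group G" "f \<in> S"
  shows "(\<lambda>v. \<Prod>g\<in>G. f (g v)) \<in> Inv G"
  unfolding Inv_iff using assms
  by (auto intro!: S_prod S_lmap simp: linear_groupD prod_linear_group_right)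

text \<open>A form \<open>l\<close> that tells \<open>z\<close> from every point \<open>g y\<close>
  yields the orbit product of \<open>l - l z\<close>, which is zero at \<open>z\<close> and nonzero
  at \<open>y\<close>. A product works in every characteristic, unlike an average.\<close>

lemma Inv_separates_orbits:
  assumes G: "linear_group G" and "\<And>g. g \<in> G \<Longrightarrow> z \<noteq> g y"
  obtains f where "f \<in> Inv G" "f y \<noteq> f z"
proof -
  have "finite ((\<lambda>g. g y - z) ` G)" using linear_groupD(1)[OF G] by simp
  moreover have "g y - z \<noteq> 0" if "g \<in> G" for g using assms(2)[OF that] by simp
  then have "0 \<notin> (\<lambda>g. g y - z) ` G" by force
  ultimately
  obtain l where l: "lform l" "\<And>u. u \<in> (\<lambda>g. g y - z) ` G \<Longrightarrow> l u \<noteq> 0"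
    using separating_lform by blast
  define f where "f v = (\<Prod>g\<in>G. l (g v) - l z)" for v
  have "f \<in> Inv G"
    unfolding f_def by (rule Inv_orbit_prod[OF G S_diff[OF S_lform[OF l(1)] S_const]])
  moreover have "l (g y) - l z \<noteq> 0" if "g \<in> G" for g
    using l(2)[OF imageI[OF that]] by (simp add: lform_diff[OF l(1)])
  then have "f y \<noteq> 0" using linear_groupD(1)[OF G] by (simp add: f_def)
  moreover have "f z = 0"
    unfolding f_def using linear_groupD(1,2)[OF G] by (auto intro!: prod_zero bexI[of _ id])
  ultimately show ?thesis using that by simp
qed

text \<open>Orbit separation gives for each \<open>u\<close> an element \<open>w\<close> with
  \<open>g u = w u\<close>, but \<open>w\<close> depends on \<open>u\<close>. If no single
  \<open>w\<close> worked on \<open>U\<close>, a generic point of \<open>U\<close> would escape all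
  of the finitely many \<open>w\<close>.\<close>

lemma group_element_on_subspace:
  assumes W: "linear_group W" and U: "subspace U" and g: "lmap g"
    and "\<And>f u. f \<in> Inv W \<Longrightarrow> u \<in> U \<Longrightarrow> f (g u) = f u"
  shows "\<exists>w\<in>W. \<forall>u\<in>U. g u = w u"
proof (rule ccontr)
  assume "\<not> ?thesis"
  then obtain u where u: "\<And>w. w \<in> W \<Longrightarrow> u w \<in> U \<and> g (u w) \<noteq> w (u w)" by metis
  have "\<exists>l. lform l \<and> l (g (u w) - w (u w)) \<noteq> 0" if "w \<in> W" for w
  proof -
    have "0 \<notin> {g (u w) - w (u w)}" using u[OF that] by simp
    then show ?thesis using separating_lform[of "{g (u w) - w (u w)}"] by blast
  qed
  then obtain l where l: "\<And>w. w \<in> W \<Longrightarrow> lform (l w) \<and> l w (g (u w) - w (u w)) \<noteq> 0" by metis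
  have "(\<lambda>v. l w (g v) - l w (w v)) \<in> S" if "w \<in> W" for w
    using l[OF that] lform_compose[of "l w"] g linear_groupD(4)[OF W that] by (intro S_diff S_lform) auto
  moreover have "\<exists>v\<in>U. l w (g v) - l w (w v) \<noteq> 0" if "w \<in> W" for w
    using l[OF that] u[OF that] by (auto simp: lform_diff)
  ultimately have "\<exists>v\<in>U. \<forall>w\<in>W. l w (g v) - l w (w v) \<noteq> 0"
    by (intro generic_point[OF linear_groupD(1)[OF W] U]) auto
  then obtain v where v: "v \<in> U" "\<forall>w\<in>W. g v \<noteq> w v" by (metis cancel_comm_monoid_add_class.diff_cancel)
  then obtain f where "f \<in> Inv W" "f v \<noteq> f (g v)" using Inv_separates_orbits[OF W, of "g v" v] by metis
  then show False using assms(4) v by metis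
qed

end

section \<open>Products of linear factors and Euler's formula\<close>

lemma degree_coeff_prod_linear:
  fixes u :: "'a \<Rightarrow> 'k::field"
  assumes "finite A"
  shows "degree (\<Prod>j\<in>A. [:u j, 1:]) = card A" "coeff (\<Prod>j\<in>A. [:u j, 1:]) (card A) = 1"
proof -
  have "degree (\<Prod>j\<in>A. [:u j, 1:]) = card A \<and> lead_coeff (\<Prod>j\<in>A. [:u j, 1:]) = 1"
    using assms
  proof (induction A rule: finite_induct)
    case (insert i A)
    then have "(\<Prod>j\<in>A. [:u j, 1:]) \<noteq> 0" by auto
    then have "degree ([:u i, 1:] * (\<Prod>j\<in>A. [:u j, 1:])) = Suc (card A)"
      using insert by (subst degree_mult_eq) auto
    moreover have "lead_coeff ([:u i, 1:] * (\<Prod>j\<in>A. [:u j, 1:])) = 1"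
      by (simp only: lead_coeff_mult conjunct2[OF insert.IH]) simp
    ultimately show ?case using insert.hyps by simp
  qed simp
  then show "degree (\<Prod>j\<in>A. [:u j, 1:]) = card A" "coeff (\<Prod>j\<in>A. [:u j, 1:]) (card A) = 1" by metis+
qed

text \<open>Euler's formula, by comparing top coefficients in Lagrange interpolation.\<close>

lemma sum_power_over_derivative:
  fixes r :: "'a \<Rightarrow> 'k::field"
  assumes I: "finite I" "inj_on r I" and k: "k < card I"
  shows "(\<Sum>i\<in>I. r i ^ k / (\<Prod>j\<in>I - {i}. r i - r j)) = (if k = card I - 1 then 1 else 0)"
proof -
  let ?\<rho> = "\<lambda>i. \<Prod>j\<in>I - {i}. r i - r j"
  let ?P = "\<lambda>i. \<Prod>j\<in>I - {i}. [:- r j, 1:]"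
  define L where "L = (\<Sum>i\<in>I. Polynomial.smult (r i ^ k / ?\<rho> i) (?P i)) - monom 1 k"
  have \<rho>: "?\<rho> i \<noteq> 0" if "i \<in> I" for i using I that by (auto simp: inj_on_def)
  have degP: "degree (?P i) = card I - 1" "coeff (?P i) (card I - 1) = 1" if "i \<in> I" for i
    using degree_coeff_prod_linear[of "I - {i}" "\<lambda>j. - r j"] I(1) that by (simp_all add: card_Diff_singleton)
  have "degree L \<le> card I - 1"
    unfolding L_def
    by (intro degree_diff_le degree_sum_le)
      (use I k degP in \<open>auto intro: order_trans[OF degree_smult_le] order_trans[OF degree_monom_le]\<close>)
  moreover have "poly L (r i) = 0" if i: "i \<in> I" for i
  proof -
    have "poly (?P m) (r i) = (if m = i then ?\<rho> i else 0)" if "m \<in> I" for m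
      using I(1) i that by (auto simp: poly_prod)
    then have "(\<Sum>m\<in>I. r m ^ k / ?\<rho> m * poly (?P m) (r i)) = (\<Sum>m\<in>I. if m = i then r i ^ k else 0)"
      using \<rho> i by (intro sum.cong) auto
    then show ?thesis using I(1) i by (simp add: L_def poly_sum poly_monom)
  qed
  then have "r ` I \<subseteq> {t. poly L t = 0}" by auto
  moreover have "card (r ` I) = card I" using I(2) by (rule card_image)
  ultimately have "L = 0"
    by (metis (mono_tags, lifting) card_mono card_poly_roots_bound diff_less k leD le_trans
        less_nat_zero_code less_one neq0_conv poly_roots_finite)
  then have "coeff (\<Sum>i\<in>I. Polynomial.smult (r i ^ k / ?\<rho> i) (?P i)) (card I - 1) = coeff (monom 1 k) (card I - 1)"
    by (simp add: L_def)
  moreover have "coeff (\<Sum>i\<in>I. Polynomial.smult (r i ^ k / ?\<rho> i) (?P i)) (card I - 1) = (\<Sum>i\<in>I. r i ^ k / ?\<rho> i)"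
    unfolding coeff_sum by (rule sum.cong) (use degP in auto)
  ultimately show ?thesis by auto
qed

context polynomial_space
begin

lemma S_coeff_prod_linear:
  assumes "finite A" "\<And>j. j \<in> A \<Longrightarrow> u j \<in> S"
  shows "(\<lambda>v. coeff (\<Prod>j\<in>A. [:u j v, 1:]) l) \<in> S"
  using assms
proof (induction A arbitrary: l rule: finite_induct)
  case (insert i A)
  have "(\<lambda>v. coeff (\<Prod>j\<in>insert i A. [:u j v, 1:]) l)
    = (\<lambda>v. u i v * coeff (\<Prod>j\<in>A. [:u j v, 1:]) l + (if l = 0 then 0 else coeff (\<Prod>j\<in>A. [:u j v, 1:]) (l - 1)))"
    using insert.hyps by (cases l) (simp_all add: coeff_pCons)
  moreover have "(\<lambda>v. if l = 0 then 0 else coeff (\<Prod>j\<in>A. [:u j v, 1:]) (l - 1)) \<in> S"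
    using insert by (cases "l = 0") auto
  moreover have "(\<lambda>v. u i v * coeff (\<Prod>j\<in>A. [:u j v, 1:]) l) \<in> S" using insert by (intro S_mult) auto
  ultimately show ?case by (simp only: S_add)
qed simp

end

section \<open>The Jacobian determinant of a system of generators\<close>

text \<open>The quotients \<open>a\<close> are parameters, so that homogeneous ones can be supplied
  (\<open>jacobian_setting_exists\<close>). By \<open>x_separates\<close> every single coordinate
  tells the elements of \<open>G\<close> apart, which makes the denominators \<open>rho\<close>
  nonzero at generic points.\<close>

locale jacobian_setting = polynomial_space scale Basis
  for scale :: "'k::field \<Rightarrow> 'v::ab_group_add \<Rightarrow> 'v" (infixr \<open>*s\<close> 75) and Basis :: "'v set" +
  fixes G :: "('v \<Rightarrow> 'v) set" and f :: "nat \<Rightarrow> 'v \<Rightarrow> 'k" and x :: "nat \<Rightarrow> 'v \<Rightarrow> 'k" and b :: "nat \<Rightarrow> 'v"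
    and a :: "nat \<Rightarrow> nat \<Rightarrow> 'v \<Rightarrow> 'v \<Rightarrow> 'k"
  assumes dim_pos: "card Basis > 0"
    and G: "linear_group G"
    and f_generate: "generated_algebra (f ` {..<card Basis}) = Inv G"
    and x: "coords x b"
    and x_separates: "\<And>j g g'. j < card Basis \<Longrightarrow> g \<in> G \<Longrightarrow> g' \<in> G \<Longrightarrow> g \<noteq> g' \<Longrightarrow> \<exists>v. x j (g v) \<noteq> x j (g' v)"
    and a_bipoly: "\<And>i j. a i j \<in> bipoly"
    and a_diff: "\<And>i y v. i < card Basis \<Longrightarrow> f i y - f i v = (\<Sum>j<card Basis. a i j y v * (x j y - x j v))"
begin

text \<open>The derivative of the orbit polynomial with roots \<open>x j (g' v)\<close> at its root
  \<open>x j (g v)\<close>, that is, the denominator in Euler's formula.\<close>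

definition rho :: "nat \<Rightarrow> ('v \<Rightarrow> 'v) \<Rightarrow> 'v \<Rightarrow> 'k" where
  "rho j g v = (\<Prod>g'\<in>G - {g}. x j (g v) - x j (g' v))"

text \<open>At such points, for every \<open>j\<close>, the orbit polynomial of \<open>x j\<close>
  has simple roots.\<close>

definition good :: "'v \<Rightarrow> bool" where
  "good v \<longleftrightarrow> (\<forall>j<n. \<forall>g\<in>G. rho j g v \<noteq> 0)"

text \<open>A Bezoutian of the generators: it vanishes at two distinct points where all
  \<open>f i\<close> agree (\<open>Delta_zero\<close>), because its matrix kills their coordinate
  difference.\<close>

definition Delta :: "'v \<Rightarrow> 'v \<Rightarrow> 'k" where
  "Delta y v = det (mat n n (\<lambda>(i, j). a i j y v))"

text \<open>\<open>a i j v v\<close> is the partial derivative of \<open>f i\<close> by \<open>x j\<close>, so \<open>jac\<close> is the Jacobian determinant.\<close>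

definition jac :: "'v \<Rightarrow> 'k" where
  "jac v = Delta v v"

lemma finite_G: "finite G" and id_G: "id \<in> G" and lmap_G: "g \<in> G \<Longrightarrow> lmap g"
  using linear_groupD[OF G] by auto

lemma f_Inv: "i < n \<Longrightarrow> f i \<in> Inv G"
  unfolding f_generate[symmetric] by (rule generated_algebra.gen) simp

lemma x_S: "j < n \<Longrightarrow> x j \<in> S"
  using coords_lform[OF x] by auto

lemma xg_S: "j < n \<Longrightarrow> g \<in> G \<Longrightarrow> (\<lambda>v. x j (g v)) \<in> S"
  using S_lmap[OF x_S lmap_G] .

lemma Delta_bipoly: "Delta \<in> bipoly"
  using bipoly_det[of n a] a_bipoly unfolding Delta_def[abs_def] by blast

lemma rho_S: "j < n \<Longrightarrow> g \<in> G \<Longrightarrow> rho j g \<in> S"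
  unfolding rho_def[abs_def] by (intro S_prod S_diff xg_S) auto

lemma rho_translate:
  assumes "g \<in> G"
  shows "rho j id (g v) = rho j g v"
proof -
  have "bij_betw (\<lambda>h. h \<circ> g) (G - {id}) (G - {g})"
    by (rule bij_betw_DiffI[OF linear_group_right_bij[OF G assms]]) (use id_G assms in \<open>auto simp: bij_betw_def\<close>)
  from prod.reindex_bij_betw[OF this, of "\<lambda>h. x j (g v) - x j (h v)"]
  show ?thesis by (simp add: rho_def)
qed

lemma rho_translate': "g \<in> G \<Longrightarrow> h \<in> G \<Longrightarrow> rho j h (g v) = rho j (h \<circ> g) v"
  using rho_translate[of h j "g v"] rho_translate[of "h \<circ> g" j v] linear_groupD(3)[OF G] by simp

lemma good_translate: "good v \<Longrightarrow> g \<in> G \<Longrightarrow> good (g v)"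
  using linear_groupD(3)[OF G] by (auto simp: good_def rho_translate')

text \<open>A common denominator for all the quotients below, and a product of linear forms.\<close>

definition Lambda :: "'v \<Rightarrow> 'k" where
  "Lambda v = (\<Prod>j<n. \<Prod>g\<in>G. rho j g v)"

lemma Lambda_S: "Lambda \<in> S"
  unfolding Lambda_def[abs_def] by (intro S_prod rho_S) auto

lemma good_iff: "good v \<longleftrightarrow> Lambda v \<noteq> 0"
  using finite_G by (auto simp: good_def Lambda_def)

lemma good_exists: "\<exists>v. good v"
proof -
  have "\<exists>v. \<forall>(j, g, g')\<in>{(j, g, g'). j < n \<and> g \<in> G \<and> g' \<in> G \<and> g \<noteq> g'}. x j (g v) - x j (g' v) \<noteq> 0"
    unfolding case_prod_beta
  proof (rule generic_point_UNIV[where f = "\<lambda>(j, g, g') v. x j (g v) - x j (g' v)", unfolded case_prod_beta])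
    show "finite {p. fst p < n \<and> fst (snd p) \<in> G \<and> snd (snd p) \<in> G \<and> fst (snd p) \<noteq> snd (snd p)}"
      by (rule finite_subset[of _ "{..<n} \<times> G \<times> G"]) (auto simp: finite_G)
  qed (use x_separates xg_S in \<open>auto intro!: S_diff\<close>)
  then obtain v where v: "\<And>j g g'. j < n \<Longrightarrow> g \<in> G \<Longrightarrow> g' \<in> G \<Longrightarrow> g \<noteq> g' \<Longrightarrow> x j (g v) \<noteq> x j (g' v)" by auto
  have "good v" unfolding good_def rho_def using v finite_G by auto
  then show ?thesis ..
qed

lemma good_dense:
  assumes "p \<in> S" "q \<in> S" "\<And>v. good v \<Longrightarrow> p v = q v"
  shows "p v = q v"
proof -
  obtain w where "Lambda w \<noteq> 0" using good_exists good_iff by blast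
  then show ?thesis using S_eq_if_generic[OF assms(1,2) Lambda_S] assms(3) good_iff by blast
qed

lemma good_inj:
  assumes "good v" "j < n"
  shows "inj_on (\<lambda>g. x j (g v)) G"
proof (rule inj_onI)
  fix g g' assume g: "g \<in> G" "g' \<in> G" "x j (g v) = x j (g' v)"
  show "g = g'"
  proof (rule ccontr)
    assume "g \<noteq> g'"
    then have "rho j g v = 0" unfolding rho_def using g finite_G by (intro prod_zero) auto
    then show False using assms g by (auto simp: good_def)
  qed
qed

text \<open>Membership in the ideal of the differences \<open>f i y - f i v\<close> passes to
  products by \<open>c y * d y - c v * d v = d y * (c y - c v) + c v * (d y - d v)\<close>.
  Invariance of \<open>K\<close> in the second argument is carried along, because it later allows
  \<open>v\<close> to be replaced by \<open>g v\<close>.\<close>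

lemma Inv_difference:
  assumes "c \<in> Inv G"
  shows "\<exists>K. (\<forall>i. K i \<in> bipoly) \<and> (\<forall>y v. c y - c v = (\<Sum>i<n. K i y v * (f i y - f i v))) \<and>
    (\<forall>i. \<forall>g\<in>G. \<forall>y v. K i y (g v) = K i y v)" (is "\<exists>K. ?P c K")
proof -
  have "c \<in> generated_algebra (f ` {..<n})" using assms f_generate by simp
  then have "c \<in> Inv G \<and> (\<exists>K. ?P c K)"
  proof (induction rule: generated_algebra.induct)
    case (const c)
    show ?case by (intro conjI Inv_const exI[of _ "\<lambda>_ _ _. 0"]) (auto simp: bipoly_const)
  next
    case (gen c)
    then obtain i where i: "i < n" "c = f i" by auto
    have "c y - c v = (\<Sum>l<n. (if l = i then 1 else 0) * (f l y - f l v))" for y v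
    proof -
      have "(\<Sum>l<n. (if l = i then 1 else 0) * (f l y - f l v)) = (\<Sum>l<n. if l = i then f l y - f l v else 0)"
        by (rule sum.cong) auto
      then show ?thesis using i by simp
    qed
    then show ?case using i f_Inv
      by (intro conjI exI[of _ "\<lambda>l _ _. if l = i then 1 else 0"]) (auto simp: bipoly_const)
  next
    case (add c d)
    then obtain K L where KL: "?P c K" "?P d L" by blast
    have "c y + d y - (c v + d v) = (\<Sum>i<n. (K i y v + L i y v) * (f i y - f i v))" for y v
    proof -
      have "c y + d y - (c v + d v) = (c y - c v) + (d y - d v)" by simp
      also have "\<dots> = (\<Sum>i<n. K i y v * (f i y - f i v)) + (\<Sum>i<n. L i y v * (f i y - f i v))"
        using KL by presburger
      finally show ?thesis by (simp add: distrib_right sum.distrib)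
    qed
    then show ?case using add KL
      by (intro conjI exI[of _ "\<lambda>i y v. K i y v + L i y v"]) (auto simp: Inv_add intro: bipoly.add)
  next
    case (mult c d)
    then obtain K L where KL: "?P c K" "?P d L" by blast
    have "c y * d y - c v * d v = (\<Sum>i<n. (d y * K i y v + c v * L i y v) * (f i y - f i v))" for y v
    proof -
      have "c y * d y - c v * d v = d y * (c y - c v) + c v * (d y - d v)" by (simp add: algebra_simps)
      also have "\<dots> = d y * (\<Sum>i<n. K i y v * (f i y - f i v)) + c v * (\<Sum>i<n. L i y v * (f i y - f i v))"
        using KL by presburger
      finally show ?thesis by (simp add: distrib_right sum.distrib sum_distrib_left mult.assoc)
    qed
    moreover have "(\<lambda>y v. d y * K i y v + c v * L i y v) \<in> bipoly" for i
      using KL mult Inv_S by (intro bipoly.add bipoly.mult bipoly.left bipoly.right) auto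
    moreover have "d y * K i y (g v) + c (g v) * L i y (g v) = d y * K i y v + c v * L i y v"
      if "g \<in> G" for i g y v
      using KL that Inv_apply[OF conjunct1[OF mult.IH(1)] that] by (simp only:)
    ultimately show ?case using mult
      by (intro conjI exI[of _ "\<lambda>i y v. d y * K i y v + c v * L i y v"]) (auto simp: Inv_mult)
  qed
  then show ?thesis by blast
qed

lemma orbit_poly_coeff:
  assumes "j < n"
  shows "(\<lambda>v. coeff (\<Prod>g\<in>G. [:- x j (g v), 1:]) l) \<in> Inv G"
proof -
  have "(\<lambda>v. coeff (\<Prod>g\<in>G. [:- x j (g v), 1:]) l) \<in> S"
    by (rule S_coeff_prod_linear[OF finite_G]) (use assms in \<open>auto intro: xg_S\<close>)
  then show ?thesis
    by (simp add: Inv_iff prod_linear_group_right[OF G, of _ "\<lambda>u. [:- x j u, 1:]"])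
qed

lemma orbit_poly_expansion:
  "(\<Prod>g\<in>G. t - x j (g v)) = (\<Sum>l\<le>card G. coeff (\<Prod>g\<in>G. [:- x j (g v), 1:]) l * t ^ l)"
proof -
  have "(\<Prod>g\<in>G. t - x j (g v)) = poly (\<Prod>g\<in>G. [:- x j (g v), 1:]) t" by (simp add: poly_prod)
  then show ?thesis by (simp add: poly_altdef degree_coeff_prod_linear(1)[OF finite_G])
qed

text \<open>The product is the value at \<open>x j y\<close> of the orbit polynomial of
  \<open>v\<close>, whereas the orbit polynomial of \<open>y\<close> vanishes there. Their
  difference only involves differences of coefficients, which are invariants.\<close>

lemma orbit_product_difference:
  assumes j: "j < n"
  shows "\<exists>h. (\<forall>i. h i \<in> bipoly) \<and>
    (\<forall>y v. (\<Prod>g\<in>G. x j y - x j (g v)) = (\<Sum>i<n. h i y v * (f i y - f i v))) \<and>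
    (\<forall>i. \<forall>g\<in>G. \<forall>y v. h i y (g v) = h i y v)"
proof -
  define c where "c l v = coeff (\<Prod>g\<in>G. [:- x j (g v), 1:]) l" for l v
  have "\<forall>l. \<exists>K. (\<forall>i. K i \<in> bipoly) \<and> (\<forall>y v. c l y - c l v = (\<Sum>i<n. K i y v * (f i y - f i v))) \<and>
      (\<forall>i. \<forall>g\<in>G. \<forall>y v. K i y (g v) = K i y v)"
    using Inv_difference orbit_poly_coeff[OF j] unfolding c_def[abs_def] by blast
  from choice[OF this] obtain K where
    "\<forall>l. (\<forall>i. K l i \<in> bipoly) \<and> (\<forall>y v. c l y - c l v = (\<Sum>i<n. K l i y v * (f i y - f i v))) \<and>
      (\<forall>i. \<forall>g\<in>G. \<forall>y v. K l i y (g v) = K l i y v)" ..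
  then have K: "K l i \<in> bipoly" "c l y - c l v = (\<Sum>i<n. K l i y v * (f i y - f i v))"
    "g \<in> G \<Longrightarrow> K l i y (g v) = K l i y v" for l i y v g by blast+
  define h where "h i y v = (\<Sum>l\<le>card G. (- (x j y ^ l)) * K l i y v)" for i y v
  have "h i \<in> bipoly" for i
    unfolding h_def using x_S[OF j] K(1)
    by (intro bipoly_sum bipoly.mult bipoly.left) auto
  moreover have "(\<Prod>g\<in>G. x j y - x j (g v)) = (\<Sum>i<n. h i y v * (f i y - f i v))" for y v
  proof -
    have "(\<Prod>g\<in>G. x j y - x j (g y)) = 0"
      using finite_G id_G by (intro prod_zero) (auto intro!: bexI[of _ id])
    then have "(\<Prod>g\<in>G. x j y - x j (g v)) = (\<Sum>l\<le>card G. c l v * x j y ^ l) - (\<Sum>l\<le>card G. c l y * x j y ^ l)"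
      using orbit_poly_expansion[of "x j y" j v] orbit_poly_expansion[of "x j y" j y] by (simp add: c_def)
    also have "\<dots> = (\<Sum>l\<le>card G. (- (x j y ^ l)) * (c l y - c l v))"
      by (simp add: sum_subtractf[symmetric] algebra_simps)
    also have "\<dots> = (\<Sum>l\<le>card G. \<Sum>i<n. (- (x j y ^ l)) * K l i y v * (f i y - f i v))"
      by (simp only: K(2) sum_distrib_left mult.assoc)
    also have "\<dots> = (\<Sum>i<n. h i y v * (f i y - f i v))"
      by (subst sum.swap) (simp only: h_def sum_distrib_right)
    finally show ?thesis .
  qed
  moreover have "h i y (g v) = h i y v" if "g \<in> G" for i g y v
    unfolding h_def using K(3)[OF that] by simp
  ultimately show ?thesis by (intro exI[of _ h]) auto
qed

text \<open>Both sides expand the same orbit product, so the discrepancies \<open>M m y\<close>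
  satisfy a relation with the differences \<open>x m y - x m v\<close>. On the line through
  \<open>v\<close> in direction \<open>b l\<close> only the \<open>l\<close>-th difference survives
  and equals \<open>t\<close>; dividing by \<open>t\<close> and then setting \<open>t = 0\<close>
  gives the claim on the diagonal.\<close>

lemma diagonal_entries:
  assumes h: "\<And>j i. j < n \<Longrightarrow> h j i \<in> bipoly"
    and hp: "\<And>j y v. j < n \<Longrightarrow> (\<Prod>g\<in>G. x j y - x j (g v)) = (\<Sum>i<n. h j i y v * (f i y - f i v))"
    and j: "j < n" and l: "l < n"
  shows "(\<Sum>i<n. h j i v v * a i l v v) = (if j = l then rho j id v else 0)"
proof -
  define r where "r y = (\<Prod>g\<in>G - {id}. x j y - x j (g v))" for y
  define M where "M l y = (\<Sum>i<n. h j i y v * a i l y v) - (if j = l then r y else 0)" for l y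
  have r_S: "r \<in> S" unfolding r_def[abs_def] using x_S[OF j] by (intro S_prod S_diff) auto
  have M_S: "M l \<in> S"
  proof -
    have "(\<lambda>y. \<Sum>i<n. h j i y v * a i l y v) \<in> S"
      using bipoly_S_left[OF h[OF j]] bipoly_S_left[OF a_bipoly] by (intro S_sum S_mult) auto
    moreover have "(\<lambda>y. if j = l then r y else 0) \<in> S" using r_S by (cases "j = l") auto
    ultimately show ?thesis unfolding M_def[abs_def] by (rule S_diff)
  qed
  have sumM: "(\<Sum>m<n. M m y * (x m y - x m v)) = 0" for y
  proof -
    have "(\<Sum>m<n. M m y * (x m y - x m v)) = (\<Sum>m<n. \<Sum>i<n. h j i y v * (a i m y v * (x m y - x m v)))
        - (\<Sum>m<n. if j = m then r y * (x m y - x m v) else 0)"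
      unfolding M_def sum_subtractf[symmetric]
      by (rule sum.cong) (auto simp: left_diff_distrib sum_distrib_right mult.assoc)
    also have "(\<Sum>m<n. \<Sum>i<n. h j i y v * (a i m y v * (x m y - x m v))) = (\<Sum>i<n. h j i y v * (f i y - f i v))"
      by (subst sum.swap) (simp add: a_diff sum_distrib_left)
    also have "\<dots> = (\<Prod>g\<in>G. x j y - x j (g v))" by (rule hp[OF j, symmetric])
    also have "\<dots> = (x j y - x j v) * r y"
      using prod.remove[OF finite_G id_G, of "\<lambda>g. x j y - x j (g v)"] by (simp add: r_def)
    finally show ?thesis using j by simp
  qed
  obtain p where p: "\<And>t. M l (v + t *s b l) = poly p t" using S_polycurve[OF M_S polycurve_line] by blast
  have "poly p t = poly 0 t" if "t \<in> {t. t \<noteq> 0}" for t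
  proof -
    have "x m (v + t *s b l) - x m v = (if m = l then t else 0)" if "m < n" for m
      using coords_basis[OF x that l] coords_lform[OF x that] by (simp add: lform_add lform_scale)
    then have "(\<Sum>m<n. M m (v + t *s b l) * (x m (v + t *s b l) - x m v))
        = (\<Sum>m<n. if m = l then M l (v + t *s b l) * t else 0)" by (intro sum.cong) auto
    then have "M l (v + t *s b l) * t = 0" using sumM l by simp
    then show ?thesis using that p by simp
  qed
  then have "p = 0" using poly_eq_if_infinite[OF infinite_nonzero] by blast
  then have "M l v = 0" using p[of 0] by simp
  moreover have "r v = rho j id v" by (simp add: r_def rho_def)
  ultimately show ?thesis by (simp add: M_def split: if_splits)
qed

text \<open>
  The orbit products \<open>\<Prod>\<^sub>g x\<^sub>j(y) - x\<^sub>j(gv)\<close> are combinations of the differences \<open>f\<^sub>i(y) - f\<^sub>i(v)\<close>;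
  \<open>H\<close> is the determinant of the coefficients, the multiplier in the transformation law for residues.
\<close>

lemma cofactor_exists:
  obtains H where "H \<in> bipoly" "\<And>g y v. g \<in> G \<Longrightarrow> H y (g v) = H y v"
    "\<And>v. H v v * jac v = (\<Prod>j<n. rho j id v)"
    "\<And>y v. (\<And>j. j < n \<Longrightarrow> \<exists>g\<in>G. x j y = x j (g v)) \<Longrightarrow> (\<And>g. g \<in> G \<Longrightarrow> y \<noteq> g v) \<Longrightarrow> H y v = 0"
proof -
  have "\<forall>j. \<exists>h. j < n \<longrightarrow> ((\<forall>i. h i \<in> bipoly) \<and>
    (\<forall>y v. (\<Prod>g\<in>G. x j y - x j (g v)) = (\<Sum>i<n. h i y v * (f i y - f i v))) \<and>
    (\<forall>i. \<forall>g\<in>G. \<forall>y v. h i y (g v) = h i y v))"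
    using orbit_product_difference by blast
  from choice[OF this] obtain h where
    "\<forall>j. j < n \<longrightarrow> ((\<forall>i. h j i \<in> bipoly) \<and>
    (\<forall>y v. (\<Prod>g\<in>G. x j y - x j (g v)) = (\<Sum>i<n. h j i y v * (f i y - f i v))) \<and>
    (\<forall>i. \<forall>g\<in>G. \<forall>y v. h j i y (g v) = h j i y v))" ..
  then have h: "j < n \<Longrightarrow> h j i \<in> bipoly"
    "j < n \<Longrightarrow> (\<Prod>g\<in>G. x j y - x j (g v)) = (\<Sum>i<n. h j i y v * (f i y - f i v))"
    "j < n \<Longrightarrow> g \<in> G \<Longrightarrow> h j i y (g v) = h j i y v" for j i y v g by blast+
  let ?h = "\<lambda>y v. mat n n (\<lambda>(j, i). h j i y v)"
  define H where "H y v = det (?h y v)" for y v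
  have "H \<in> bipoly" unfolding H_def[abs_def] using h(1) by (intro bipoly_det) auto
  moreover have "H y (g v) = H y v" if "g \<in> G" for g y v
  proof -
    have "?h y (g v) = ?h y v" using h(3) that by (intro eq_matI) auto
    then show ?thesis by (simp add: H_def)
  qed
  moreover have "H v v * jac v = (\<Prod>j<n. rho j id v)" for v
  proof -
    let ?a = "mat n n (\<lambda>(i, j). a i j v v)"
    let ?D = "mat n n (\<lambda>(j, l). if j = l then rho j id v else 0)"
    have "?h v v * ?a = ?D"
    proof (rule eq_matI)
      fix j l assume "j < dim_row ?D" "l < dim_col ?D"
      then have jl: "j < n" "l < n" by auto
      then have "(?h v v * ?a) $$ (j, l) = (\<Sum>i<n. h j i v v * a i l v v)"
        by (simp add: scalar_prod_def atLeast0LessThan)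
      then show "(?h v v * ?a) $$ (j, l) = ?D $$ (j, l)"
        using diagonal_entries[OF h(1,2) jl] jl by simp
    qed auto
    then have "H v v * jac v = det ?D"
      unfolding H_def jac_def Delta_def by (subst det_mult[symmetric, of _ n]) auto
    also have "\<dots> = prod_list (diag_mat ?D)" by (rule det_upper_triangular[of _ n]) auto
    also have "\<dots> = (\<Prod>j<n. rho j id v)" by (simp add: prod_list_diag_prod atLeast0LessThan)
    finally show ?thesis .
  qed
  \<comment> \<open>If every coordinate of \<open>y\<close> occurs in the orbit of \<open>v\<close>,
    all orbit products vanish, so the matrix kills the vector of the \<open>f i y - f i v\<close>.
    This vector is nonzero when \<open>y\<close> is outside the orbit, because invariants separate
    orbits.\<close>
  moreover have "H y v = 0" if y: "\<And>j. j < n \<Longrightarrow> \<exists>g\<in>G. x j y = x j (g v)" "\<And>g. g \<in> G \<Longrightarrow> y \<noteq> g v" for y v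
  proof -
    obtain c where c: "c \<in> Inv G" "c v \<noteq> c y" using Inv_separates_orbits[OF G, of y v] y(2) by blast
    obtain K where "c y - c v = (\<Sum>i<n. K i y v * (f i y - f i v))" using Inv_difference[OF c(1)] by blast
    with c(2) have "(\<Sum>i<n. K i y v * (f i y - f i v)) \<noteq> 0" by auto
    then obtain i where i: "i < n" "f i y - f i v \<noteq> 0" by (metis (no_types, lifting) lessThan_iff mult_zero_right sum.neutral)
    let ?w = "vec n (\<lambda>i. f i y - f i v)"
    have "?w $ i \<noteq> 0\<^sub>v n $ i" using i by simp
    then have w: "?w \<noteq> 0\<^sub>v n" by metis
    have "?h y v *\<^sub>v ?w = 0\<^sub>v n"
    proof (rule eq_vecI)
      fix j assume "j < dim_vec (0\<^sub>v n :: 'k vec)"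
      then have j: "j < n" by simp
      then have "(?h y v *\<^sub>v ?w) $ j = (\<Prod>g\<in>G. x j y - x j (g v))"
        by (simp add: h(2) scalar_prod_def atLeast0LessThan)
      also have "\<dots> = 0" using y(1)[OF j] finite_G by (intro prod_zero) auto
      finally show "(?h y v *\<^sub>v ?w) $ j = 0\<^sub>v n $ j" using j by simp
    qed auto
    then show ?thesis unfolding H_def using w by (intro iffD2[OF det_0_iff_vec_prod_zero[of _ n]] exI[of _ ?w]) auto
  qed
  ultimately show ?thesis using that by blast
qed

lemma jac_nonzero: "good v \<Longrightarrow> jac v \<noteq> 0"
proof -
  assume v: "good v"
  obtain H where "H v v * jac v = (\<Prod>j<n. rho j id v)" using cofactor_exists by metis
  moreover have "(\<Prod>j<n. rho j id v) \<noteq> 0" using v id_G by (auto simp: good_def)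
  ultimately show ?thesis by auto
qed

lemma Delta_zero: "y \<noteq> v \<Longrightarrow> (\<And>i. i < n \<Longrightarrow> f i y = f i v) \<Longrightarrow> Delta y v = 0"
proof -
  assume yv: "y \<noteq> v" and fy: "\<And>i. i < n \<Longrightarrow> f i y = f i v"
  let ?a = "mat n n (\<lambda>(i, j). a i j y v)"
  let ?w = "vec n (\<lambda>j. x j y - x j v)"
  obtain j where j: "j < n" "x j y \<noteq> x j v" using coords_eqI[OF x] yv by blast
  then have "?w $ j \<noteq> 0\<^sub>v n $ j" by simp
  then have w: "?w \<noteq> 0\<^sub>v n" by metis
  have "?a *\<^sub>v ?w = 0\<^sub>v n"
  proof (rule eq_vecI)
    fix i assume "i < dim_vec (0\<^sub>v n :: 'k vec)"
    then have i: "i < n" by simp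
    then have "(?a *\<^sub>v ?w) $ i = f i y - f i v"
      by (simp add: a_diff scalar_prod_def atLeast0LessThan)
    then show "(?a *\<^sub>v ?w) $ i = 0\<^sub>v n $ i" using i fy by simp
  qed auto
  then show ?thesis unfolding Delta_def using w by (intro iffD2[OF det_0_iff_vec_prod_zero[of _ n]] exI[of _ ?w]) auto
qed

end

text \<open>Multiplying by a power of \<open>t\<close> turns \<open>B\<close> into its reflected
  polynomial, whose value at 0 is the leading coefficient of \<open>B\<close>.\<close>

lemma poly_inverse_eq_imp_const:
  fixes A B :: "'k::field poly"
  assumes inf: "infinite (UNIV :: 'k set)" and eq: "\<And>t. t \<noteq> 0 \<Longrightarrow> poly A t = poly B (inverse t)"
  shows "degree B = 0"
proof (rule ccontr)
  assume d: "degree B \<noteq> 0"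
  have "monom 1 (degree B) * A = reflect_poly B"
  proof (rule poly_eq_if_infinite)
    show "infinite (UNIV - {0 :: 'k})" using inf by simp
    fix t :: 'k assume "t \<in> UNIV - {0}"
    then show "poly (monom 1 (degree B) * A) t = poly (reflect_poly B) t"
      by (simp add: poly_monom poly_reflect_poly_nz eq)
  qed
  then have "poly (monom 1 (degree B) * A) 0 = poly (reflect_poly B) 0" by simp
  moreover have "poly (monom 1 (degree B) * A) 0 = 0" using d by (simp add: poly_monom)
  moreover have "poly (reflect_poly B) 0 = lead_coeff B" by (rule poly_reflect_poly_0)
  ultimately have "lead_coeff B = 0" by metis
  then show False using d by (simp only: leading_coeff_0_iff) simp
qed

section \<open>Divisibility by products of linear forms\<close>

context polynomial_space
begin

text \<open>Each linear form is prime, and some multiplier \<open>e\<close> is not divisible by it,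
  so the forms are split off \<open>N\<close> one at a time. Factors are indexed, hence may be
  repeated.\<close>

lemma cancel_linear_factors:
  assumes "finite I" and l: "\<And>i. i \<in> I \<Longrightarrow> lform (l i)" "\<And>i. i \<in> I \<Longrightarrow> \<exists>u. l i u \<noteq> 0"
    and "N \<in> S" "E \<subseteq> S"
    and "\<And>e. e \<in> E \<Longrightarrow> \<exists>T\<in>S. \<forall>v. e v * N v = (\<Prod>i\<in>I. l i v) * T v"
    and "\<And>i. i \<in> I \<Longrightarrow> \<exists>e\<in>E. \<exists>v. l i v = 0 \<and> e v \<noteq> 0"
  shows "\<exists>T\<in>S. \<forall>v. N v = (\<Prod>i\<in>I. l i v) * T v"
  using assms
proof (induction I rule: finite_induct)
  case empty
  then show ?case by auto
next
  case (insert i I)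
  have "\<exists>T\<in>S. \<forall>v. N v = (\<Prod>i\<in>I. l i v) * T v"
  proof (rule insert.IH)
    fix e assume "e \<in> E"
    then obtain T where T: "T \<in> S" "\<And>v. e v * N v = (\<Prod>i\<in>insert i I. l i v) * T v"
      using insert.prems(5) by blast
    then have "e v * N v = (\<Prod>i\<in>I. l i v) * (l i v * T v)" for v
      using insert.hyps by (simp add: mult_ac)
    moreover have "(\<lambda>v. l i v * T v) \<in> S" using insert.prems(1) T(1) by auto
    ultimately show "\<exists>T\<in>S. \<forall>v. e v * N v = (\<Prod>i\<in>I. l i v) * T v"
      by (intro bexI[of _ "\<lambda>v. l i v * T v"]) simp_all
  qed (use insert in auto)
  then obtain T0 where T0: "T0 \<in> S" "\<And>v. N v = (\<Prod>i\<in>I. l i v) * T0 v" by blast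
  obtain e u where e: "e \<in> E" "l i u = 0" "e u \<noteq> 0" using insert.prems(6) by blast
  then obtain T where T: "T \<in> S" "\<And>v. e v * N v = (\<Prod>i\<in>insert i I. l i v) * T v"
    using insert.prems(5) by blast
  have P: "(\<lambda>v. \<Prod>i\<in>I. l i v) \<in> S" using insert.prems(1) by auto
  obtain w where w: "(\<Prod>i\<in>I. l i w) \<noteq> 0"
    using generic_point_UNIV[of I l] insert by (auto simp: S_lform)
  have eS: "e \<in> S" and li: "lform (l i)" using e(1) insert.prems by auto
  have eT0: "e v * T0 v = l i v * T v" for v
  proof (rule S_eq_if_generic[OF S_mult[OF eS T0(1)] S_mult[OF S_lform[OF li] T(1)] P w])
    fix v assume "(\<Prod>i\<in>I. l i v) \<noteq> 0"
    moreover have "(\<Prod>i\<in>I. l i v) * (e v * T0 v) = (\<Prod>i\<in>I. l i v) * (l i v * T v)"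
      using T(2)[of v] T0(2)[of v] insert.hyps by (simp add: mult_ac)
    ultimately show "e v * T0 v = l i v * T v" by simp
  qed
  have "T0 v = 0" if "l i v = 0" for v
  proof (rule ccontr)
    assume "T0 v \<noteq> 0"
    then have "\<exists>u\<in>{v. l i v = 0}. \<forall>q\<in>{True, False}. (if q then e else T0) u \<noteq> 0"
      using that e eS T0(1) by (intro generic_point subspace_lform_kernel[OF li]) auto
    then show False using eT0 by (auto simp del: mult_eq_0_iff) (metis mult_eq_0_iff mult_zero_left)
  qed
  moreover obtain u' where "l i u' \<noteq> 0" using insert.prems(2) by blast
  ultimately obtain s where s: "s \<in> S" "\<And>v. T0 v = l i v * s v"
    using lform_dvd_if_vanishes[OF li _ T0(1)] by blast
  have "N v = (\<Prod>i\<in>insert i I. l i v) * s v" for v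
    using insert.hyps T0(2)[of v] s(2)[of v] by (simp add: mult_ac)
  then show ?case using s(1) by blast
qed

end

section \<open>Sums over orbits divided by the Jacobian\<close>

context jacobian_setting
begin

text \<open>Euler's formula covers exponents below \<open>card G\<close>. Higher powers reduce by
  the orbit polynomial, whose coefficients are polynomials in \<open>v\<close> that do not depend on
  the summation index.\<close>

lemma single_orbit_sum:
  assumes j: "j < n"
  shows "\<exists>T\<in>S. \<forall>v. good v \<longrightarrow> (\<Sum>g\<in>G. x j (g v) ^ k / rho j g v) = T v"
proof (induction k rule: less_induct)
  case (less k)
  show ?case
  proof (cases "k < card G")
    case True
    then have "(\<Sum>g\<in>G. x j (g v) ^ k / rho j g v) = (if k = card G - 1 then 1 else 0)" if "good v" for v
      using sum_power_over_derivative[OF finite_G good_inj[OF that j]] by (simp add: rho_def)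
    then show ?thesis by (intro bexI[of _ "\<lambda>_. if k = card G - 1 then 1 else 0"]) auto
  next
    case False
    define d where "d = card G"
    define c where "c l v = coeff (\<Prod>g\<in>G. [:- x j (g v), 1:]) l" for l v
    have "\<forall>l. \<exists>T. l < d \<longrightarrow> T \<in> S \<and> (\<forall>v. good v \<longrightarrow> (\<Sum>g\<in>G. x j (g v) ^ (k - d + l) / rho j g v) = T v)"
    proof
      fix l
      show "\<exists>T. l < d \<longrightarrow> T \<in> S \<and> (\<forall>v. good v \<longrightarrow> (\<Sum>g\<in>G. x j (g v) ^ (k - d + l) / rho j g v) = T v)"
      proof (cases "l < d")
        case True
        then have "k - d + l < k" using False by (simp add: d_def)
        then show ?thesis using less[of "k - d + l"] by blast
      qed simp
    qed
    from choice[OF this] obtain T where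
      T: "\<And>l. l < d \<Longrightarrow> T l \<in> S"
        "\<And>l v. l < d \<Longrightarrow> good v \<Longrightarrow> (\<Sum>g\<in>G. x j (g v) ^ (k - d + l) / rho j g v) = T l v" by blast
    have "x j (g v) ^ k = - (\<Sum>l<d. c l v * x j (g v) ^ (k - d + l))" if "g \<in> G" for g v
    proof -
      have "0 = (\<Prod>h\<in>G. x j (g v) - x j (h v))" using that finite_G by (intro prod_zero[symmetric]) auto
      also have "\<dots> = (\<Sum>l\<le>d. c l v * x j (g v) ^ l)" unfolding c_def d_def by (rule orbit_poly_expansion)
      also have "\<dots> = (\<Sum>l<d. c l v * x j (g v) ^ l) + x j (g v) ^ d"
        unfolding lessThan_Suc_atMost[symmetric] sum.lessThan_Suc
        by (simp add: c_def d_def degree_coeff_prod_linear(2)[OF finite_G])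
      finally have "x j (g v) ^ d = - (\<Sum>l<d. c l v * x j (g v) ^ l)" by (simp add: eq_neg_iff_add_eq_0 add.commute)
      moreover have "x j (g v) ^ k = x j (g v) ^ (k - d) * x j (g v) ^ d"
        using False by (simp add: d_def power_add[symmetric])
      ultimately show ?thesis by (simp add: sum_distrib_left power_add mult_ac)
    qed
    then have "(\<Sum>g\<in>G. x j (g v) ^ k / rho j g v)
        = (\<Sum>g\<in>G. - (\<Sum>l<d. c l v * x j (g v) ^ (k - d + l)) / rho j g v)" for v
      by (intro sum.cong) auto
    also have "(\<Sum>g\<in>G. - (\<Sum>l<d. c l v * x j (g v) ^ (k - d + l)) / rho j g v)
        = - (\<Sum>l<d. c l v * (\<Sum>g\<in>G. x j (g v) ^ (k - d + l) / rho j g v))" for v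
      by (simp add: sum_divide_distrib sum_distrib_left sum_negf[symmetric] sum.swap[of _ G])
    finally have "(\<Sum>g\<in>G. x j (g v) ^ k / rho j g v) = - (\<Sum>l<d. c l v * T l v)" if "good v" for v
      using T(2)[OF _ that] by simp
    moreover have "(\<lambda>v. - (\<Sum>l<d. c l v * T l v)) \<in> S"
      using T(1) Inv_S[OF orbit_poly_coeff[OF j]] unfolding c_def by (intro S_uminus S_sum S_mult) auto
    ultimately show ?thesis by (intro bexI[of _ "\<lambda>v. - (\<Sum>l<d. c l v * T l v)"]) auto
  qed
qed

text \<open>The points with coordinates taken independently from the orbit of \<open>v\<close>: they
  are the common zeros \<open>y\<close> of the orbit products for all \<open>j\<close>.\<close>

definition tuple_point :: "(nat \<Rightarrow> 'v \<Rightarrow> 'v) \<Rightarrow> 'v \<Rightarrow> 'v" where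
  "tuple_point \<gamma> v = (\<Sum>j<n. x j (\<gamma> j v) *s b j)"

lemma x_tuple_point: "j < n \<Longrightarrow> x j (tuple_point \<gamma> v) = x j (\<gamma> j v)"
  unfolding tuple_point_def by (rule coords_combination[OF x])

abbreviation "tuples \<equiv> {..<n} \<rightarrow>\<^sub>E G"

text \<open>For a monomial the sum over tuples factors into one sum over \<open>G\<close> for each
  coordinate.\<close>

lemma tuple_sum:
  assumes "s \<in> S"
  shows "\<exists>T\<in>S. \<forall>v. good v \<longrightarrow> (\<Sum>\<gamma>\<in>tuples. s (tuple_point \<gamma> v) / (\<Prod>j<n. rho j (\<gamma> j) v)) = T v"
proof -
  obtain D where "s \<in> monomial_span x D" using S_monomial_span[OF x assms] .
  then show ?thesis
  proof (induction rule: monomial_span.induct)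
    case (monomial \<kappa> c)
    have "\<forall>j. \<exists>T. j < n \<longrightarrow> T \<in> S \<and> (\<forall>v. good v \<longrightarrow> (\<Sum>g\<in>G. x j (g v) ^ \<kappa> j / rho j g v) = T v)"
      using single_orbit_sum by blast
    from choice[OF this] obtain T where T: "\<And>j. j < n \<Longrightarrow> T j \<in> S"
      "\<And>j v. j < n \<Longrightarrow> good v \<Longrightarrow> (\<Sum>g\<in>G. x j (g v) ^ \<kappa> j / rho j g v) = T j v" by blast
    have "(\<Sum>\<gamma>\<in>tuples. c * (\<Prod>j<n. x j (tuple_point \<gamma> v) ^ \<kappa> j) / (\<Prod>j<n. rho j (\<gamma> j) v)) = c * (\<Prod>j<n. T j v)"
      if "good v" for v
    proof -
      have "(\<Prod>j<n. T j v) = (\<Prod>j<n. \<Sum>g\<in>G. x j (g v) ^ \<kappa> j / rho j g v)"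
        using T(2) that by simp
      also have "\<dots> = (\<Sum>\<gamma>\<in>tuples. \<Prod>j<n. x j (\<gamma> j v) ^ \<kappa> j / rho j (\<gamma> j) v)"
        by (rule prod_sum_PiE) (auto simp: finite_G)
      finally show ?thesis by (simp add: x_tuple_point prod_dividef sum_distrib_left)
    qed
    moreover have "(\<lambda>v. c * (\<Prod>j<n. T j v)) \<in> S" using T(1) by (intro S_cmult S_prod) simp
    ultimately show ?case by (intro bexI[of _ "\<lambda>v. c * (\<Prod>j<n. T j v)"]) auto
  next
    case (add s s')
    then obtain T T' where "T \<in> S" "T' \<in> S"
      "\<forall>v. good v \<longrightarrow> (\<Sum>\<gamma>\<in>tuples. s (tuple_point \<gamma> v) / (\<Prod>j<n. rho j (\<gamma> j) v)) = T v"
      "\<forall>v. good v \<longrightarrow> (\<Sum>\<gamma>\<in>tuples. s' (tuple_point \<gamma> v) / (\<Prod>j<n. rho j (\<gamma> j) v)) = T' v" by blast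
    then show ?case
      by (intro bexI[of _ "\<lambda>v. T v + T' v"]) (auto simp: add_divide_distrib sum.distrib)
  qed
qed

lemma tuple_sum_bipoly:
  assumes "F \<in> bipoly"
  shows "\<exists>T\<in>S. \<forall>v. good v \<longrightarrow> (\<Sum>\<gamma>\<in>tuples. F (tuple_point \<gamma> v) v / (\<Prod>j<n. rho j (\<gamma> j) v)) = T v"
  using bipoly_tensors[OF assms]
proof (induction rule: tensors.induct)
  case (tensor s q)
  obtain T where T: "T \<in> S"
    "\<And>v. good v \<Longrightarrow> (\<Sum>\<gamma>\<in>tuples. s (tuple_point \<gamma> v) / (\<Prod>j<n. rho j (\<gamma> j) v)) = T v"
    using tuple_sum[OF tensor(1)] by blast
  have "(\<Sum>\<gamma>\<in>tuples. s (tuple_point \<gamma> v) * q v / (\<Prod>j<n. rho j (\<gamma> j) v)) = T v * q v" if "good v" for v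
    unfolding T(2)[OF that, symmetric] by (simp add: sum_distrib_right)
  then show ?case using T(1) tensor(2)
    by (intro bexI[of _ "\<lambda>v. T v * q v"]) auto
next
  case (add F F')
  then obtain T T' where "T \<in> S" "T' \<in> S"
    "\<forall>v. good v \<longrightarrow> (\<Sum>\<gamma>\<in>tuples. F (tuple_point \<gamma> v) v / (\<Prod>j<n. rho j (\<gamma> j) v)) = T v"
    "\<forall>v. good v \<longrightarrow> (\<Sum>\<gamma>\<in>tuples. F' (tuple_point \<gamma> v) v / (\<Prod>j<n. rho j (\<gamma> j) v)) = T' v" by blast
  then show ?case
    by (intro bexI[of _ "\<lambda>v. T v + T' v"]) (auto simp: add_divide_distrib sum.distrib)
qed

text \<open>
  The transformation law for residues turns the trace of \<open>F/jac\<close> into a sum over all tuples,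
  where Euler's formula applies coordinatewise; the extra tuples contribute \<open>0\<close>.
\<close>

lemma orbit_sum_over_jac:
  assumes F: "F \<in> bipoly"
  shows "\<exists>T\<in>S. \<forall>v. good v \<longrightarrow> (\<Sum>g\<in>G. F (g v) v / jac (g v)) = T v"
proof -
  obtain H where H: "H \<in> bipoly" "\<And>g y v. g \<in> G \<Longrightarrow> H y (g v) = H y v"
    "\<And>v. H v v * jac v = (\<Prod>j<n. rho j id v)"
    "\<And>y v. (\<And>j. j < n \<Longrightarrow> \<exists>g\<in>G. x j y = x j (g v)) \<Longrightarrow> (\<And>g. g \<in> G \<Longrightarrow> y \<noteq> g v) \<Longrightarrow> H y v = 0"
    using cofactor_exists by blast
  obtain T where T: "T \<in> S" "\<And>v. good v \<Longrightarrow>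
      (\<Sum>\<gamma>\<in>tuples. F (tuple_point \<gamma> v) v * H (tuple_point \<gamma> v) v / (\<Prod>j<n. rho j (\<gamma> j) v)) = T v"
    using tuple_sum_bipoly[OF bipoly.mult[OF F H(1)]] by blast
  \<comment> \<open>Constant tuples give back the orbit itself; positive dimension makes them
    distinct for distinct \<open>g\<close>.\<close>
  define k where "k g = restrict (\<lambda>_. g) {..<n}" for g :: "'v \<Rightarrow> 'v"
  have k_inj: "inj_on k G"
    using dim_pos by (intro inj_onI) (metis k_def lessThan_iff restrict_apply')
  have k_in: "k ` G \<subseteq> tuples" by (auto simp: k_def)
  have pt: "tuple_point (k g) v = g v" for g v
    by (simp add: tuple_point_def k_def coords_sum[OF x])
  have "(\<Sum>g\<in>G. F (g v) v / jac (g v)) = T v" if v: "good v" for v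
  proof -
    let ?t = "\<lambda>\<gamma>. F (tuple_point \<gamma> v) v * H (tuple_point \<gamma> v) v / (\<Prod>j<n. rho j (\<gamma> j) v)"
    \<comment> \<open>For good \<open>v\<close> a nonconstant tuple is not a point of the orbit,
      though all its coordinates occur there, so \<open>H\<close> vanishes.\<close>
    have zero: "?t \<gamma> = 0" if \<gamma>: "\<gamma> \<in> tuples - k ` G" for \<gamma>
    proof -
      have "\<gamma> j \<in> G" if "j < n" for j using \<gamma> that by auto
      then have 1: "\<exists>g\<in>G. x j (tuple_point \<gamma> v) = x j (g v)" if "j < n" for j
        using x_tuple_point[OF that] that by blast
      have 2: "tuple_point \<gamma> v \<noteq> g v" if g: "g \<in> G" for g
      proof
        assume "tuple_point \<gamma> v = g v"
        then have "x j (\<gamma> j v) = x j (g v)" if "j < n" for j using x_tuple_point[OF that] by metis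
        then have "\<gamma> j = g" if "j < n" for j
          using good_inj[OF v that] \<gamma> g that by (auto simp: inj_on_def)
        then have "\<gamma> = k g" using \<gamma> by (intro ext) (auto simp: k_def PiE_def extensional_def)
        then show False using \<gamma> g by auto
      qed
      have "H (tuple_point \<gamma> v) v = 0" by (rule H(4)) (fact 1, fact 2)
      then show ?thesis by simp
    qed
    have "?t (k g) = F (g v) v / jac (g v)" if g: "g \<in> G" for g
    proof -
      \<comment> \<open>\<open>H\<close> is invariant in its second argument, so \<open>v\<close>
        may be moved to \<open>g v\<close>, where the diagonal formula holds.\<close>
      have "H (g v) v * jac (g v) = (\<Prod>j<n. rho j g v)"
        using H(3)[of "g v"] H(2)[OF g, of "g v" v] by (simp add: rho_translate[OF g])
      moreover have "(\<Prod>j<n. rho j (k g j) v) = (\<Prod>j<n. rho j g v)" by (simp add: k_def)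
      moreover have "jac (g v) \<noteq> 0" "(\<Prod>j<n. rho j g v) \<noteq> 0"
        using jac_nonzero[OF good_translate[OF v g]] v g by (auto simp: good_def)
      ultimately show ?thesis unfolding pt by (simp add: frac_eq_eq)
    qed
    then have "(\<Sum>g\<in>G. F (g v) v / jac (g v)) = (\<Sum>\<gamma>\<in>k ` G. ?t \<gamma>)"
      by (subst sum.reindex[OF k_inj]) simp
    also have "\<dots> = (\<Sum>\<gamma>\<in>tuples. ?t \<gamma>)"
      using k_in zero by (intro sum.mono_neutral_left) (auto intro!: finite_PiE simp: finite_G)
    also have "\<dots> = T v" by (rule T(2)[OF v])
    finally show ?thesis .
  qed
  then show ?thesis using T(1) by blast
qed

text \<open>
  Multiplying by \<open>\<Prod>\<^sub>g a\<^sub>g(v) - a\<^sub>g(gv)\<close>, with \<open>g\<close> outside \<open>W\<close> and \<open>a\<^sub>g\<close> invariant under \<open>W\<close>, kills the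
  terms outside \<open>W\<close> in the sum over \<open>G\<close>. The denominators are products of linear forms \<open>l\<close>, and
  the factor can be chosen nonzero on \<open>l = 0\<close>, since otherwise some \<open>g\<close> outside \<open>W\<close> agrees there with
  an element of \<open>W\<close>.
\<close>

lemma subgroup_sum_over_jac:
  assumes W: "linear_group W" "W \<subseteq> G"
    and reflections: "\<And>g l. g \<in> G \<Longrightarrow> lform l \<Longrightarrow> \<exists>u. l u \<noteq> 0 \<Longrightarrow> (\<And>u. l u = 0 \<Longrightarrow> g u = u) \<Longrightarrow> g \<in> W"
    and s: "s \<in> S"
  shows "\<exists>T\<in>S. \<forall>v. good v \<longrightarrow> (\<Sum>w\<in>W. s (w v) / jac (w v)) = T v"
proof -
  obtain H where H: "H \<in> bipoly" "\<And>g y v. g \<in> G \<Longrightarrow> H y (g v) = H y v"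
    "\<And>v. H v v * jac v = (\<Prod>j<n. rho j id v)"
    using cofactor_exists by metis
  \<comment> \<open>Since \<open>1 / jac\<close> is \<open>H\<close> on the diagonal over a product
    of \<open>rho\<close>, the sum over \<open>W\<close> becomes \<open>N / Lambda\<close>. It
    remains to show that \<open>Lambda\<close> divides \<open>N\<close>.\<close>
  define R where "R w v = (\<Prod>j<n. \<Prod>g\<in>G - {w}. rho j g v)" for w v
  define N where "N v = (\<Sum>w\<in>W. s (w v) * (H (w v) (w v) * R w v))" for v
  have R_S: "R w \<in> S" for w unfolding R_def[abs_def] by (intro S_prod rho_S) auto
  have N_S: "N \<in> S"
    unfolding N_def[abs_def] using W R_S
    by (intro S_sum S_mult S_lmap[OF s] S_lmap[OF bipoly_diag[OF H(1)]] linear_groupD(4)) auto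
  have quot: "(\<Sum>w\<in>W. s (w v) / jac (w v)) = N v / Lambda v" if v: "good v" for v
    unfolding N_def sum_divide_distrib
  proof (rule sum.cong[OF refl])
    fix w assume "w \<in> W"
    then have w: "w \<in> G" using W by auto
    have "Lambda v = (\<Prod>j<n. rho j w v) * R w v"
      unfolding Lambda_def R_def prod.distrib[symmetric]
      by (intro prod.cong refl prod.remove[OF finite_G w])
    also have "(\<Prod>j<n. rho j w v) = H (w v) (w v) * jac (w v)" using H(3)[of "w v"] by (simp add: rho_translate[OF w])
    finally have "Lambda v = H (w v) (w v) * R w v * jac (w v)" by (simp add: mult_ac)
    moreover have "Lambda v \<noteq> 0" using v good_iff by blast
    ultimately show "s (w v) / jac (w v) = s (w v) * (H (w v) (w v) * R w v) / Lambda v" by simp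
  qed
  define e where "e a v = (\<Prod>g\<in>G - W. a g v - a g (g v))" for a :: "('v \<Rightarrow> 'v) \<Rightarrow> 'v \<Rightarrow> 'k" and v
  let ?E = "{e a | a. \<forall>g. a g \<in> Inv W}"
  have e_S: "e a \<in> S" if "\<And>g. a g \<in> Inv W" for a
    unfolding e_def[abs_def] by (intro S_prod S_diff S_lmap[OF Inv_S[OF that] lmap_G] Inv_S[OF that]) simp
  let ?I = "{(j, g, g'). j < n \<and> g \<in> G \<and> g' \<in> G \<and> g \<noteq> g'}"
  let ?l = "\<lambda>(j, g, g') v. x j (g v) - x j (g' v)"
  have Lam: "Lambda v = (\<Prod>i\<in>?I. ?l i v)" for v
  proof -
    have "?I = Sigma {..<n} (\<lambda>j. Sigma G (\<lambda>g. G - {g}))" by auto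
    then show ?thesis unfolding Lambda_def rho_def
      by (simp add: prod.Sigma finite_G case_prod_beta)
  qed
  have "\<exists>T\<in>S. \<forall>v. N v = (\<Prod>i\<in>?I. ?l i v) * T v"
  proof (rule cancel_linear_factors[OF _ _ _ N_S])
    show "finite ?I" by (rule finite_subset[of _ "{..<n} \<times> G \<times> G"]) (auto simp: finite_G)
    show l: "lform (?l i)" if "i \<in> ?I" for i
      using that lform_compose[OF coords_lform[OF x] lmap_G]
      by (auto simp: lform_iff algebra_simps lmap_add[OF lmap_G] lmap_scale[OF lmap_G])
    show l0: "\<exists>u. ?l i u \<noteq> 0" if "i \<in> ?I" for i
      using that x_separates by (auto split: prod.splits)
    show "?E \<subseteq> S" using e_S by auto
    show "\<exists>T\<in>S. \<forall>v. d v * N v = (\<Prod>i\<in>?I. ?l i v) * T v" if d: "d \<in> ?E" for d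
    proof -
      obtain a where a: "d = e a" "\<And>g. a g \<in> Inv W" using d by auto
      \<comment> \<open>The multiplier as a function of two points. At \<open>y = g v\<close> with
        \<open>g\<close> outside \<open>W\<close> the factor for \<open>g\<close> vanishes, and at
        \<open>y = w v\<close> invariance of the \<open>a g\<close> under \<open>W\<close> gives
        \<open>s (w v) * d v\<close>.\<close>
      define F where "F y u = s y * (\<Prod>g\<in>G - W. a g y - a g (g u))" for y u
      have "F \<in> bipoly" unfolding F_def[abs_def]
        by (intro bipoly.mult bipoly_prod bipoly_diff bipoly.left[OF s] bipoly.left[OF Inv_S[OF a(2)]]
            bipoly.right[OF S_lmap[OF Inv_S[OF a(2)] lmap_G]]) simp
      then obtain T where T: "T \<in> S" "\<And>v. good v \<Longrightarrow> (\<Sum>g\<in>G. F (g v) v / jac (g v)) = T v"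
        using orbit_sum_over_jac by blast
      have "d v * N v = Lambda v * T v" for v
      proof (rule good_dense)
        show "(\<lambda>v. d v * N v) \<in> S" "(\<lambda>v. Lambda v * T v) \<in> S"
          using e_S a N_S Lambda_S T(1) by auto
        fix v assume v: "good v"
        have "F (g v) v = 0" if "g \<in> G - W" for g
          unfolding F_def using that finite_G by auto
        then have "T v = (\<Sum>w\<in>W. F (w v) v / jac (w v))"
          unfolding T(2)[OF v, symmetric] using W(2) by (intro sum.mono_neutral_right) (auto simp: finite_G)
        also have "\<dots> = (\<Sum>w\<in>W. d v * (s (w v) / jac (w v)))"
        proof (rule sum.cong[OF refl])
          fix w assume "w \<in> W"
          then have "F (w v) v = s (w v) * d v"
            unfolding F_def a(1) e_def using Inv_apply[OF a(2)] by simp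
          then show "F (w v) v / jac (w v) = d v * (s (w v) / jac (w v))" by simp
        qed
        also have "\<dots> = d v * (N v / Lambda v)" unfolding sum_distrib_left[symmetric] quot[OF v] ..
        finally show "d v * N v = Lambda v * T v" using v good_iff by simp
      qed
      then show ?thesis using T(1) Lam by auto
    qed
    show "\<exists>d\<in>?E. \<exists>v. ?l i v = 0 \<and> d v \<noteq> 0" if i: "i \<in> ?I" for i
    proof -
      let ?U = "{v. ?l i v = 0}"
      have U: "subspace ?U" using subspace_lform_kernel[OF l[OF i]] .
      have "\<exists>c. c \<in> Inv W \<and> (g \<in> G - W \<longrightarrow> (\<exists>u\<in>?U. c u - c (g u) \<noteq> 0))" for g
      proof (rule ccontr)
        assume "\<not> ?thesis"
        then have no: "\<And>c. c \<in> Inv W \<Longrightarrow> g \<in> G - W \<and> (\<forall>u\<in>?U. c (g u) = c u)" by auto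
        then have g: "g \<in> G" "g \<notin> W" using Inv_const by auto
        obtain w where w: "w \<in> W" "\<And>u. u \<in> ?U \<Longrightarrow> g u = w u"
          using group_element_on_subspace[OF W(1) U lmap_G[OF g(1)]] no by blast
        obtain w' where w': "w' \<in> W" "w \<circ> w' = id" "\<And>v. w' (w v) = v"
          using linear_group_inverse[OF W(1) w(1)] by metis
        have "w' \<circ> g \<in> W"
        proof (rule reflections[OF _ l[OF i] l0[OF i]])
          show "w' \<circ> g \<in> G" using w' g W by (auto intro: linear_groupD(3)[OF G])
          show "(w' \<circ> g) u = u" if "?l i u = 0" for u using w(2)[of u] that w'(3) by simp
        qed
        then have "w \<circ> (w' \<circ> g) \<in> W" using w(1) linear_groupD(3)[OF W(1)] by blast
        then show False using g w'(2) by (simp add: comp_assoc[symmetric])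
      qed
      from choice[OF allI[OF this]]
      obtain c where "\<forall>g. c g \<in> Inv W \<and> (g \<in> G - W \<longrightarrow> (\<exists>u\<in>?U. c g u - c g (g u) \<noteq> 0))" ..
      then have c: "c g \<in> Inv W" "g \<in> G - W \<Longrightarrow> \<exists>u\<in>?U. c g u - c g (g u) \<noteq> 0" for g
        by (simp_all only: simp_thms)
      have "\<exists>u\<in>?U. \<forall>g\<in>G - W. c g u - c g (g u) \<noteq> 0"
      proof (rule generic_point[OF _ U, of "G - W" "\<lambda>g u. c g u - c g (g u)"])
        show "(\<lambda>u. c g u - c g (g u)) \<in> S" if "g \<in> G - W" for g
          using Inv_S[OF c(1)] S_lmap[OF Inv_S[OF c(1)] lmap_G] that by auto
      qed (use c(2) finite_G in auto)
      then obtain u where u: "u \<in> ?U" "\<And>g. g \<in> G - W \<Longrightarrow> c g u - c g (g u) \<noteq> 0" by blast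
      then have "e c u \<noteq> 0" unfolding e_def using finite_G by auto
      then show ?thesis using u(1) c(1) by blast
    qed
  qed
  then obtain T where T: "T \<in> S" "\<And>v. N v = Lambda v * T v" unfolding Lam by blast
  have "(\<Sum>w\<in>W. s (w v) / jac (w v)) = T v" if "good v" for v
    using quot[OF that] T(2)[of v] that good_iff by simp
  then show ?thesis using T(1) by blast
qed

end

section \<open>Cosets and subgroups containing all reflections\<close>

context polynomial_space
begin

definition right_coset :: "('v \<Rightarrow> 'v) set \<Rightarrow> ('v \<Rightarrow> 'v) \<Rightarrow> ('v \<Rightarrow> 'v) set" where
  "right_coset W h = (\<lambda>w. w \<circ> h) ` W"

lemma right_coset_self: "linear_group W \<Longrightarrow> h \<in> right_coset W h"
  using linear_groupD(2) by (auto simp: right_coset_def intro!: image_eqI[of _ _ id])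

lemma right_coset_eq:
  assumes "linear_group W" "h' \<in> right_coset W h"
  shows "right_coset W h' = right_coset W h"
proof -
  obtain w where w: "w \<in> W" "h' = w \<circ> h" using assms(2) by (auto simp: right_coset_def)
  have "right_coset W h' = (\<lambda>w. w \<circ> h) ` ((\<lambda>w'. w' \<circ> w) ` W)"
    unfolding right_coset_def w(2) image_image comp_assoc ..
  also have "(\<lambda>w'. w' \<circ> w) ` W = W"
    using linear_group_right_bij[OF assms(1) w(1)] by (simp add: bij_betw_def)
  finally show ?thesis unfolding right_coset_def .
qed

lemma right_coset_subset:
  "linear_group G \<Longrightarrow> W \<subseteq> G \<Longrightarrow> h \<in> G \<Longrightarrow> right_coset W h \<subseteq> G"
  using linear_groupD(3) by (auto simp: right_coset_def)

lemma right_coset_fiber: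
  assumes "linear_group W" "linear_group G" "W \<subseteq> G" "h \<in> G"
  shows "{h' \<in> G. right_coset W h' = right_coset W h} = right_coset W h"
  using right_coset_self[OF assms(1)] right_coset_eq[OF assms(1)] right_coset_subset[OF assms(2-4)] by auto

end

context jacobian_setting
begin

lemma Delta_homogeneous:
  assumes "\<And>i j t y v. i < n \<Longrightarrow> a i j (t *s y) (t *s v) = t ^ e i * a i j y v"
  shows "Delta (t *s y) (t *s v) = t ^ (\<Sum>i<n. e i) * Delta y v"
proof -
  let ?P = "{p. p permutes {0..<n}}"
  have D: "Delta y v = (\<Sum>p\<in>?P. signof p * (\<Prod>i=0..<n. a i (p i) y v))" for y v
    unfolding Delta_def det_def
    by (auto intro!: sum.cong prod.cong simp: permutes_in_image[of _ "{0..<n}", simplified])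
  have "(\<Prod>i=0..<n. a i (p i) (t *s y) (t *s v)) = t ^ (\<Sum>i<n. e i) * (\<Prod>i=0..<n. a i (p i) y v)" for p
  proof -
    have "(\<Prod>i=0..<n. a i (p i) (t *s y) (t *s v)) = (\<Prod>i=0..<n. t ^ e i * a i (p i) y v)"
      using assms by (intro prod.cong) auto
    then show ?thesis by (simp add: prod.distrib power_sum atLeast0LessThan)
  qed
  then show ?thesis unfolding D by (simp add: sum_distrib_left mult_ac)
qed

text \<open>
  If all \<open>a i j\<close> are homogeneous, so are \<open>Delta\<close> and \<open>jac\<close>, of the same degree; hence
  \<open>\<Sum>\<^sub>w Delta u (w v) / jac (w v)\<close> is a polynomial in \<open>u\<close> and in \<open>v\<close> that is invariant under
  scaling of \<open>(u, v)\<close>, which makes it independent of \<open>u\<close>. As \<open>Delta v (g v) = 0\<close> for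
  \<open>g \<noteq> id\<close>, every \<open>W\<close>-invariant \<open>c\<close> is recovered by summing \<open>c (g v) Delta u (g v) / jac (g v)\<close>
  over \<open>G\<close> at \<open>u = v\<close>, and therefore also at \<open>u = 0\<close>.
\<close>

lemma reflection_subgroup_eq:
  assumes hom: "\<And>i j t y v. i < n \<Longrightarrow> a i j (t *s y) (t *s v) = t ^ e i * a i j y v"
    and W: "linear_group W" "W \<subseteq> G"
    and reflections: "\<And>g l. g \<in> G \<Longrightarrow> lform l \<Longrightarrow> \<exists>u. l u \<noteq> 0 \<Longrightarrow> (\<And>u. l u = 0 \<Longrightarrow> g u = u) \<Longrightarrow> g \<in> W"
  shows "W = G"
proof -
  note Delta_hom = Delta_homogeneous[of e, OF hom]
  have jac_hom: "jac (t *s v) = t ^ (\<Sum>i<n. e i) * jac v" for t v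
    unfolding jac_def by (rule Delta_hom)
  have good_scale: "good (t *s v)" if "good v" "t \<noteq> 0" for t v
  proof -
    have "rho j g (t *s v) = t ^ card (G - {g}) * rho j g v" if j: "j < n" and g: "g \<in> G" for j g
    proof -
      have "x j (h (t *s v)) = t * x j (h v)" if "h \<in> G" for h
        using lmap_scale[OF lmap_G[OF that]] lform_scale[OF coords_lform[OF x j]] by simp
      then have "rho j g (t *s v) = (\<Prod>h\<in>G - {g}. t * (x j (g v) - x j (h v)))"
        unfolding rho_def using g by (intro prod.cong) (auto simp: right_diff_distrib)
      then show ?thesis by (simp add: rho_def prod.distrib)
    qed
    then show ?thesis using that by (simp add: good_def)
  qed
  define \<Psi> where "\<Psi> u v = (\<Sum>w\<in>W. Delta u (w v) / jac (w v))" for u v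
  have \<Psi>: "\<Psi> u v = \<Psi> 0 v" if v: "good v" for u v
  proof -
    have "\<exists>q\<in>S. \<forall>v. good v \<longrightarrow> \<Psi> u v = q v" unfolding \<Psi>_def
      by (rule subgroup_sum_over_jac[OF W _ bipoly_S_right[OF Delta_bipoly]], rule reflections)
    then obtain q where q: "q \<in> S" "\<And>v. good v \<Longrightarrow> \<Psi> u v = q v" by blast
    have "(\<lambda>u. \<Sum>w\<in>W. inverse (jac (w v)) * Delta u (w v)) \<in> S"
      by (intro S_sum S_cmult bipoly_S_left[OF Delta_bipoly])
    then have \<Psi>_S: "(\<lambda>u. \<Psi> u v) \<in> S" unfolding \<Psi>_def by (simp add: divide_inverse mult.commute)
    \<comment> \<open>By homogeneity of degree 0, scaling \<open>v\<close> by \<open>t\<close> has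
      the same effect as scaling \<open>u\<close> by the inverse of \<open>t\<close>, so
      \<open>A\<close> at \<open>t\<close> equals \<open>B\<close> at the inverse of
      \<open>t\<close>.\<close>
    obtain A where A: "\<And>t. q (t *s v) = poly A t" using S_polycurve[OF q(1) polycurve_ray] by blast
    obtain B where B: "\<And>t. \<Psi> (t *s u) v = poly B t" using S_polycurve[OF \<Psi>_S polycurve_ray] by blast
    have "poly A t = poly B (inverse t)" if t: "t \<noteq> 0" for t
    proof -
      have "poly A t = \<Psi> u (t *s v)" using A q(2)[OF good_scale[OF v t]] by simp
      also have "\<dots> = \<Psi> (inverse t *s u) v"
        unfolding \<Psi>_def
      proof (rule sum.cong[OF refl])
        fix w assume "w \<in> W"
        then have w: "w (t *s v) = t *s w v" using lmap_scale lmap_G W(2) by blast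
        have "Delta u (w (t *s v)) = t ^ (\<Sum>i<n. e i) * Delta (inverse t *s u) (w v)"
          using Delta_hom[of t "inverse t *s u" "w v"] t unfolding w by simp
        moreover have "jac (w (t *s v)) = t ^ (\<Sum>i<n. e i) * jac (w v)" unfolding w by (rule jac_hom)
        ultimately show "Delta u (w (t *s v)) / jac (w (t *s v)) = Delta (inverse t *s u) (w v) / jac (w v)"
          using t by simp
      qed
      finally show ?thesis using B by simp
    qed
    then have "degree B = 0" by (rule poly_inverse_eq_imp_const[OF infinite_field])
    then obtain \<beta> where "B = [:\<beta>:]" by (rule degree_eq_zeroE)
    then show ?thesis using B[of 1] B[of 0] by simp
  qed
  have "g \<in> W" if g: "g \<in> G" for g
  proof -
    have inv: "c (g u) = c u" if c: "c \<in> Inv W" for c u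
    proof -
      define \<Phi> where "\<Phi> u v = (\<Sum>h\<in>G. c (h v) * Delta u (h v) / jac (h v))" for u v
      note fiber = right_coset_fiber[OF W(1) G W(2)]
      have \<Phi>_const: "\<Phi> u v = \<Phi> 0 v" if v: "good v" for u v
      proof -
        \<comment> \<open>On the points \<open>w (k v)\<close> with \<open>w\<close> in
          \<open>W\<close> the function \<open>c\<close> is constant, so the right coset of
          \<open>k\<close> contributes \<open>c (k v) * \<Psi> u (k v)\<close>, which does not
          depend on \<open>u\<close>.\<close>
        have grouped: "\<Phi> u v = (\<Sum>C\<in>right_coset W ` G. \<Sum>h\<in>C. c (h v) * Delta u (h v) / jac (h v))" for u
        proof -
          have "\<Phi> u v = (\<Sum>C\<in>right_coset W ` G. \<Sum>h\<in>{h \<in> G. right_coset W h = C}. c (h v) * Delta u (h v) / jac (h v))"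
            unfolding \<Phi>_def using finite_G by (intro sum.group[symmetric]) auto
          also have "\<dots> = (\<Sum>C\<in>right_coset W ` G. \<Sum>h\<in>C. c (h v) * Delta u (h v) / jac (h v))"
            using fiber by (intro sum.cong) auto
          finally show ?thesis .
        qed
        have part: "(\<Sum>h\<in>right_coset W k. c (h v) * Delta u (h v) / jac (h v)) = c (k v) * \<Psi> u (k v)" if k: "k \<in> G" for k u
        proof -
          obtain k' where k': "k' \<in> G" "k \<circ> k' = id" using linear_group_inverse[OF G k] by metis
          have "inj_on (\<lambda>w. w \<circ> k) W"
          proof (rule inj_onI)
            fix w w' assume "w \<circ> k = w' \<circ> k"
            then have "w \<circ> (k \<circ> k') = w' \<circ> (k \<circ> k')" by (simp only: comp_assoc[symmetric])
            then show "w = w'" using k'(2) by simp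
          qed
          then have "(\<Sum>h\<in>right_coset W k. c (h v) * Delta u (h v) / jac (h v))
              = (\<Sum>w\<in>W. c (w (k v)) * Delta u (w (k v)) / jac (w (k v)))"
            unfolding right_coset_def by (subst sum.reindex) auto
          also have "\<dots> = (\<Sum>w\<in>W. c (k v) * (Delta u (w (k v)) / jac (w (k v))))"
            using Inv_apply[OF c] by (intro sum.cong) auto
          finally show ?thesis unfolding \<Psi>_def sum_distrib_left .
        qed
        have "(\<Sum>h\<in>right_coset W k. c (h v) * Delta u (h v) / jac (h v))
            = (\<Sum>h\<in>right_coset W k. c (h v) * Delta 0 (h v) / jac (h v))" if "k \<in> G" for k
          unfolding part[OF that] \<Psi>[OF good_translate[OF v that], of u] ..
        then have "(\<Sum>h\<in>C. c (h v) * Delta u (h v) / jac (h v)) = (\<Sum>h\<in>C. c (h v) * Delta 0 (h v) / jac (h v))"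
          if "C \<in> right_coset W ` G" for C using that by blast
        then show ?thesis unfolding grouped by (rule sum.cong[OF refl])
      qed
      have \<Phi>_diag: "\<Phi> v v = c v" if v: "good v" for v
      proof -
        have "Delta v (h v) = 0" if h: "h \<in> G - {id}" for h
        proof (rule Delta_zero)
          show "v \<noteq> h v"
            using good_inj[OF v dim_pos] h id_G by (auto simp: inj_on_def)
          show "f i v = f i (h v)" if "i < n" for i using Inv_apply[OF f_Inv[OF that]] h by auto
        qed
        then have "\<Phi> v v = (\<Sum>h\<in>{id}. c (h v) * Delta v (h v) / jac (h v))"
          unfolding \<Phi>_def using id_G finite_G by (intro sum.mono_neutral_right) auto
        also have "\<dots> = c v" using jac_nonzero[OF v] by (simp add: jac_def)
        finally show ?thesis .
      qed
      show ?thesis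
      proof (rule good_dense[OF S_lmap[OF Inv_S[OF c] lmap_G[OF g]] Inv_S[OF c]])
        fix v assume v: "good v"
        \<comment> \<open>With \<open>u\<close> fixed at 0 the sum over \<open>G\<close> depends
          only on the orbit of \<open>v\<close>, so \<open>c\<close> is invariant under all of
          \<open>G\<close>.\<close>
        have "c (g v) = \<Phi> 0 (g v)" using \<Phi>_diag \<Phi>_const good_translate[OF v g] by metis
        also have "\<dots> = \<Phi> 0 v"
          unfolding \<Phi>_def using sum_linear_group_right[OF G g, of "\<lambda>u. c u * Delta 0 u / jac u"] .
        also have "\<dots> = c v" using \<Phi>_diag \<Phi>_const v by metis
        finally show "c (g v) = c v" .
      qed
    qed
    \<comment> \<open>As all \<open>W\<close>-invariants are fixed by \<open>g\<close>, orbit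
      separation puts \<open>g\<close> into \<open>W\<close>.\<close>
    obtain w where "w \<in> W" "\<And>u. g u = w u"
      using group_element_on_subspace[OF W(1) subspace_UNIV lmap_G[OF g] inv] by auto
    then show ?thesis by (metis ext)
  qed
  then show ?thesis using W(2) by blast
qed

text \<open>The quotient map by \<open>G\<close>, with its target identified with \<open>V\<close>
  through the basis \<open>b\<close>.\<close>

abbreviation "f_map v \<equiv> (\<Sum>i<n. f i v *s b i)"

text \<open>
  The lowest homogeneous part of a relation, expanded at a point with \<open>jac \<noteq> 0\<close>, is a relation
  between linear coordinates.
\<close>

lemma f_functionally_independent:
  assumes Q: "Q \<in> S" "\<And>v. Q (f_map v) = 0"
  shows "Q u = 0"
proof (rule ccontr)
  assume Qu: "Q u \<noteq> 0"
  obtain v0 where "good v0" using good_exists by blast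
  then have J: "jac v0 \<noteq> 0" by (rule jac_nonzero)
  define Q' where "Q' y = Q (f_map v0 + y)" for y
  have Q'_S: "Q' \<in> S" unfolding Q'_def[abs_def] by (rule S_translate[OF Q(1)])
  obtain D where D: "\<And>d. D < d \<Longrightarrow> hpart d Q' = (\<lambda>_. 0)" "\<And>t v. Q' (t *s v) = (\<Sum>d\<le>D. t ^ d * hpart d Q' v)"
    "\<And>v. Q' v = (\<Sum>d\<le>D. hpart d Q' v)" using hpart_expansion[OF Q'_S] by blast
  have "Q' (u - f_map v0) \<noteq> 0" using Qu by (simp add: Q'_def)
  then have ex: "\<exists>d. hpart d Q' \<noteq> (\<lambda>_. 0)" using D(3)[of "u - f_map v0"] by (metis (mono_tags, lifting) sum.neutral)
  define d where "d = (LEAST d. hpart d Q' \<noteq> (\<lambda>_. 0))"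
  have d: "hpart d Q' \<noteq> (\<lambda>_. 0)" unfolding d_def by (rule LeastI_ex[OF ex])
  have lt: "hpart i Q' = (\<lambda>_. 0)" if "i < d" for i using not_less_Least[of i] that unfolding d_def by blast
  have "d \<le> D" using D(1)[of d] d by (meson not_le_imp_less)
  \<comment> \<open>The differential of \<open>f_map\<close> at \<open>v0\<close>, invertible
    because \<open>jac v0\<close> is nonzero.\<close>
  define lin where "lin v = (\<Sum>i<n. (\<Sum>j<n. a i j v0 v0 * x j v) *s b i)" for v
  have x_lin: "x i (lin v) = (\<Sum>j<n. a i j v0 v0 * x j v)" if "i < n" for i v
    unfolding lin_def using coords_combination[OF x that] .
  have lin0: "hpart d Q' (lin v) = 0" for v
  proof -
    \<comment> \<open>Chosen so that \<open>f_map (v0 + t *s v)\<close> equals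
      \<open>f_map v0 + t *s \<gamma> t\<close>, with value \<open>lin v\<close> at
      \<open>t = 0\<close>.\<close>
    define \<gamma> where "\<gamma> t = (\<Sum>i<n. (\<Sum>j<n. a i j (v0 + t *s v) v0 * x j v) *s b i)" for t
    have "polycurve \<gamma>" unfolding polycurve_def
    proof (intro allI impI)
      fix l assume l: "lform l"
      have "(\<lambda>y. \<Sum>i<n. (\<Sum>j<n. a i j y v0 * x j v) * l (b i)) \<in> S"
        by (intro S_sum S_mult S_const bipoly_S_left[OF a_bipoly])
      from S_polycurve[OF this polycurve_line]
      obtain p where "\<And>t. (\<Sum>i<n. (\<Sum>j<n. a i j (v0 + t *s v) v0 * x j v) * l (b i)) = poly p t" by blast
      then show "\<exists>p. \<forall>t. l (\<gamma> t) = poly p t"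
        unfolding \<gamma>_def using l by (intro exI[of _ p]) (simp add: lform_sum lform_scale)
    qed
    then have "\<forall>k. \<exists>p. \<forall>t. hpart k Q' (\<gamma> t) = poly p t"
      using S_polycurve[OF hpart_S[OF Q'_S]] by metis
    from choice[OF this] obtain p where p: "\<And>k t. hpart k Q' (\<gamma> t) = poly (p k) t" by blast
    \<comment> \<open>The relation along the curve divided by \<open>t ^ d\<close>; its value at 0
      is the lowest part of \<open>Q'\<close> at \<open>lin v\<close>.\<close>
    define R where "R = (\<Sum>k\<in>{d..D}. monom 1 (k - d) * p k)"
    have "poly R t = poly 0 t" if t: "t \<in> {t. t \<noteq> 0}" for t
    proof -
      have "f i (v0 + t *s v) = f i v0 + t * (\<Sum>j<n. a i j (v0 + t *s v) v0 * x j v)" if "i < n" for i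
      proof -
        have "f i (v0 + t *s v) - f i v0 = (\<Sum>j<n. a i j (v0 + t *s v) v0 * (t * x j v))"
          using a_diff[OF that] by (simp add: lform_add lform_scale coords_lform[OF x])
        then show ?thesis by (simp add: sum_distrib_left mult_ac eq_diff_eq diff_eq_eq)
      qed
      then have "f_map (v0 + t *s v) = f_map v0 + t *s \<gamma> t"
        by (simp add: \<gamma>_def scale_left_distrib sum.distrib scale_sum_right)
      then have "0 = Q' (t *s \<gamma> t)" using Q(2)[of "v0 + t *s v"] by (simp add: Q'_def)
      also have "\<dots> = (\<Sum>k\<le>D. t ^ k * hpart k Q' (\<gamma> t))" by (rule D(2))
      also have "\<dots> = (\<Sum>k\<in>{d..D}. t ^ k * hpart k Q' (\<gamma> t))"
        using lt by (intro sum.mono_neutral_right) (auto simp: not_le)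
      also have "\<dots> = (\<Sum>k\<in>{d..D}. t ^ d * (t ^ (k - d) * hpart k Q' (\<gamma> t)))"
        by (intro sum.cong refl) (simp add: mult.assoc[symmetric] power_add[symmetric])
      also have "\<dots> = t ^ d * poly R t"
        by (simp add: R_def poly_sum poly_monom p sum_distrib_left)
      finally show ?thesis using t by simp
    qed
    then have "R = 0" using poly_eq_if_infinite[OF infinite_nonzero] by blast
    moreover have "poly R 0 = (\<Sum>k\<in>{d..D}. if k = d then poly (p d) 0 else 0)"
      unfolding R_def poly_sum by (intro sum.cong) (auto simp: poly_monom)
    ultimately have "poly (p d) 0 = 0" using \<open>d \<le> D\<close> by simp
    moreover have "\<gamma> 0 = lin v" by (simp add: \<gamma>_def lin_def)
    ultimately show ?thesis using p[of d 0] by simp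
  qed
  have lin: "lmap lin"
    unfolding lmap_iff
  proof (intro conjI allI)
    show "lin (u + v) = lin u + lin v" for u v
      by (rule coords_eqI[OF x]) (simp add: x_lin lform_add[OF coords_lform[OF x]] distrib_left sum.distrib)
    show "lin (c *s u) = c *s lin u" for c u
      by (rule coords_eqI[OF x]) (simp add: x_lin lform_scale[OF coords_lform[OF x]] sum_distrib_left mult_ac)
  qed
  have "inj lin"
  proof (rule injI)
    fix u v assume "lin u = lin v"
    then have z: "lin (u - v) = 0" using lmap_diff[OF lin] by simp
    let ?w = "vec n (\<lambda>j. x j (u - v))" and ?a = "mat n n (\<lambda>(i, j). a i j v0 v0)"
    have "?a *\<^sub>v ?w = 0\<^sub>v n"
    proof (rule eq_vecI)
      fix i assume "i < dim_vec (0\<^sub>v n :: 'k vec)"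
      then have i: "i < n" by simp
      then have "(?a *\<^sub>v ?w) $ i = x i (lin (u - v))"
        by (simp add: x_lin scalar_prod_def atLeast0LessThan)
      then show "(?a *\<^sub>v ?w) $ i = 0\<^sub>v n $ i" using i z lform_zero[OF coords_lform[OF x i]] by simp
    qed auto
    moreover have "?a \<in> carrier_mat n n" "?w \<in> carrier_vec n" by auto
    ultimately have "?w = 0\<^sub>v n"
      using J det_0_iff_vec_prod_zero[of ?a n] unfolding jac_def Delta_def by blast
    then have "x j (u - v) = 0" if "j < n" for j using that by (metis index_vec index_zero_vec(1))
    then show "u = v"
      by (intro coords_eqI[OF x]) (simp add: lform_diff[OF coords_lform[OF x]])
  qed
  then have "surj lin" using linear_inj_imp_surj[OF lin] by blast
  then have "hpart d Q' v = 0" for v using lin0 by (metis surjD)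
  then show False using d by auto
qed

text \<open>Algebraic independence uses the functions themselves as variables, so distinct indices
  must give distinct functions.\<close>

lemma f_inj: "inj_on f {..<n}"
proof (rule inj_onI)
  fix i j assume ij: "i \<in> {..<n}" "j \<in> {..<n}" "f i = f j"
  have "x i (b i) - x j (b i) = 0"
  proof (rule f_functionally_independent)
    show "(\<lambda>v. x i v - x j v) \<in> S" using ij x_S by (intro S_diff) auto
    show "x i (f_map v) - x j (f_map v) = 0" for v
      using ij coords_combination[OF x, of _ "\<lambda>i. f i v"] by simp
  qed
  then show "i = j" using ij coords_basis[OF x] by (auto split: if_splits)
qed

lemma f_algebraically_independent: "algebraically_independent (f ` {..<n})"
  unfolding algebraically_independent_def
proof (intro allI impI)
  fix p :: "(('v \<Rightarrow> 'k) \<Rightarrow>\<^sub>0 nat) \<Rightarrow>\<^sub>0 'k"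
  assume p: "(\<forall>m\<in>Poly_Mapping.keys p. Poly_Mapping.keys m \<subseteq> f ` {..<n}) \<and> (\<forall>v. mpoly_eval (\<lambda>f. f v) p = 0)"
  define idx where "idx = the_inv_into {..<n} f"
  have idx: "idx (f i) = i" if "i < n" for i using the_inv_into_f_f[OF f_inj] that by (simp add: idx_def)
  have cong: "mpoly_eval \<alpha> p = mpoly_eval \<beta> p" if "\<And>i. i < n \<Longrightarrow> \<alpha> (f i) = \<beta> (f i)" for \<alpha> \<beta>
    unfolding mpoly_eval_def
  proof (intro sum.cong refl arg_cong[where f = "(*) _"] prod.cong)
    fix m q assume "m \<in> Poly_Mapping.keys p" "q \<in> Poly_Mapping.keys m"
    then have "q \<in> f ` {..<n}" using p by blast
    then show "\<alpha> q ^ Poly_Mapping.lookup m q = \<beta> q ^ Poly_Mapping.lookup m q" using that by auto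
  qed
  define Q where "Q y = mpoly_eval (\<lambda>q. x (idx q) y) p" for y
  have Q_S: "Q \<in> S"
    unfolding Q_def[abs_def] mpoly_eval_def
  proof (intro S_sum S_cmult S_prod S_power)
    fix m q assume "m \<in> Poly_Mapping.keys p" "q \<in> Poly_Mapping.keys m"
    then have "q \<in> f ` {..<n}" using p by blast
    then show "(\<lambda>v. x (idx q) v) \<in> S" using idx x_S by auto
  qed
  have "Q (f_map v) = 0" for v
  proof -
    have "Q (f_map v) = mpoly_eval (\<lambda>q. q v) p"
      unfolding Q_def by (rule cong) (simp add: idx coords_combination[OF x])
    then show ?thesis using p by simp
  qed
  then have Q0: "Q u = 0" for u using f_functionally_independent[OF Q_S] by blast
  show "p = 0"
  proof (rule mpoly_eq_0_if_eval_eq_0[OF infinite_field])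
    fix \<alpha> :: "('v \<Rightarrow> 'k) \<Rightarrow> 'k"
    have "mpoly_eval \<alpha> p = Q (\<Sum>i<n. \<alpha> (f i) *s b i)"
      unfolding Q_def by (rule cong) (simp add: idx coords_combination[OF x])
    then show "mpoly_eval \<alpha> p = 0" using Q0 by simp
  qed
qed

end

context polynomial_space
begin

lemma jacobian_setting_exists:
  assumes "n > 0" and G: "linear_group G" and f: "generated_algebra (f ` {..<n}) = Inv G"
    and hom: "\<And>i. i < n \<Longrightarrow> homogeneous (d i) (f i)"
  obtains x b a where "jacobian_setting (*s) Basis G f x b a"
    "\<And>i j t y v. a i j (t *s y) (t *s v) = t ^ (d i - 1) * a i j y v"
proof -
  have "\<exists>u. g u \<noteq> g' u" if "g \<noteq> g'" for g g' :: "'v \<Rightarrow> 'v" using that by auto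
  then obtain u where u: "\<And>g g'. g \<noteq> g' \<Longrightarrow> g (u g g') \<noteq> (g' :: 'v \<Rightarrow> 'v) (u g g')" by metis
  \<comment> \<open>One nonzero vector for each pair of distinct group elements; coordinates that
    vanish nowhere on \<open>X\<close> separate them.\<close>
  define X where "X = (\<lambda>(g, g'). g (u g g') - g' (u g g')) ` {(g, g'). g \<in> G \<and> g' \<in> G \<and> g \<noteq> g'}"
  have "finite X" unfolding X_def
    by (rule finite_imageI, rule finite_subset[of _ "G \<times> G"]) (auto simp: linear_groupD(1)[OF G])
  moreover have "0 \<notin> X" using u by (auto simp: X_def)
  ultimately obtain x b where x: "coords x b" "\<And>j v. j < n \<Longrightarrow> v \<in> X \<Longrightarrow> x j v \<noteq> 0"
    using generic_coords by blast
  have sep: "\<exists>v. x j (g v) \<noteq> x j (g' v)" if "j < n" "g \<in> G" "g' \<in> G" "g \<noteq> g'" for j g g'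
  proof -
    have "g (u g g') - g' (u g g') \<in> X" unfolding X_def using that by (intro image_eqI[of _ _ "(g, g')"]) auto
    then have "x j (g (u g g') - g' (u g g')) \<noteq> 0" by (rule x(2)[OF that(1)])
    then show ?thesis by (metis lform_diff[OF coords_lform[OF x(1) that(1)]] eq_iff_diff_eq_0)
  qed
  have "\<forall>i. \<exists>a. (\<forall>j. a j \<in> bipoly) \<and>
    (i < n \<longrightarrow> (\<forall>y v. f i y - f i v = (\<Sum>j<n. a j y v * (x j y - x j v)))) \<and>
    (\<forall>j t y v. a j (t *s y) (t *s v) = t ^ (d i - 1) * a j y v)"
  proof
    fix i
    show "\<exists>a. (\<forall>j. a j \<in> bipoly) \<and>
      (i < n \<longrightarrow> (\<forall>y v. f i y - f i v = (\<Sum>j<n. a j y v * (x j y - x j v)))) \<and>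
      (\<forall>j t y v. a j (t *s y) (t *s v) = t ^ (d i - 1) * a j y v)"
    proof (cases "i < n")
      case True
      then have eq: "hpart (d i) (f i) = f i" using hpart_of_homogeneous[OF hom] by simp
      obtain a where "(\<forall>j. a j \<in> bipoly) \<and>
          (\<forall>y v. f i y - f i v = (\<Sum>j<n. a j y v * (x j y - x j v))) \<and>
          (\<forall>j t y v. a j (t *s y) (t *s v) = t ^ (d i - 1) * a j y v) \<and> (d i = 0 \<longrightarrow> a = (\<lambda>_ _ _. 0))"
        using homogeneous_difference_coeffs[OF x(1) homogeneous_S[OF hom[OF True]], of "d i"]
        unfolding eq by (elim exE)
      then show ?thesis by (intro exI[of _ a]) (simp only: simp_thms)
    next
      case False
      then show ?thesis by (intro exI[of _ "\<lambda>_ _ _. 0"]) (auto simp: bipoly_const)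
    qed
  qed
  from choice[OF this] obtain a where a: "\<And>i j. a i j \<in> bipoly"
    "\<And>i y v. i < n \<Longrightarrow> f i y - f i v = (\<Sum>j<n. a i j y v * (x j y - x j v))"
    "\<And>i j t y v. a i j (t *s y) (t *s v) = t ^ (d i - 1) * a i j y v" by blast
  have "jacobian_setting (*s) Basis G f x b a"
    by unfold_locales (use assms x(1) sep a in auto)
  then show ?thesis using that a(3) by blast
qed

section \<open>Homogeneous generators\<close>

lemma generated_algebra_sum:
  "(\<And>i. i \<in> I \<Longrightarrow> f i \<in> generated_algebra F) \<Longrightarrow> (\<lambda>v. \<Sum>i\<in>I. f i v) \<in> generated_algebra F"
  by (induction I rule: infinite_finite_induct) (auto intro: generated_algebra.intros)

lemma generated_algebra_cmult:
  "f \<in> generated_algebra F \<Longrightarrow> (\<lambda>v. c * f v) \<in> generated_algebra F"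
  using generated_algebra.mult[OF generated_algebra.const] .

lemma generated_algebra_subset_Inv:
  assumes "F \<subseteq> Inv H"
  shows "generated_algebra F \<subseteq> Inv H"
proof
  fix f assume "f \<in> generated_algebra F"
  then show "f \<in> Inv H"
    by (induction rule: generated_algebra.induct) (use assms in \<open>auto intro: Inv_const Inv_add Inv_mult\<close>)
qed

text \<open>The square of the ideal of invariants that vanish at the origin.\<close>

inductive_set decomposable :: "('v \<Rightarrow> 'v) set \<Rightarrow> ('v \<Rightarrow> 'k) set" for H where
  zero: "(\<lambda>_. 0) \<in> decomposable H"
| add: "f \<in> decomposable H \<Longrightarrow> g \<in> decomposable H \<Longrightarrow> (\<lambda>v. f v + g v) \<in> decomposable H"
| mult: "p \<in> Inv H \<Longrightarrow> q \<in> Inv H \<Longrightarrow> p 0 = 0 \<Longrightarrow> q 0 = 0 \<Longrightarrow> (\<lambda>v. p v * q v) \<in> decomposable H"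

lemma decomposable_Inv: "f \<in> decomposable H \<Longrightarrow> f \<in> Inv H"
  by (induction rule: decomposable.induct) (auto intro: Inv_const Inv_add Inv_mult)

lemma decomposable_cmult: "f \<in> decomposable H \<Longrightarrow> (\<lambda>v. c * f v) \<in> decomposable H"
proof (induction rule: decomposable.induct)
  case zero then show ?case using decomposable.zero by simp
next
  case (add f g) then show ?case using decomposable.add[OF add.IH] by (simp add: distrib_left)
next
  case (mult p q) then show ?case using decomposable.mult[of "\<lambda>v. c * p v" H q] Inv_cmult[of p H c]
    by (simp add: mult.assoc)
qed

lemma decomposable_sum:
  "(\<And>i. i \<in> I \<Longrightarrow> f i \<in> decomposable H) \<Longrightarrow> (\<lambda>v. \<Sum>i\<in>I. f i v) \<in> decomposable H"
  by (induction I rule: infinite_finite_induct) (auto intro: decomposable.intros)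

lemma homogeneous_at_0:
  assumes "homogeneous d f" "d > 0"
  shows "f 0 = 0"
proof -
  have "f (0 *s 0) = 0 ^ d * f 0" using assms(1) unfolding homogeneous_def by blast
  then show ?thesis using assms(2) by (cases d) simp_all
qed

lemma decomposable_hpart:
  assumes H: "linear_group H" and "f \<in> decomposable H"
  shows "hpart d f \<in> decomposable H"
  using assms(2)
proof (induction rule: decomposable.induct)
  case zero then show ?case using decomposable.zero by (simp add: hpart_const)
next
  case (add f g)
  then show ?case unfolding hpart_add[OF Inv_S[OF decomposable_Inv[OF add(1)]] Inv_S[OF decomposable_Inv[OF add(2)]]]
    by (intro decomposable.add)
next
  case (mult p q)
  have "(\<lambda>v. hpart i p v * hpart (d - i) q v) \<in> decomposable H" for i
  proof (rule decomposable.mult[OF Inv_hpart[OF H mult(1)] Inv_hpart[OF H mult(2)]])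
    have "hpart j r 0 = 0" if "r \<in> Inv H" "r 0 = 0" for j r
    proof (cases "j = 0")
      case True then show ?thesis using that hpart_0[OF Inv_S] by simp
    next
      case False
      then show ?thesis using homogeneous_at_0[OF hpart_homogeneous[OF Inv_S[OF that(1)]]] by simp
    qed
    then show "hpart i p 0 = 0" "hpart (d - i) q 0 = 0" using mult by auto
  qed
  then show ?case unfolding hpart_mult[OF Inv_S[OF mult(1)] Inv_S[OF mult(2)]] by (rule decomposable_sum)
qed

text \<open>Both factors vanish at the origin, so a component of degree \<open>d\<close> of their
  product only involves components of positive degree less than \<open>d\<close>. This drives the
  induction on the degree.\<close>

lemma decomposable_hpart_generated:
  assumes H: "linear_group H" and "f \<in> decomposable H"
    and T: "\<And>e c. e < d \<Longrightarrow> c \<in> Inv H \<Longrightarrow> homogeneous e c \<Longrightarrow> c \<in> generated_algebra T"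
  shows "hpart d f \<in> generated_algebra T"
  using assms(2)
proof (induction rule: decomposable.induct)
  case zero then show ?case by (simp add: hpart_const generated_algebra.const)
next
  case (add f g)
  then show ?case unfolding hpart_add[OF Inv_S[OF decomposable_Inv[OF add(1)]] Inv_S[OF decomposable_Inv[OF add(2)]]]
    by (intro generated_algebra.add)
next
  case (mult p q)
  have "(\<lambda>v. hpart i p v * hpart (d - i) q v) \<in> generated_algebra T" if "i \<le> d" for i
  proof (cases "i = 0 \<or> i = d")
    case True
    then have "(\<lambda>v. hpart i p v * hpart (d - i) q v) = (\<lambda>_. 0)"
      using mult hpart_0[OF Inv_S] by auto
    then show ?thesis by (simp add: generated_algebra.const)
  next
    case False
    then have "i < d" "d - i < d" using that by auto
    then show ?thesis using T Inv_hpart[OF H] hpart_homogeneous[OF Inv_S] mult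
      by (intro generated_algebra.mult) blast+
  qed
  then show ?case unfolding hpart_mult[OF Inv_S[OF mult(1)] Inv_S[OF mult(2)]]
    by (intro generated_algebra_sum) auto
qed

text \<open>Linear independence modulo decomposables. \<open>E\<close> is a further property
  demanded of the generators, such as being an eigenvector.\<close>

definition independent_generators :: "('v \<Rightarrow> 'v) set \<Rightarrow> (('v \<Rightarrow> 'k) \<Rightarrow> bool) \<Rightarrow> ('v \<Rightarrow> 'k) set \<Rightarrow> bool" where
  "independent_generators H E T \<longleftrightarrow> finite T \<and>
    (\<forall>\<tau>\<in>T. \<tau> \<in> Inv H \<and> \<tau> 0 = 0 \<and> E \<tau> \<and> (\<exists>d. homogeneous d \<tau>)) \<and>
    (\<forall>r. (\<lambda>v. \<Sum>\<tau>\<in>T. r \<tau> * \<tau> v) \<in> decomposable H \<longrightarrow> (\<forall>\<tau>\<in>T. r \<tau> = 0))"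

text \<open>
  \<open>bound\<close> says that, up to order \<open>D\<close>, the invariants vanishing at the origin are spanned by \<open>n\<close>
  functions modulo decomposables.
\<close>

lemma independent_generators_card_le:
  assumes H: "linear_group H" and T: "independent_generators H E T"
    and bound: "\<And>D. D > 0 \<Longrightarrow> \<exists>F. \<forall>c\<in>Inv H. c 0 = 0 \<longrightarrow> (\<exists>r. \<exists>i\<in>decomposable H.
      vanishes_to_order D (\<lambda>v. c v - (\<Sum>l<n. r l * F l v) - i v))"
  shows "card T \<le> n"
proof (rule ccontr)
  assume "\<not> card T \<le> n"
  then have lt: "card {..<n} < card T" by simp
  have fin: "finite T" using T by (simp add: independent_generators_def)
  have T': "\<tau> \<in> Inv H" "\<tau> 0 = 0" "\<exists>d. homogeneous d \<tau>" if "\<tau> \<in> T" for \<tau>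
    using T that by (auto simp: independent_generators_def)
  have TS: "\<tau> \<in> S" if "\<tau> \<in> T" for \<tau> using T'(1)[OF that] by (rule Inv_S)
  obtain deg where deg: "\<And>\<tau>. \<tau> \<in> T \<Longrightarrow> homogeneous (deg \<tau>) \<tau>" using T'(3) by metis
  \<comment> \<open>\<open>D\<close> exceeds all degrees in \<open>T\<close>, so a combination of
    elements of \<open>T\<close> is the sum of its parts of degree less than
    \<open>D\<close>.\<close>
  define D where "D = Suc (\<Sum>\<tau>\<in>T. deg \<tau>)"
  have D: "deg \<tau> < D" if "\<tau> \<in> T" for \<tau>
    using member_le_sum[OF that, of deg] fin by (simp add: D_def less_Suc_eq_le)
  obtain F where F: "\<And>c. c \<in> Inv H \<Longrightarrow> c 0 = 0 \<Longrightarrow> \<exists>r. \<exists>i\<in>decomposable H.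
      vanishes_to_order D (\<lambda>v. c v - (\<Sum>l<n. r l * F l v) - i v)"
    using bound[of D] by (auto simp: D_def)
  have "\<forall>\<tau>. \<exists>r. \<exists>i. \<tau> \<in> T \<longrightarrow> i \<in> decomposable H \<and>
      vanishes_to_order D (\<lambda>v. \<tau> v - (\<Sum>l<n. r l * F l v) - i v)"
    using F T'(1,2) by meson
  from choice[OF this] obtain r where "\<forall>\<tau>. \<exists>i. \<tau> \<in> T \<longrightarrow> i \<in> decomposable H \<and>
      vanishes_to_order D (\<lambda>v. \<tau> v - (\<Sum>l<n. r \<tau> l * F l v) - i v)" ..
  from choice[OF this] obtain i where i: "\<And>\<tau>. \<tau> \<in> T \<Longrightarrow> i \<tau> \<in> decomposable H"
      "\<And>\<tau>. \<tau> \<in> T \<Longrightarrow> vanishes_to_order D (\<lambda>v. \<tau> v - (\<Sum>l<n. r \<tau> l * F l v) - i \<tau> v)" by blast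
  \<comment> \<open>A combination in which the contributions of all \<open>F l\<close> cancel: up to
    order \<open>D\<close> it agrees with the decomposable \<open>i'\<close>, so it is a sum of
    homogeneous parts of \<open>i'\<close>.\<close>
  obtain c where c: "\<exists>\<tau>\<in>T. c \<tau> \<noteq> 0" "\<And>l. l < n \<Longrightarrow> (\<Sum>\<tau>\<in>T. c \<tau> * r \<tau> l) = 0"
    using underdetermined_system[OF _ fin lt, of r] by auto
  define g where "g v = (\<Sum>\<tau>\<in>T. c \<tau> * \<tau> v)" for v
  define i' where "i' v = (\<Sum>\<tau>\<in>T. c \<tau> * i \<tau> v)" for v
  have i': "i' \<in> decomposable H"
    unfolding i'_def[abs_def] using i(1) by (intro decomposable_sum decomposable_cmult)
  have gS: "g \<in> S" unfolding g_def[abs_def] using TS by (intro S_sum S_cmult)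
  have i'S: "i' \<in> S" using decomposable_Inv[OF i'] by (rule Inv_S)
  have "(\<lambda>v. \<Sum>\<tau>\<in>T. c \<tau> * (\<tau> v - (\<Sum>l<n. r \<tau> l * F l v) - i \<tau> v)) = (\<lambda>v. g v + (- 1) * i' v)"
  proof
    fix v
    have "(\<Sum>\<tau>\<in>T. c \<tau> * (\<Sum>l<n. r \<tau> l * F l v)) = (\<Sum>l<n. (\<Sum>\<tau>\<in>T. c \<tau> * r \<tau> l) * F l v)"
      unfolding sum_distrib_left sum_distrib_right by (subst sum.swap) (simp add: mult.assoc)
    also have "\<dots> = 0" using c(2) by simp
    finally show "(\<Sum>\<tau>\<in>T. c \<tau> * (\<tau> v - (\<Sum>l<n. r \<tau> l * F l v) - i \<tau> v)) = g v + (- 1) * i' v"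
      by (simp add: g_def i'_def right_diff_distrib sum_subtractf)
  qed
  moreover have "vanishes_to_order D (\<lambda>v. \<Sum>\<tau>\<in>T. c \<tau> * (\<tau> v - (\<Sum>l<n. r \<tau> l * F l v) - i \<tau> v))"
    using i(2) by (intro vanishes_to_order_sum vanishes_to_order_mult_left) auto
  ultimately have "vanishes_to_order D (\<lambda>v. g v + (- 1) * i' v)" by simp
  note van = this
  have "hpart e g v + (- 1) * hpart e i' v = 0" if "e < D" for e v
  proof -
    have "hpart e (\<lambda>v. g v + (- 1) * i' v) = (\<lambda>_. 0)"
      using van that unfolding vanishes_to_order_def by blast
    from fun_cong[OF this, of v] show ?thesis
      unfolding hpart_add[OF gS S_cmult[OF i'S]] hpart_cmult[OF i'S] .
  qed
  then have low: "hpart e g v = hpart e i' v" if "e < D" for e v using that by simp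
  have "g v = (\<Sum>e<D. hpart e i' v)" for v
  proof -
    have "(\<Sum>e<D. hpart e i' v) = (\<Sum>e<D. \<Sum>\<tau>\<in>T. c \<tau> * hpart e \<tau> v)"
      using low TS unfolding g_def[abs_def] by (intro sum.cong) (simp_all add: hpart_sum hpart_cmult S_cmult)
    also have "\<dots> = (\<Sum>\<tau>\<in>T. c \<tau> * (\<Sum>e<D. hpart e \<tau> v))"
      by (subst sum.swap) (simp add: sum_distrib_left)
    also have "\<dots> = g v" unfolding g_def
    proof (intro sum.cong refl arg_cong[where f = "(*) _"])
      fix \<tau> assume t: "\<tau> \<in> T"
      have "(\<Sum>e<D. hpart e \<tau> v) = (\<Sum>e<D. if e = deg \<tau> then \<tau> v else 0)"
        using hpart_of_homogeneous[OF deg[OF t]] by (intro sum.cong) auto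
      then show "(\<Sum>e<D. hpart e \<tau> v) = \<tau> v" using D[OF t] by simp
    qed
    finally show ?thesis ..
  qed
  then have g_eq: "g = (\<lambda>v. \<Sum>e<D. hpart e i' v)" by blast
  have "g \<in> decomposable H" unfolding g_eq by (rule decomposable_sum[OF decomposable_hpart[OF H i']])
  then show False using T c(1) unfolding independent_generators_def g_def[abs_def] by blast
qed

text \<open>The graded Nakayama argument: a largest independent set spans modulo decomposables and
  therefore generates, by induction on the degree. Generators with property \<open>E\<close> are
  available as soon as every homogeneous invariant is a sum of homogeneous ones with
  \<open>E\<close>.\<close>

lemma homogeneous_generators:
  assumes H: "linear_group H" and E0: "E (\<lambda>_. 0)"
    and E: "\<And>d c. c \<in> Inv H \<Longrightarrow> homogeneous d c \<Longrightarrow> \<exists>(m::nat) e.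
      (\<forall>j<m. e j \<in> Inv H \<and> homogeneous d (e j) \<and> E (e j)) \<and> c = (\<lambda>v. \<Sum>j<m. e j v)"
    and bound: "\<And>D. D > 0 \<Longrightarrow> \<exists>F. \<forall>c\<in>Inv H. c 0 = 0 \<longrightarrow> (\<exists>r. \<exists>i\<in>decomposable H.
      vanishes_to_order D (\<lambda>v. c v - (\<Sum>l<n. r l * F l v) - i v))"
  obtains f d where "generated_algebra (f ` {..<n}) = Inv H"
    "\<And>i. i < n \<Longrightarrow> homogeneous (d i) (f i)" "\<And>i. i < n \<Longrightarrow> E (f i)"
proof -
  let ?P = "independent_generators H E"
  have "?P {}" by (simp add: independent_generators_def)
  moreover have card_le: "card T \<le> n" if "?P T" for T
    by (rule independent_generators_card_le[OF H that]) (rule bound)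
  ultimately have "\<exists>T. ?P T \<and> (\<forall>T'. ?P T' \<longrightarrow> card T' \<le> card T)"
    by (intro ex_has_greatest_nat[of ?P "{}" card "Suc n"]) (auto simp: less_Suc_eq_le)
  then obtain T where T: "?P T" "\<And>T'. ?P T' \<Longrightarrow> card T' \<le> card T" by blast
  have fin: "finite T" and T': "\<And>\<tau>. \<tau> \<in> T \<Longrightarrow> \<tau> \<in> Inv H \<and> \<tau> 0 = 0 \<and> E \<tau> \<and> (\<exists>d. homogeneous d \<tau>)"
    and ind: "\<And>r. (\<lambda>v. \<Sum>\<tau>\<in>T. r \<tau> * \<tau> v) \<in> decomposable H \<Longrightarrow> \<forall>\<tau>\<in>T. r \<tau> = 0"
    using T(1) by (auto simp: independent_generators_def)
  \<comment> \<open>By maximality \<open>insert c T\<close> is dependent, and the coefficient of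
    \<open>c\<close> is nonzero because \<open>T\<close> is independent.\<close>
  have spans: "\<exists>r. \<exists>i\<in>decomposable H. \<forall>v. c v = (\<Sum>\<tau>\<in>T. r \<tau> * \<tau> v) + i v"
    if c: "c \<in> Inv H" "homogeneous d c" "d > 0" "E c" for c d
  proof (cases "c \<in> T")
    case True
    have "(\<Sum>\<tau>\<in>T. (if \<tau> = c then 1 else 0) * \<tau> v) = (\<Sum>\<tau>\<in>T. if \<tau> = c then \<tau> v else 0)" for v
      by (intro sum.cong) auto
    then show ?thesis using True fin
      by (intro exI[of _ "\<lambda>\<tau>. if \<tau> = c then 1 else 0"] bexI[of _ "\<lambda>_. 0"]) (auto intro: decomposable.zero)
  next
    case False
    then have "card (insert c T) = Suc (card T)" using fin by simp
    then have "\<not> ?P (insert c T)" using T(2)[of "insert c T"] by auto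
    moreover have "c 0 = 0" using homogeneous_at_0[OF c(2,3)] .
    ultimately obtain r where r: "(\<lambda>v. \<Sum>\<tau>\<in>insert c T. r \<tau> * \<tau> v) \<in> decomposable H" "\<exists>\<tau>\<in>insert c T. r \<tau> \<noteq> 0"
      using c T' fin unfolding independent_generators_def by blast
    have eq: "(\<Sum>\<tau>\<in>insert c T. r \<tau> * \<tau> v) = r c * c v + (\<Sum>\<tau>\<in>T. r \<tau> * \<tau> v)" for v
      using fin False by simp
    have rc: "r c \<noteq> 0"
    proof
      assume "r c = 0"
      then have "\<forall>\<tau>\<in>T. r \<tau> = 0" using r(1) unfolding eq by (intro ind) simp
      then show False using r(2) \<open>r c = 0\<close> by auto
    qed
    have "c v = (\<Sum>\<tau>\<in>T. (- r \<tau> / r c) * \<tau> v) + inverse (r c) * (\<Sum>\<tau>\<in>insert c T. r \<tau> * \<tau> v)" for v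
    proof -
      have "(\<Sum>\<tau>\<in>T. (- r \<tau> / r c) * \<tau> v) = - (inverse (r c) * (\<Sum>\<tau>\<in>T. r \<tau> * \<tau> v))"
        by (simp add: sum_distrib_left sum_negf[symmetric] divide_inverse mult_ac)
      then show ?thesis unfolding eq using rc by (simp add: distrib_left)
    qed
    then show ?thesis using decomposable_cmult[OF r(1), of "inverse (r c)"]
      by (intro exI[of _ "\<lambda>\<tau>. - r \<tau> / r c"] bexI[of _ "\<lambda>v. inverse (r c) * (\<Sum>\<tau>\<in>insert c T. r \<tau> * \<tau> v)"]) auto
  qed
  have hom: "c \<in> Inv H \<longrightarrow> homogeneous d c \<longrightarrow> c \<in> generated_algebra T" for c d
  proof (induction d arbitrary: c rule: less_induct)
    case (less d)
    show ?case
    proof (intro impI)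
      assume c: "c \<in> Inv H" "homogeneous d c"
      show "c \<in> generated_algebra T"
      proof (cases "d = 0")
        case True
        have "c v = c 0" for v using c(2) scale_zero_left[of v] unfolding True homogeneous_def
          by (metis mult_1 power_0)
        then have "c = (\<lambda>_. c 0)" by blast
        then show ?thesis using generated_algebra.const by metis
      next
        case False
        obtain m :: nat and e where e: "\<forall>j<m. e j \<in> Inv H \<and> homogeneous d (e j) \<and> E (e j)"
          "c = (\<lambda>v. \<Sum>j<m. e j v)" using E[OF c] by (elim exE conjE)
        have "e j \<in> generated_algebra T" if j: "j < m" for j
        proof -
          obtain r i where ri: "i \<in> decomposable H" "\<And>v. e j v = (\<Sum>\<tau>\<in>T. r \<tau> * \<tau> v) + i v"
            using spans[of "e j" d] e(1)[rule_format, OF j] False by blast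
          have TS: "\<tau> \<in> S" if "\<tau> \<in> T" for \<tau> using T'[OF that] Inv_S by blast
          have iS: "i \<in> S" using decomposable_Inv[OF ri(1)] by (rule Inv_S)
          have "e j = hpart d (e j)" using hpart_of_homogeneous e(1)[rule_format, OF j] by metis
          also have "\<dots> = hpart d (\<lambda>v. (\<Sum>\<tau>\<in>T. r \<tau> * \<tau> v) + i v)" using ri(2) by presburger
          also have "\<dots> = (\<lambda>v. (\<Sum>\<tau>\<in>T. r \<tau> * hpart d \<tau> v) + hpart d i v)"
          proof -
            have "(\<lambda>v. \<Sum>\<tau>\<in>T. r \<tau> * \<tau> v) \<in> S" using TS by (intro S_sum S_cmult)
            then show ?thesis using iS TS by (simp add: hpart_add hpart_sum hpart_cmult S_cmult)
          qed
          also have "\<dots> \<in> generated_algebra T"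
          proof (intro generated_algebra.add generated_algebra_sum generated_algebra_cmult)
            show "hpart d i \<in> generated_algebra T"
              using decomposable_hpart_generated[OF H ri(1)] less.IH by blast
            fix \<tau> assume t: "\<tau> \<in> T"
            then obtain d' where "homogeneous d' \<tau>" using T' by blast
            then show "hpart d \<tau> \<in> generated_algebra T"
              using t by (auto simp: hpart_of_homogeneous intro: generated_algebra.intros)
          qed
          finally show ?thesis .
        qed
        then show ?thesis unfolding e(2) by (intro generated_algebra_sum) simp
      qed
    qed
  qed
  have "generated_algebra T = Inv H"
  proof
    show "generated_algebra T \<subseteq> Inv H" using T' by (intro generated_algebra_subset_Inv) blast
    show "Inv H \<subseteq> generated_algebra T"
    proof
      fix c assume c: "c \<in> Inv H"
      obtain D where D: "\<And>v. c v = (\<Sum>d\<le>D. hpart d c v)" using hpart_expansion[OF Inv_S[OF c]] by metis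
      have "(\<lambda>v. \<Sum>d\<le>D. hpart d c v) \<in> generated_algebra T"
        using hom Inv_hpart[OF H c] hpart_homogeneous[OF Inv_S[OF c]] by (intro generated_algebra_sum) blast
      then show "c \<in> generated_algebra T" unfolding D[symmetric] .
    qed
  qed
  moreover obtain f where f: "f ` {..<n} \<subseteq> insert (\<lambda>_. 0) T"
    "generated_algebra (f ` {..<n}) = generated_algebra T"
    using indexed_generators[OF fin card_le[OF T(1)]] by metis
  have "E (f i) \<and> (\<exists>d. homogeneous d (f i))" if "i < n" for i
  proof -
    \<comment> \<open>Padding by the zero function counts as homogeneous of degree 0 and has
      property \<open>E\<close> by assumption.\<close>
    have hom0: "homogeneous 0 (\<lambda>_. 0)" by (simp add: homogeneous_def)
    have "f i \<in> insert (\<lambda>_. 0) T" using f(1) that by auto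
    then consider "f i = (\<lambda>_. 0)" | "f i \<in> T" by blast
    then show ?thesis
    proof cases
      case 1 then show ?thesis using E0 hom0 by metis
    next
      case 2 then show ?thesis using T' by blast
    qed
  qed
  then obtain d where "\<And>i. i < n \<Longrightarrow> E (f i) \<and> homogeneous (d i) (f i)" by metis
  ultimately show ?thesis using that f(2) by metis
qed

section \<open>Point stabilizers\<close>

text \<open>Modulo decomposables, \<open>c (w + v) - c w\<close> behaves like a derivation in
  \<open>c\<close>: for a product the error term is
  \<open>(c (w + v) - c w) * (d (w + v) - d w)\<close>. The factors are \<open>H\<close>-invariant
  because \<open>H\<close> fixes \<open>w\<close>.\<close>

lemma translate_expansion:
  assumes G: "linear_group G" and f: "generated_algebra (f ` {..<n}) = Inv G"
    and H: "H = {g \<in> G. g w = w}" and "c \<in> Inv G"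
  shows "\<exists>r. (\<lambda>v. c (w + v) - c w - (\<Sum>l<n. r l * (f l (w + v) - f l w))) \<in> decomposable H"
proof -
  have inv: "(\<lambda>v. c (w + v) - c w) \<in> Inv H" if "c \<in> Inv G" for c
  proof -
    have "c (w + h v) = c (w + v)" if h: "h \<in> H" for h v
    proof -
      have "h \<in> G" "h w = w" using h H by auto
      then have "w + h v = h (w + v)" using lmap_add[OF linear_groupD(4)[OF G], of h w v] by simp
      then show ?thesis using Inv_apply[OF \<open>c \<in> Inv G\<close>] h H by simp
    qed
    then show ?thesis using S_translate[OF Inv_S[OF that]] by (auto simp: Inv_iff)
  qed
  have "c \<in> generated_algebra (f ` {..<n})" using assms(4) f by simp
  then have "c \<in> Inv G \<and> ?thesis"
  proof (induction rule: generated_algebra.induct)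
    case (const c)
    show ?case by (intro conjI Inv_const exI[of _ "\<lambda>_. 0"]) (simp add: decomposable.zero)
  next
    case (gen c)
    then obtain i where i: "i < n" "c = f i" by auto
    have "(\<Sum>l<n. (if l = i then 1 else 0) * (f l (w + v) - f l w)) = c (w + v) - c w" for v
    proof -
      have "(\<Sum>l<n. (if l = i then 1 else 0) * (f l (w + v) - f l w))
        = (\<Sum>l<n. if l = i then f l (w + v) - f l w else 0)" by (rule sum.cong) auto
      then show ?thesis using i by simp
    qed
    moreover have "c \<in> Inv G" unfolding f[symmetric] using gen by (rule generated_algebra.gen)
    ultimately show ?case
      by (intro conjI exI[of _ "\<lambda>l. if l = i then 1 else 0"]) (simp_all add: decomposable.zero)
  next
    case (add c d)
    then obtain r s where
      rs: "(\<lambda>v. c (w + v) - c w - (\<Sum>l<n. r l * (f l (w + v) - f l w))) \<in> decomposable H"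
        "(\<lambda>v. d (w + v) - d w - (\<Sum>l<n. s l * (f l (w + v) - f l w))) \<in> decomposable H" by blast
    have "(\<lambda>v. c (w + v) + d (w + v) - (c w + d w) - (\<Sum>l<n. (r l + s l) * (f l (w + v) - f l w)))
      = (\<lambda>v. (c (w + v) - c w - (\<Sum>l<n. r l * (f l (w + v) - f l w)))
          + (d (w + v) - d w - (\<Sum>l<n. s l * (f l (w + v) - f l w))))"
      by (rule ext) (simp add: distrib_right sum.distrib)
    also have "\<dots> \<in> decomposable H" by (rule decomposable.add[OF rs])
    finally show ?case using add Inv_add by (intro conjI exI[of _ "\<lambda>l. r l + s l"]) auto
  next
    case (mult c d)
    then obtain r s where
      rs: "(\<lambda>v. c (w + v) - c w - (\<Sum>l<n. r l * (f l (w + v) - f l w))) \<in> decomposable H"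
        "(\<lambda>v. d (w + v) - d w - (\<Sum>l<n. s l * (f l (w + v) - f l w))) \<in> decomposable H" by blast
    have "(\<lambda>v. (c (w + v) - c w) * (d (w + v) - d w)) \<in> decomposable H"
      using mult by (intro decomposable.mult inv) auto
    note dec = decomposable.add[OF this
        decomposable.add[OF decomposable_cmult[OF rs(1), of "d w"] decomposable_cmult[OF rs(2), of "c w"]]]
    have eq: "(\<Sum>l<n. (d w * r l + c w * s l) * (f l (w + v) - f l w))
        = d w * (\<Sum>l<n. r l * (f l (w + v) - f l w)) + c w * (\<Sum>l<n. s l * (f l (w + v) - f l w))" for v
      unfolding sum_distrib_left sum.distrib[symmetric] by (rule sum.cong) (simp_all add: algebra_simps)
    have "(\<lambda>v. c (w + v) * d (w + v) - c w * d w
        - (\<Sum>l<n. (d w * r l + c w * s l) * (f l (w + v) - f l w))) \<in> decomposable H"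
      unfolding eq using dec by (simp add: algebra_simps)
    then show ?case using mult Inv_mult by (intro conjI exI[of _ "\<lambda>l. d w * r l + c w * s l"]) auto
  qed
  then show ?thesis by blast
qed

lemma linear_group_pointwise_stabilizer:
  assumes G: "linear_group G"
  shows "linear_group (pointwise_stabilizer G W)"
  unfolding linear_group_def
proof (intro conjI ballI)
  show "finite (pointwise_stabilizer G W)" "id \<in> pointwise_stabilizer G W"
    using linear_groupD[OF G] by (auto simp: pointwise_stabilizer_def)
  fix g assume g: "g \<in> pointwise_stabilizer G W"
  then show "lmap g" using linear_groupD[OF G] by (auto simp: pointwise_stabilizer_def)
  show "g \<circ> h \<in> pointwise_stabilizer G W" if "h \<in> pointwise_stabilizer G W" for h
    using g that linear_groupD(3)[OF G] by (auto simp: pointwise_stabilizer_def)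
  have "g \<in> G" "\<And>u. u \<in> W \<Longrightarrow> g u = u" using g by (auto simp: pointwise_stabilizer_def)
  moreover obtain h where "h \<in> G" "h \<circ> g = id" "g \<circ> h = id" "\<And>v. h (g v) = v"
    using linear_group_inverse[OF G \<open>g \<in> G\<close>] by metis
  ultimately show "\<exists>h\<in>pointwise_stabilizer G W. h \<circ> g = id \<and> g \<circ> h = id"
    by (intro bexI[of _ h]) (auto simp: pointwise_stabilizer_def, metis)
qed

lemma point_stabilizer_eq: "{g \<in> G. g w = w} = pointwise_stabilizer G {w}"
  by (auto simp: pointwise_stabilizer_def)

text \<open>\<open>P\<close> is 1 at \<open>w\<close> and vanishes to order \<open>D\<close> at the
  rest of the orbit. Then \<open>1 - (1 - P) ^ D\<close> is still divisible by \<open>P\<close> and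
  is 1 up to order \<open>D\<close> at \<open>w\<close>. The orbit product over \<open>H\<close>
  makes it invariant; both properties survive, since \<open>H\<close> fixes \<open>w\<close> and the
  factor of \<open>id\<close> already vanishes elsewhere.\<close>

lemma cutoff_exists:
  assumes G: "linear_group G" and Hdef: "H = {g \<in> G. g w = w}" and D: "D > 0"
  obtains e where "e \<in> Inv H" "vanishes_to_order D (\<lambda>v. e (w + v) - 1)"
    "\<And>g. g \<in> G - H \<Longrightarrow> vanishes_to_order D (\<lambda>v. e (g w + v))"
proof -
  have H: "linear_group H" unfolding Hdef point_stabilizer_eq by (rule linear_group_pointwise_stabilizer[OF G])
  have fin: "finite (G - H)" using linear_groupD(1)[OF G] by simp
  let ?X = "(\<lambda>g. w - g w) ` (G - H)"
  have "0 \<notin> ?X" by (auto simp: Hdef)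
  then obtain l where l: "lform l" "\<And>u. u \<in> ?X \<Longrightarrow> l u \<noteq> 0"
    using separating_lform fin by (metis finite_imageI)
  define P0 where "P0 v = (\<Prod>g\<in>G - H. (l v - l (g w)) / (l w - l (g w)))" for v
  define P where "P v = P0 v ^ D" for v
  define e0 where "e0 v = 1 - (1 - P v) ^ D" for v
  define e where "e v = (\<Prod>h\<in>H. e0 (h v))" for v
  have P0_S: "P0 \<in> S"
    unfolding P0_def[abs_def] divide_inverse
    by (intro S_prod S_mult[OF S_diff[OF S_lform[OF l(1)] S_const] S_const])
  have P_S: "P \<in> S" unfolding P_def[abs_def] by (rule S_power[OF P0_S])
  have Q_S: "(\<lambda>v. 1 - P v) \<in> S" by (rule S_diff[OF S_const P_S])
  have e0_S: "e0 \<in> S" unfolding e0_def[abs_def] by (rule S_diff[OF S_const S_power[OF Q_S]])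
  have "l w - l (g w) \<noteq> 0" if "g \<in> G - H" for g
    using l(2)[OF imageI[OF that]] lform_diff[OF l(1)] by simp
  then have Pw: "P w = 1" by (simp add: P_def P0_def)
  have "e \<in> Inv H" unfolding e_def[abs_def] by (rule Inv_orbit_prod[OF H e0_S])
  moreover have "vanishes_to_order D (\<lambda>v. e (w + v) - 1)"
  proof -
    have factor: "vanishes_to_order D (\<lambda>v. e0 (h (w + v)) - 1)" if h: "h \<in> H" for h
    proof -
      have hl: "lmap h" and hw: "h w = w" using h Hdef linear_groupD(4)[OF G] by auto
      have "vanishes_to_order D (\<lambda>v. (1 - P (w + v)) ^ D)"
        by (rule vanishes_to_order_power[OF S_translate[OF Q_S, of w]]) (simp add: Pw)
      from vanishes_to_order_mult_left[OF vanishes_to_order_lmap[OF this hl] S_const[of "-1"]]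
      show ?thesis by (simp add: e0_def lmap_add[OF hl] hw)
    qed
    have "vanishes_to_order D (\<lambda>v. (\<Prod>h\<in>K. e0 (h (w + v))) - 1)" if "finite K" "K \<subseteq> H" for K
      using that
    proof (induction K rule: finite_induct)
      case empty
      show ?case by (simp add: vanishes_to_order_def hpart_const)
    next
      case (insert h K)
      have "(\<lambda>v. \<Prod>h\<in>K. e0 (h (w + v))) \<in> S"
        using insert.prems linear_groupD(4)[OF H]
        by (intro S_prod S_translate[OF S_lmap[OF e0_S]]) auto
      from vanishes_to_order_add[OF vanishes_to_order_mult_left[OF factor[of h] this] insert.IH] insert
      show ?case by (simp add: algebra_simps)
    qed
    from this[OF linear_groupD(1)[OF H] order_refl] show ?thesis unfolding e_def .
  qed
  moreover have "vanishes_to_order D (\<lambda>v. e (g w + v))" if g: "g \<in> G - H" for g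
  proof -
    have "P0 (g w) = 0" unfolding P0_def using fin g by (intro prod_zero) auto
    then have 1: "vanishes_to_order D (\<lambda>v. P (g w + v))"
      unfolding P_def by (intro vanishes_to_order_power S_translate[OF P0_S]) simp
    have e0: "e0 v = (\<Sum>i<D. (1 - P v) ^ i) * P v" for v
      unfolding e0_def one_diff_power_eq by (simp add: mult.commute)
    have "(\<lambda>v. \<Sum>i<D. (1 - P v) ^ i) \<in> S" by (intro S_sum S_power[OF Q_S])
    from vanishes_to_order_mult_left[OF 1 S_translate[OF this, of "g w"]]
    have 2: "vanishes_to_order D (\<lambda>v. e0 (g w + v))" unfolding e0 .
    have "e v = (\<Prod>h\<in>H - {id}. e0 (h v)) * e0 v" for v
      unfolding e_def using prod.remove[OF linear_groupD(1,2)[OF H], of "\<lambda>h. e0 (h v)"] by (simp add: mult.commute)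
    moreover have "(\<lambda>v. \<Prod>h\<in>H - {id}. e0 (h v)) \<in> S"
      using linear_groupD(4)[OF H] by (intro S_prod S_lmap[OF e0_S]) auto
    ultimately show ?thesis using vanishes_to_order_mult_left[OF 2 S_translate, of _ "g w"] by simp
  qed
  ultimately show ?thesis by (rule that)
qed

text \<open>The relative trace from \<open>H\<close> to \<open>G\<close>. Since \<open>s\<close> is
  \<open>H\<close>-invariant, the choice of representatives by \<open>SOME\<close> does not matter;
  summing over cosets avoids the factor \<open>card H\<close>, which may be zero in the
  field.\<close>

lemma coset_sum_invariant:
  assumes G: "linear_group G" and H: "linear_group H" "H \<subseteq> G" and s: "s \<in> Inv H"
  shows "(\<lambda>v. \<Sum>C\<in>right_coset H ` G. s ((SOME h. h \<in> C) v)) \<in> Inv G"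
proof -
  have rep: "s ((SOME h. h \<in> C) v) = s (h v)" if C: "C \<in> right_coset H ` G" "h \<in> C" for C h v
  proof -
    obtain k where k: "C = right_coset H k" using C by blast
    have "\<exists>w\<in>H. h' = w \<circ> k" if "h' \<in> C" for h' using that k by (auto simp: right_coset_def)
    moreover have "(SOME h. h \<in> C) \<in> C" using someI[of "\<lambda>h. h \<in> C", OF C(2)] .
    ultimately obtain w w' where "w \<in> H" "h = w \<circ> k" "w' \<in> H" "(SOME h. h \<in> C) = w' \<circ> k" using C(2) by metis
    then show ?thesis using Inv_apply[OF s] by simp
  qed
  have rep_in: "(SOME h. h \<in> C) \<in> C" if "C \<in> right_coset H ` G" for C
    using that right_coset_self[OF H(1)] by (metis imageE someI)
  have sub: "C \<subseteq> G" if "C \<in> right_coset H ` G" for C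
    using that right_coset_subset[OF G H(2)] by blast
  have "(\<lambda>v. \<Sum>C\<in>right_coset H ` G. s ((SOME h. h \<in> C) v)) \<in> S"
    using rep_in sub linear_groupD(4)[OF G] by (intro S_sum S_lmap[OF Inv_S[OF s]]) blast
  moreover have "(\<Sum>C\<in>right_coset H ` G. s ((SOME h. h \<in> C) (g v))) = (\<Sum>C\<in>right_coset H ` G. s ((SOME h. h \<in> C) v))"
    if g: "g \<in> G" for g v
  proof -
    obtain g' where g': "g' \<in> G" "g' \<circ> g = id" "g \<circ> g' = id" using linear_group_inverse[OF G g] by metis
    let ?t = "\<lambda>g C. (\<lambda>h. h \<circ> g) ` C"
    have t: "?t g (right_coset H k) = right_coset H (k \<circ> g)" for g k
      by (simp add: right_coset_def image_image comp_assoc)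
    have "bij_betw (?t g) (right_coset H ` G) (right_coset H ` G)"
      by (rule bij_betw_byWitness[where f' = "?t g'"])
        (use g g' in \<open>auto simp: image_image comp_assoc t linear_groupD(3)[OF G]\<close>)
    from sum.reindex_bij_betw[OF this, of "\<lambda>C. s ((SOME h. h \<in> C) v)"]
    have "(\<Sum>C\<in>right_coset H ` G. s ((SOME h. h \<in> C) v)) = (\<Sum>C\<in>right_coset H ` G. s ((SOME h. h \<in> ?t g C) v))" ..
    also have "\<dots> = (\<Sum>C\<in>right_coset H ` G. s ((SOME h. h \<in> C) (g v)))"
    proof (rule sum.cong[OF refl])
      fix C assume C: "C \<in> right_coset H ` G"
      then have 1: "?t g C \<in> right_coset H ` G" using t g linear_groupD(3)[OF G] by auto
      have 2: "(SOME h. h \<in> C) \<circ> g \<in> ?t g C" using rep_in[OF C] by blast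
      show "s ((SOME h. h \<in> ?t g C) v) = s ((SOME h. h \<in> C) (g v))"
        using rep[OF 1 2, of v] by (simp only: comp_apply)
    qed
    finally show ?thesis ..
  qed
  ultimately show ?thesis by (simp add: Inv_iff)
qed

text \<open>Move \<open>c\<close> to the point \<open>w\<close> and multiply by the cutoff
  \<open>e\<close>. The relative trace is a \<open>G\<close>-invariant \<open>b\<close> whose
  expansion at \<open>w\<close> agrees with \<open>c\<close> up to order \<open>D\<close>, as the
  cosets other than \<open>H\<close> contribute only higher order terms. Expanding \<open>b\<close>
  in the generators of \<open>Inv G\<close> gives the coefficients.\<close>

lemma stabilizer_bound:
  assumes G: "linear_group G" and f: "generated_algebra (f ` {..<n}) = Inv G"
    and Hdef: "H = {g \<in> G. g w = w}" and D: "D > 0"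
  shows "\<exists>F. \<forall>c\<in>Inv H. c 0 = 0 \<longrightarrow> (\<exists>r. \<exists>i\<in>decomposable H.
      vanishes_to_order D (\<lambda>v. c v - (\<Sum>l<n. r l * F l v) - i v))"
proof (intro exI[of _ "\<lambda>l v. f l (w + v) - f l w"] ballI impI)
  fix c assume c: "c \<in> Inv H" "c 0 = 0"
  have H: "linear_group H" unfolding Hdef point_stabilizer_eq by (rule linear_group_pointwise_stabilizer[OF G])
  have HG: "H \<subseteq> G" by (auto simp: Hdef)
  obtain e where e: "e \<in> Inv H" "vanishes_to_order D (\<lambda>v. e (w + v) - 1)"
    "\<And>g. g \<in> G - H \<Longrightarrow> vanishes_to_order D (\<lambda>v. e (g w + v))" using cutoff_exists[OF G Hdef D] by metis
  define s where "s v = c (v - w) * e v" for v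
  have c_S: "(\<lambda>v. c (v - w)) \<in> S" using S_translate[OF Inv_S[OF c(1)], of "- w"] by simp
  have "c (h v - w) = c (v - w)" if "h \<in> H" for h v
  proof -
    have "h v - w = h (v - w)" using that lmap_diff[OF linear_groupD(4)[OF H that]] by (simp add: Hdef)
    then show ?thesis using Inv_apply[OF c(1) that] by simp
  qed
  then have "(\<lambda>v. c (v - w)) \<in> Inv H" using c_S by (simp add: Inv_iff)
  then have s: "s \<in> Inv H" unfolding s_def[abs_def] using e(1) by (rule Inv_mult)
  define b where "b v = (\<Sum>C\<in>right_coset H ` G. s ((SOME h. h \<in> C) v))" for v
  have b: "b \<in> Inv G" unfolding b_def[abs_def] by (rule coset_sum_invariant[OF G H HG s])
  let ?\<C> = "right_coset H ` G"
  have coset_H: "right_coset H id = H" by (simp add: right_coset_def)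
  have H_in: "H \<in> ?\<C>" using coset_H linear_groupD(2)[OF G] by (metis imageI)
  have other: "(SOME h. h \<in> C) \<in> G - H" if C: "C \<in> ?\<C> - {H}" for C
  proof -
    obtain k where k: "k \<in> G" "C = right_coset H k" using C by blast
    then have "(SOME h. h \<in> C) \<in> C" using right_coset_self[OF H] by (metis someI)
    moreover have "C \<subseteq> G" using k right_coset_subset[OF G HG] by blast
    moreover have "h \<notin> H" if "h \<in> C" for h
    proof
      assume "h \<in> H"
      then have "right_coset H h = H" using right_coset_eq[OF H, of h id] coset_H by simp
      moreover have "right_coset H h = C" using right_coset_eq[OF H, of h k] k that by simp
      ultimately show False using C by simp
    qed
    ultimately show ?thesis by blast
  qed
  have bc: "b (w + v) - c v = c v * (e (w + v) - 1) + (\<Sum>C\<in>?\<C> - {H}. s ((SOME h. h \<in> C) (w + v)))" for v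
  proof -
    have "(SOME h. h \<in> H) \<in> H" using someI[of "\<lambda>h. h \<in> H", OF linear_groupD(2)[OF H]] .
    then have "s ((SOME h. h \<in> H) (w + v)) = c v * e (w + v)" using Inv_apply[OF s] by (simp add: s_def)
    then show ?thesis unfolding b_def
      using sum.remove[OF _ H_in, of "\<lambda>C. s ((SOME h. h \<in> C) (w + v))"] linear_groupD(1)[OF G]
      by (simp add: algebra_simps)
  qed
  have van: "vanishes_to_order D (\<lambda>v. b (w + v) - c v)"
    unfolding bc
  proof (intro vanishes_to_order_add vanishes_to_order_sum)
    show "vanishes_to_order D (\<lambda>v. c v * (e (w + v) - 1))"
      by (rule vanishes_to_order_mult_left[OF e(2) Inv_S[OF c(1)]])
    fix C assume "C \<in> ?\<C> - {H}"
    then have g: "(SOME h. h \<in> C) \<in> G - H" by (rule other)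
    define g where "g = (SOME h. h \<in> C)"
    have gl: "lmap g" using g linear_groupD(4)[OF G] by (simp add: g_def)
    have "vanishes_to_order D (\<lambda>v. c (g w + v - w) * e (g w + v))"
      by (rule vanishes_to_order_mult_left[OF e(3)[OF g, folded g_def] S_translate[OF c_S]])
    from vanishes_to_order_lmap[OF this gl]
    show "vanishes_to_order D (\<lambda>v. s ((SOME h. h \<in> C) (w + v)))"
      unfolding s_def g_def[symmetric] lmap_add[OF gl] .
  qed
  have "b (w + 0) - c 0 = 0"
    using van D hpart_0[of "\<lambda>v. b (w + v) - c v" 0] unfolding vanishes_to_order_def by metis
  then have bw: "b w = 0" using c(2) by simp
  obtain r where r: "(\<lambda>v. b (w + v) - b w - (\<Sum>l<n. r l * (f l (w + v) - f l w))) \<in> decomposable H"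
    using translate_expansion[OF G f Hdef b] by blast
  have "vanishes_to_order D (\<lambda>v. - 1 * (b (w + v) - c v))"
    by (rule vanishes_to_order_mult_left[OF van S_const])
  then have "vanishes_to_order D (\<lambda>v. c v - (\<Sum>l<n. r l * (f l (w + v) - f l w))
      - (b (w + v) - b w - (\<Sum>l<n. r l * (f l (w + v) - f l w))))" by (simp add: bw)
  then show "\<exists>r. \<exists>i\<in>decomposable H. vanishes_to_order D (\<lambda>v. c v - (\<Sum>l<n. r l * (f l (w + v) - f l w)) - i v)"
    by (intro exI[of _ r] bexI[OF _ r])
qed

section \<open>Polynomial rings of invariants\<close>

lemma polynomial_ring_generators:
  assumes "is_polynomial_ring (Inv G)"
  obtains f where "generated_algebra (f ` {..<n}) = Inv G"
proof -
  obtain F where F: "algebraically_independent F" "generated_algebra F = Inv G"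
    using assms by (auto simp: is_polynomial_ring_def)
  then have "F \<subseteq> S" using generated_algebra.gen Inv_S by blast
  from algebraically_independent_card_le[OF this F(1)] obtain f
    where "generated_algebra (f ` {..<n}) = generated_algebra F" using indexed_generators by metis
  then show ?thesis using that F(2) by metis
qed

lemma polynomial_ring_if_homogeneous_generators:
  assumes "n > 0" "linear_group G" "generated_algebra (f ` {..<n}) = Inv G"
    and "\<And>i. i < n \<Longrightarrow> homogeneous (d i) (f i)"
  shows "is_polynomial_ring (Inv G)"
proof -
  obtain x b a where "jacobian_setting (*s) Basis G f x b a"
    using jacobian_setting_exists[OF assms] by metis
  then interpret jacobian_setting "(*s)" Basis G f x b a .
  show ?thesis unfolding is_polynomial_ring_def using f_algebraically_independent assms(3) by blast
qed

text \<open>For \<open>w = 0\<close> this gives homogeneous generators of \<open>Inv G\<close>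
  itself, which \<open>is_polynomial_ring\<close> does not provide directly.\<close>

lemma stabilizer_homogeneous_generators:
  assumes G: "linear_group G" and "is_polynomial_ring (Inv G)"
  obtains f d where "generated_algebra (f ` {..<n}) = Inv {g \<in> G. g w = w}"
    "\<And>i. i < n \<Longrightarrow> homogeneous (d i) (f i)"
proof -
  obtain f where f: "generated_algebra (f ` {..<n}) = Inv G" using polynomial_ring_generators[OF assms(2)] .
  have H: "linear_group {g \<in> G. g w = w}"
    unfolding point_stabilizer_eq by (rule linear_group_pointwise_stabilizer[OF G])
  show thesis
  proof (rule homogeneous_generators[OF H, of "\<lambda>_. True"])
    show "thesis" if "generated_algebra (f ` {..<n}) = Inv {g \<in> G. g w = w}" "\<And>i. i < n \<Longrightarrow> homogeneous (d i) (f i)"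
      for f d using \<open>\<And>f d. generated_algebra (f ` {..<n}) = Inv {g \<in> G. g w = w} \<Longrightarrow>
        (\<And>i. i < n \<Longrightarrow> homogeneous (d i) (f i)) \<Longrightarrow> thesis\<close> that .
    show "\<exists>(m::nat) e. (\<forall>j<m. e j \<in> Inv {g \<in> G. g w = w} \<and> homogeneous d (e j) \<and> True) \<and> c = (\<lambda>v. \<Sum>j<m. e j v)"
      if "c \<in> Inv {g \<in> G. g w = w}" "homogeneous d c" for c d
      using that by (intro exI[of _ 1] exI[of _ "\<lambda>_. c"]) auto
  qed (use stabilizer_bound[OF G f refl] in simp_all)
qed

text \<open>A generic point \<open>w\<close> of \<open>W\<close> is moved by every element of
  \<open>G\<close> that moves some point of \<open>W\<close>, so the pointwise stabilizer of
  \<open>W\<close> is the stabilizer of \<open>w\<close>.\<close>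

lemma polynomial_ring_pointwise_stabilizer:
  assumes "n > 0" "linear_group G" "is_polynomial_ring (Inv G)" "subspace W"
  shows "is_polynomial_ring (Inv (pointwise_stabilizer G W))"
proof -
  let ?I = "G - pointwise_stabilizer G W"
  have "\<forall>g. \<exists>l. g \<in> ?I \<longrightarrow> lform l \<and> (\<exists>u\<in>W. l (g u) - l u \<noteq> 0)"
  proof
    fix g
    show "\<exists>l. g \<in> ?I \<longrightarrow> lform l \<and> (\<exists>u\<in>W. l (g u) - l u \<noteq> 0)"
    proof (cases "g \<in> ?I")
      case True
      then obtain u where u: "u \<in> W" "g u \<noteq> u" by (auto simp: pointwise_stabilizer_def)
      then have "0 \<notin> {g u - u}" by simp
      then obtain l where "lform l" "l (g u - u) \<noteq> 0" using separating_lform[of "{g u - u}"] by blast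
      then show ?thesis using u lform_diff by metis
    qed blast
  qed
  from choice[OF this] obtain l where l: "\<And>g. g \<in> ?I \<Longrightarrow> lform (l g)"
    "\<And>g. g \<in> ?I \<Longrightarrow> \<exists>u\<in>W. l g (g u) - l g u \<noteq> 0" by blast
  have "\<exists>w\<in>W. \<forall>g\<in>?I. l g (g w) - l g w \<noteq> 0"
  proof (rule generic_point[OF _ assms(4), of ?I "\<lambda>g w. l g (g w) - l g w"])
    show "(\<lambda>w. l g (g w) - l g w) \<in> S" if "g \<in> ?I" for g
      using lform_compose[OF l(1)[OF that] linear_groupD(4)[OF assms(2)]] l(1)[OF that] that
      by (intro S_diff S_lform) auto
  qed (use l linear_groupD(1)[OF assms(2)] in auto)
  then obtain w where w: "w \<in> W" "\<And>g. g \<in> ?I \<Longrightarrow> l g (g w) - l g w \<noteq> 0" by blast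
  then have moved: "g w \<noteq> w" if "g \<in> ?I" for g using that by (metis diff_self)
  have eq: "{g \<in> G. g w = w} = pointwise_stabilizer G W"
    using w(1) moved by (auto simp: pointwise_stabilizer_def)
  obtain f d where "generated_algebra (f ` {..<n}) = Inv (pointwise_stabilizer G W)"
    "\<And>i. i < n \<Longrightarrow> homogeneous (d i) (f i)"
    using stabilizer_homogeneous_generators[OF assms(2,3), of w] unfolding eq by blast
  then show ?thesis
    by (rule polynomial_ring_if_homogeneous_generators[OF assms(1) linear_group_pointwise_stabilizer[OF assms(2)]])
qed

lemma polynomial_ring_reflection_group:
  assumes "n > 0" and G: "linear_group G" and poly: "is_polynomial_ring (Inv G)"
    and W: "linear_group W" "W \<subseteq> G"
    and reflections: "\<And>g l. g \<in> G \<Longrightarrow> lform l \<Longrightarrow> \<exists>u. l u \<noteq> 0 \<Longrightarrow> (\<And>u. l u = 0 \<Longrightarrow> g u = u) \<Longrightarrow> g \<in> W"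
  shows "W = G"
proof -
  have "{g \<in> G. g 0 = 0} = G" using lmap_zero linear_groupD(4)[OF G] by auto
  then obtain f d where f: "generated_algebra (f ` {..<n}) = Inv G"
    "\<And>i. i < n \<Longrightarrow> homogeneous (d i) (f i)"
    using stabilizer_homogeneous_generators[OF G poly, of 0] by metis
  obtain x b a where a: "jacobian_setting (*s) Basis G f x b a"
    "\<And>i j t y v. a i j (t *s y) (t *s v) = t ^ (d i - 1) * a i j y v"
    using jacobian_setting_exists[OF assms(1) G f] by metis
  interpret jacobian_setting "(*s)" Basis G f x b a by (fact a(1))
  show ?thesis
    by (rule reflection_subgroup_eq[OF a(2) W]) (rule reflections)
qed

end

text \<open>For \<open>m = card Q\<close>, all roots of \<open>X\<^sup>m - 1\<close> are simple, so its derivative at \<open>1\<close> is nonzero.\<close>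

lemma finite_root_group:
  fixes Q :: "'k::field set"
  assumes Q: "finite Q" "1 \<in> Q" "0 \<notin> Q" "\<And>p q. p \<in> Q \<Longrightarrow> q \<in> Q \<Longrightarrow> p * q \<in> Q"
  shows "q \<in> Q \<Longrightarrow> q ^ card Q = 1" "of_nat (card Q) \<noteq> (0 :: 'k)"
    "q \<in> Q \<Longrightarrow> bij_betw (\<lambda>p. p * q) Q Q"
proof -
  have bij: "bij_betw (\<lambda>p. p * q) Q Q" if "q \<in> Q" for q
  proof -
    have "q \<noteq> 0" using that Q(3) by blast
    then have "inj_on (\<lambda>p. p * q) Q" by (auto simp: inj_on_def)
    moreover have "(\<lambda>p. p * q) ` Q \<subseteq> Q" using Q(4) that by auto
    ultimately show ?thesis using endo_inj_surj[OF Q(1)] by (simp add: bij_betw_def)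
  qed
  have root: "q ^ card Q = 1" if "q \<in> Q" for q
  proof -
    have "(\<Prod>p\<in>Q. p) = (\<Prod>p\<in>Q. p * q)" using prod.reindex_bij_betw[OF bij[OF that], of "\<lambda>p. p"] by simp
    also have "\<dots> = (\<Prod>p\<in>Q. p) * q ^ card Q" by (simp add: prod.distrib)
    finally show ?thesis using Q(1,3) by simp
  qed
  show "q \<in> Q \<Longrightarrow> q ^ card Q = 1" by (rule root)
  show "q \<in> Q \<Longrightarrow> bij_betw (\<lambda>p. p * q) Q Q" by (rule bij)
  let ?P = "\<Prod>q\<in>Q. [:- q, 1:]"
  have pos: "card Q > 0" using Q(1,2) card_gt_0_iff by blast
  have "?P = monom 1 (card Q) - 1"
  proof (rule ccontr)
    define L where "L = ?P - (monom 1 (card Q) - 1)"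
    assume "?P \<noteq> monom 1 (card Q) - 1"
    then have "L \<noteq> 0" by (simp add: L_def)
    have "degree L \<le> card Q"
      unfolding L_def using degree_coeff_prod_linear(1)[OF Q(1), of uminus]
      by (intro degree_diff_le) (auto simp: degree_monom_eq)
    moreover have "coeff L (card Q) = 0"
      unfolding L_def using degree_coeff_prod_linear(2)[OF Q(1), of uminus] pos by (simp add: coeff_eq_0)
    ultimately have "degree L < card Q"
      using \<open>L \<noteq> 0\<close> by (metis le_neq_implies_less leading_coeff_0_iff)
    moreover have "Q \<subseteq> {t. poly L t = 0}"
      using Q(1) root by (auto simp: L_def poly_prod poly_monom intro!: prod_zero)
    then have "card Q \<le> degree L"
      using card_poly_roots_bound[OF \<open>L \<noteq> 0\<close>] card_mono[OF poly_roots_finite[OF \<open>L \<noteq> 0\<close>]] by (meson order_trans)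
    ultimately show False by simp
  qed
  moreover have "?P = [:- 1, 1:] * (\<Prod>q\<in>Q - {1}. [:- q, 1:])"
    using prod.remove[OF Q(1,2), of "\<lambda>q. [:- q, 1:]"] .
  ultimately have "pderiv (monom 1 (card Q) - 1) = pderiv ([:- 1, 1:] * (\<Prod>q\<in>Q - {1}. [:- q, 1:]))" by metis
  then have "poly (pderiv (monom 1 (card Q) - 1)) 1 = poly (\<Prod>q\<in>Q - {1}. [:- q, 1:]) (1 :: 'k)"
    by (simp add: pderiv_mult pderiv_pCons del: mult_pCons_left)
  also have "poly (\<Prod>q\<in>Q - {1}. [:- q, 1:]) (1 :: 'k) \<noteq> 0" using Q(1) by (simp add: poly_prod)
  finally show "of_nat (card Q) \<noteq> (0 :: 'k)" by (simp add: pderiv_diff pderiv_monom poly_monom)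
qed

section \<open>Common divisors of powers, and the character of an invariant line\<close>

lemma monom_divisor_const:
  fixes p r :: "'k::field poly"
  assumes "p * r = monom 1 M" "poly p 0 \<noteq> 0"
  shows "degree p = 0"
proof -
  have nz: "p * r \<noteq> 0" using assms(1) by simp
  have "Polynomial.order 0 p = 0" using assms(2) by (simp add: order_root)
  then have "Polynomial.order 0 r = M" using order_mult[OF nz, of 0] assms(1) by simp
  moreover have "r \<noteq> 0" using nz by auto
  ultimately have "M \<le> degree r" using order_degree by metis
  moreover have "degree p + degree r = M"
  proof -
    have "p \<noteq> 0" "r \<noteq> 0" using nz by auto
    then have "degree (p * r) = degree p + degree r" by (rule degree_mult_eq)
    then show ?thesis unfolding assms(1) by (simp add: degree_monom_eq)
  qed
  ultimately show ?thesis by simp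
qed

context polynomial_space
begin

lemma generated_algebra_substitution:
  assumes x: "coords x b" and "c \<in> generated_algebra (f ` {..<n})"
  obtains P where "P \<in> S" "\<And>v. c v = P (\<Sum>i<n. f i v *s b i)"
proof -
  have "\<exists>P\<in>S. \<forall>v. c v = P (\<Sum>i<n. f i v *s b i)"
    using assms(2)
  proof (induction rule: generated_algebra.induct)
    case (const c)
    show ?case by (intro bexI[of _ "\<lambda>_. c"]) auto
  next
    case (gen c)
    then obtain i where "i < n" "c = f i" by auto
    then show ?case using coords_combination[OF x] coords_lform[OF x]
      by (intro bexI[of _ "x i"]) auto
  next
    case (add c d)
    then obtain P R where "P \<in> S" "R \<in> S" "\<forall>v. c v = P (\<Sum>i<n. f i v *s b i)"
      "\<forall>v. d v = R (\<Sum>i<n. f i v *s b i)" by blast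
    then show ?case by (intro bexI[of _ "\<lambda>v. P v + R v"]) auto
  next
    case (mult c d)
    then obtain P R where "P \<in> S" "R \<in> S" "\<forall>v. c v = P (\<Sum>i<n. f i v *s b i)"
      "\<forall>v. d v = R (\<Sum>i<n. f i v *s b i)" by blast
    then show ?case by (intro bexI[of _ "\<lambda>v. P v * R v"]) auto
  qed
  then show ?thesis using that by blast
qed

text \<open>Powers of two coordinates are coprime, so \<open>P\<close> is a unit. At a zero
  \<open>y\<close> of \<open>P\<close> both coordinates vanish. Shift \<open>y\<close> by a nonzero
  multiple \<open>s\<close> of \<open>b j\<close>: in direction \<open>b i\<close>, \<open>P\<close>
  divides a power of \<open>t\<close> and is nonzero at \<open>t = 0\<close>, hence is constant.
  Letting \<open>s\<close> tend to 0 formally, \<open>P (y + b i) = P y = 0\<close>, although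
  \<open>P\<close> divides a power of \<open>x i\<close>.\<close>

lemma common_divisor_of_powers_nonzero:
  assumes x: "coords x b" and ij: "i < n" "j < n" "i \<noteq> j"
    and S: "P \<in> S" "A \<in> S" and M: "M > 0"
    and i: "\<And>y. P y * A y = x i y ^ M" and j: "\<And>y. P y * B y = x j y ^ M"
  shows "P y \<noteq> 0"
proof
  assume y: "P y = 0"
  have xi: "x i y = 0" "x j y = 0" using i[of y] j[of y] y M by simp_all
  have coord: "x i (y + s *s b j + t *s b i) = t" "x j (y + s *s b j + t *s b i) = s" for s t
    using xi ij coords_basis[OF x] by (simp_all add: lform_add[OF coords_lform[OF x]] lform_scale[OF coords_lform[OF x]])
  have const: "P (y + s *s b j + 1 *s b i) = P (y + s *s b j + 0 *s b i)" if s: "s \<noteq> 0" for s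
  proof -
    obtain p where p: "\<And>t. P (y + s *s b j + t *s b i) = poly p t"
      using S_polycurve[OF S(1) polycurve_line] by metis
    obtain r where r: "\<And>t. A (y + s *s b j + t *s b i) = poly r t"
      using S_polycurve[OF S(2) polycurve_line] by metis
    have "p * r = monom 1 M"
      by (rule poly_eq_if_infinite[OF infinite_field])
        (use i coord(1) in \<open>simp add: poly_monom p[symmetric] r[symmetric]\<close>)
    moreover have "poly p 0 \<noteq> 0" using j[of "y + s *s b j + 0 *s b i"] coord(2)[of s 0] s p[of 0] by auto
    ultimately have "degree p = 0" by (rule monom_divisor_const)
    then obtain c where "p = [:c:]" by (rule degree_eq_zeroE)
    then show ?thesis using p[of 1] p[of 0] by simp
  qed
  obtain p where p: "\<And>s. P (y + b i + s *s b j) = poly p s" using S_polycurve[OF S(1) polycurve_line] by metis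
  obtain q where q: "\<And>s. P (y + s *s b j) = poly q s" using S_polycurve[OF S(1) polycurve_line] by metis
  have "poly p s = poly q s" if "s \<in> {t. t \<noteq> 0}" for s
    using const[of s] that p[of s] q[of s] by (simp add: add_ac)
  then have "p = q" using poly_eq_if_infinite[OF infinite_nonzero] by blast
  then have "P (y + b i) = 0" using p[of 0] q[of 0] y by simp
  then show False using i[of "y + b i"] coord(1)[of 0 1] by simp
qed

lemma line_character:
  assumes G: "linear_group G" and L: "subspace L" "dim L = 1" "\<forall>g\<in>G. g ` L \<subseteq> L"
  obtains \<chi> where "\<chi> id = 1" "\<And>g. g \<in> G \<Longrightarrow> \<chi> g \<noteq> 0"
    "\<And>g h. g \<in> G \<Longrightarrow> h \<in> G \<Longrightarrow> \<chi> (g \<circ> h) = \<chi> g * \<chi> h"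
    "pointwise_stabilizer G L = {g \<in> G. \<chi> g = (1 :: 'k)}"
proof -
  obtain B where B: "B \<subseteq> L" "independent B" "L \<subseteq> span B" "card B = 1"
    using basis_exists[of L] L(2) by metis
  then obtain u where u: "B = {u}" by (auto simp: card_1_singleton_iff)
  have u0: "u \<noteq> 0" and uL: "u \<in> L" using B u by (auto simp: dependent_zero)
  have line: "\<exists>c. v = c *s u" if "v \<in> L" for v using that B(3) u by (auto simp: span_singleton)
  have "\<forall>g. \<exists>c. g \<in> G \<longrightarrow> g u = c *s u" using L(3) uL line by blast
  from choice[OF this] obtain \<chi> where \<chi>: "\<And>g. g \<in> G \<Longrightarrow> g u = \<chi> g *s u" by blast
  have eq: "c = d" if "c *s u = d *s u" for c d using that u0 by simp
  have "\<chi> id = 1" using \<chi>[OF linear_groupD(2)[OF G]] u0 by (intro eq) simp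
  moreover have mult: "\<chi> (g \<circ> h) = \<chi> g * \<chi> h" if "g \<in> G" "h \<in> G" for g h
  proof (rule eq)
    have "\<chi> (g \<circ> h) *s u = g (h u)" using \<chi>[OF linear_groupD(3)[OF G that]] by simp
    also have "\<dots> = \<chi> h *s (\<chi> g *s u)"
      using \<chi>[OF that(1)] \<chi>[OF that(2)] lmap_scale[OF linear_groupD(4)[OF G that(1)]] by simp
    finally show "\<chi> (g \<circ> h) *s u = (\<chi> g * \<chi> h) *s u" by (simp only: scale_scale mult.commute)
  qed
  moreover have "\<chi> g \<noteq> 0" if g: "g \<in> G" for g
  proof -
    obtain h where "h \<in> G" "h \<circ> g = id" using linear_group_inverse[OF G g] by metis
    then show ?thesis using mult[of h g] g \<open>\<chi> id = 1\<close> by auto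
  qed
  moreover have "pointwise_stabilizer G L = {g \<in> G. \<chi> g = 1}"
  proof (intro equalityI subsetI)
    fix g assume "g \<in> pointwise_stabilizer G L"
    then have "g \<in> G" "g u = u" using uL by (auto simp: pointwise_stabilizer_def)
    then show "g \<in> {g \<in> G. \<chi> g = 1}" using \<chi>[of g] by (auto intro!: eq)
  next
    fix g assume "g \<in> {g \<in> G. \<chi> g = 1}"
    then have g: "g \<in> G" "g u = u" using \<chi>[of g] by auto
    have "g v = v" if "v \<in> L" for v
      using line[OF that] g(2) lmap_scale[OF linear_groupD(4)[OF G g(1)]] by auto
    then show "g \<in> pointwise_stabilizer G L" using g(1) by (auto simp: pointwise_stabilizer_def)
  qed
  ultimately show ?thesis by (intro that)
qed

end

section \<open>The stabilizer of an invariant line\<close>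

locale line_stabilizer = polynomial_space scale Basis
  for scale :: "'k::field \<Rightarrow> 'v::ab_group_add \<Rightarrow> 'v" (infixr \<open>*s\<close> 75) and Basis :: "'v set" +
  fixes G H :: "('v \<Rightarrow> 'v) set" and \<chi> :: "('v \<Rightarrow> 'v) \<Rightarrow> 'k"
  assumes dim_pos: "card Basis > 0"
    and G: "linear_group G"
    and chi_id: "\<chi> id = 1"
    and chi_nonzero: "\<And>g. g \<in> G \<Longrightarrow> \<chi> g \<noteq> 0"
    and chi_mult: "\<And>g h. g \<in> G \<Longrightarrow> h \<in> G \<Longrightarrow> \<chi> (g \<circ> h) = \<chi> g * \<chi> h"
    and H_eq: "H = {g \<in> G. \<chi> g = 1}"
begin

definition roots :: "'k set" where "roots = \<chi> ` G"

abbreviation "m \<equiv> card roots"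

text \<open>Representatives of the cosets of \<open>H\<close>, indexed by the values of the
  character.\<close>

definition rep :: "'k \<Rightarrow> 'v \<Rightarrow> 'v" where
  "rep q = (SOME g. g \<in> G \<and> \<chi> g = q)"

lemma rep: "q \<in> roots \<Longrightarrow> rep q \<in> G" "q \<in> roots \<Longrightarrow> \<chi> (rep q) = q"
  using someI_ex[of "\<lambda>g. g \<in> G \<and> \<chi> g = q"] by (auto simp: roots_def rep_def)

lemma chi_root: "g \<in> G \<Longrightarrow> \<chi> g \<in> roots"
  by (simp add: roots_def)

lemma roots_group: "finite roots" "1 \<in> roots" "0 \<notin> roots"
proof -
  show "finite roots" using linear_groupD(1)[OF G] by (simp add: roots_def)
  show "1 \<in> roots" using chi_root[OF linear_groupD(2)[OF G]] chi_id by simp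
  show "0 \<notin> roots" using chi_nonzero by (auto simp: roots_def)
qed

lemma roots_mult: "p \<in> roots \<Longrightarrow> q \<in> roots \<Longrightarrow> p * q \<in> roots"
  using rep chi_mult chi_root linear_groupD(3)[OF G] by metis

lemma root_power: "q \<in> roots \<Longrightarrow> q ^ m = 1"
  using finite_root_group(1)[OF roots_group] roots_mult by blast

lemma m_nonzero: "of_nat m \<noteq> (0 :: 'k)"
  using finite_root_group(2)[OF roots_group] roots_mult by blast

lemma roots_bij: "q \<in> roots \<Longrightarrow> bij_betw (\<lambda>p. p * q) roots roots"
  using finite_root_group(3)[OF roots_group] roots_mult by blast

lemma H: "linear_group H"
  unfolding linear_group_def
proof (intro conjI ballI)
  show "finite H" "id \<in> H" using linear_groupD[OF G] chi_id by (auto simp: H_eq)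
  fix g assume g: "g \<in> H"
  then show "lmap g" using linear_groupD[OF G] by (auto simp: H_eq)
  show "g \<circ> h \<in> H" if "h \<in> H" for h using g that linear_groupD(3)[OF G] chi_mult by (auto simp: H_eq)
  obtain h where h: "h \<in> G" "h \<circ> g = id" "g \<circ> h = id" using linear_group_inverse[OF G] g H_eq by blast
  then have "\<chi> h = 1" using chi_mult[of h g] g chi_id by (auto simp: H_eq)
  then show "\<exists>h\<in>H. h \<circ> g = id \<and> g \<circ> h = id" using h by (intro bexI[of _ h]) (auto simp: H_eq)
qed

lemma Inv_H_chi:
  assumes c: "c \<in> Inv H" and g: "g \<in> G" "g' \<in> G" "\<chi> g = \<chi> g'"
  shows "c (g v) = c (g' v)"
proof -
  obtain k where k: "k \<in> G" "k \<circ> g' = id" "g' \<circ> k = id" "\<And>v. k (g' v) = v" using linear_group_inverse[OF G g(2)] by metis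
  have "\<chi> (g \<circ> k) = \<chi> g' * \<chi> k" using chi_mult g k by simp
  also have "\<dots> = 1" using chi_mult[of g' k] g k chi_id by simp
  finally have "g \<circ> k \<in> H" using linear_groupD(3)[OF G] g k by (simp add: H_eq)
  then have "c ((g \<circ> k) (g' v)) = c (g' v)" using Inv_apply[OF c] by blast
  then show ?thesis by (simp add: k(4))
qed

definition eigen :: "('v \<Rightarrow> 'k) \<Rightarrow> bool" where
  "eigen c \<longleftrightarrow> (\<exists>j::nat. \<forall>g\<in>G. \<forall>v. c (g v) = \<chi> g ^ j * c v)"

text \<open>The projections onto the eigenspaces exist since \<open>m\<close> is invertible in \<open>k\<close>.\<close>

lemma eigen_decomposition:
  assumes c: "c \<in> Inv H" and hom: "homogeneous d c"
  shows "\<exists>(r::nat) e. (\<forall>j<r. e j \<in> Inv H \<and> homogeneous d (e j) \<and> eigen (e j)) \<and> c = (\<lambda>v. \<Sum>j<r. e j v)"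
proof -
  \<comment> \<open>The projection onto the part on which \<open>g\<close> acts by
    \<open>\<chi> g ^ j\<close>. Summed over \<open>j\<close>, the geometric sums leave only
    \<open>q = 1\<close>.\<close>
  define e where "e j v = inverse (of_nat m) * (\<Sum>q\<in>roots. inverse q ^ j * c (rep q v))" for j :: nat and v
  have eS: "e j \<in> S" for j
    unfolding e_def[abs_def]
    by (intro S_cmult S_sum S_lmap[OF Inv_S[OF c]]) (use rep linear_groupD(4)[OF G] in auto)
  have eig: "e j (g v) = \<chi> g ^ j * e j v" if g: "g \<in> G" for j g v
  proof -
    have "(\<Sum>q\<in>roots. inverse q ^ j * c (rep q (g v)))
        = (\<Sum>q\<in>roots. \<chi> g ^ j * (inverse (q * \<chi> g) ^ j * c (rep (q * \<chi> g) v)))"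
    proof (rule sum.cong[OF refl])
      fix q assume q: "q \<in> roots"
      have qg: "q * \<chi> g \<in> roots" using roots_mult[OF q chi_root[OF g]] .
      have "c ((rep q \<circ> g) v) = c (rep (q * \<chi> g) v)"
        using rep[OF q] rep[OF qg] g chi_mult linear_groupD(3)[OF G]
        by (intro Inv_H_chi[OF c, of "rep q \<circ> g" "rep (q * \<chi> g)" v]) auto
      then show "inverse q ^ j * c (rep q (g v)) = \<chi> g ^ j * (inverse (q * \<chi> g) ^ j * c (rep (q * \<chi> g) v))"
        using chi_nonzero[OF g] by (simp add: power_mult_distrib field_simps)
    qed
    also have "\<dots> = \<chi> g ^ j * (\<Sum>q\<in>roots. inverse q ^ j * c (rep q v))"
      unfolding sum_distrib_left[symmetric]
      using sum.reindex_bij_betw[OF roots_bij[OF chi_root[OF g]], of "\<lambda>q. inverse q ^ j * c (rep q v)"] by simp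
    finally show ?thesis by (simp add: e_def)
  qed
  have "e j \<in> Inv H" for j using eS eig by (auto simp: Inv_iff H_eq)
  moreover have "homogeneous d (e j)" for j
  proof -
    have "e j (t *s v) = t ^ d * e j v" for t v
    proof -
      have "c (rep q (t *s v)) = t ^ d * c (rep q v)" if "q \<in> roots" for q
        using hom lmap_scale[OF linear_groupD(4)[OF G rep(1)[OF that]]] by (simp add: homogeneous_def)
      then show ?thesis by (simp add: e_def sum_distrib_left mult_ac)
    qed
    then show ?thesis using eS by (simp add: homogeneous_def)
  qed
  moreover have "eigen (e j)" for j using eig by (auto simp: eigen_def)
  moreover have "c v = (\<Sum>j<m. e j v)" for v
  proof -
    have "(\<Sum>j<m. e j v) = inverse (of_nat m) * (\<Sum>q\<in>roots. (\<Sum>j<m. inverse q ^ j) * c (rep q v))"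
      unfolding e_def sum_distrib_left[symmetric] by (subst sum.swap) (simp add: sum_distrib_right)
    also have "(\<Sum>q\<in>roots. (\<Sum>j<m. inverse q ^ j) * c (rep q v))
        = (\<Sum>q\<in>roots. if q = 1 then of_nat m * c (rep q v) else 0)"
    proof (rule sum.cong[OF refl])
      fix q assume q: "q \<in> roots"
      have "(\<Sum>j<m. inverse q ^ j) = 0" if "q \<noteq> 1"
      proof -
        have "inverse q ^ m = 1" using root_power[OF q] by (simp add: power_inverse)
        moreover have "inverse q \<noteq> 1" using that by (metis inverse_1 inverse_inverse_eq)
        ultimately show ?thesis by (simp add: geometric_sum)
      qed
      then show "(\<Sum>j<m. inverse q ^ j) * c (rep q v) = (if q = 1 then of_nat m * c (rep q v) else 0)" by simp
    qed
    also have "\<dots> = of_nat m * c (rep 1 v)" using roots_group(1,2) by simp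
    also have "c (rep 1 v) = c (id v)"
      using rep[OF roots_group(2)] chi_id linear_groupD(2)[OF G]
      by (intro Inv_H_chi[OF c, of "rep 1" id v]) auto
    finally show ?thesis using m_nonzero by simp
  qed
  then have "c = (\<lambda>v. \<Sum>j<m. e j v)" by blast
  ultimately show ?thesis by blast
qed

text \<open>
  If \<open>g\<close> fixes the hyperplane \<open>l = 0\<close> and scales both \<open>f i\<close> and \<open>f j\<close> nontrivially, these are
  divisible by \<open>l\<close>; then the norm of \<open>l\<close> divides powers of both in \<open>k[f]\<close>.
\<close>

lemma polynomial_ring_from_line_stabilizer:
  assumes H_poly: "is_polynomial_ring (Inv H)"
    and gen: "\<And>W. linear_group W \<Longrightarrow> W \<subseteq> G \<Longrightarrow>
      (\<And>g l. g \<in> G \<Longrightarrow> lform l \<Longrightarrow> \<exists>u. l u \<noteq> 0 \<Longrightarrow> (\<And>u. l u = 0 \<Longrightarrow> g u = u) \<Longrightarrow> g \<in> W) \<Longrightarrow> W = G"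
  shows "is_polynomial_ring (Inv G)"
proof -
  obtain f0 where f0: "generated_algebra (f0 ` {..<n}) = Inv H" using polynomial_ring_generators[OF H_poly] .
  \<comment> \<open>\<open>H\<close> is the stabilizer of the origin in itself, so
    \<open>stabilizer_bound\<close> applies with \<open>w = 0\<close>.\<close>
  have H0: "H = {g \<in> H. g 0 = 0}" using lmap_zero linear_groupD(4)[OF H] by auto
  obtain f d where f: "generated_algebra (f ` {..<n}) = Inv H"
    and hom: "\<And>i. i < n \<Longrightarrow> homogeneous (d i) (f i)" and eig: "\<And>i. i < n \<Longrightarrow> eigen (f i)"
  proof (rule homogeneous_generators[OF H, of eigen])
    show "eigen (\<lambda>_. 0)" by (simp add: eigen_def)
    show "\<exists>F. \<forall>c\<in>Inv H. c 0 = 0 \<longrightarrow> (\<exists>r. \<exists>i\<in>decomposable H.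
      vanishes_to_order D (\<lambda>v. c v - (\<Sum>l<n. r l * F l v) - i v))" if "D > 0" for D
      by (rule stabilizer_bound[OF H f0 H0 that])
  qed (use eigen_decomposition in blast)+
  have "\<forall>i. \<exists>k::nat. i < n \<longrightarrow> (\<forall>g\<in>G. \<forall>v. f i (g v) = \<chi> g ^ k * f i v)" using eig unfolding eigen_def by blast
  from choice[OF this] obtain a :: "nat \<Rightarrow> nat"
    where a: "\<And>i g v. i < n \<Longrightarrow> g \<in> G \<Longrightarrow> f i (g v) = \<chi> g ^ a i * f i v" by blast
  have fS: "f i \<in> S" if "i < n" for i using homogeneous_S[OF hom[OF that]] .
  obtain x b A where "jacobian_setting (*s) Basis H f x b A"
    using jacobian_setting_exists[OF dim_pos H f hom] by metis
  then interpret J: jacobian_setting "(*s)" Basis H f x b A .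
  note x = J.x
  have one_moved: "\<chi> g ^ a i = 1 \<or> \<chi> g ^ a j = 1"
    if g: "g \<in> G" and l: "lform l" "\<exists>u. l u \<noteq> 0" "\<And>u. l u = 0 \<Longrightarrow> g u = u" and ij: "i < n" "j < n" "i \<noteq> j" for g l i j
  proof (rule ccontr)
    assume nt: "\<not> (\<chi> g ^ a i = 1 \<or> \<chi> g ^ a j = 1)"
    define N where "N v = (\<Prod>h\<in>H. l (h v))" for v
    have N: "N \<in> Inv H" unfolding N_def[abs_def] by (rule Inv_orbit_prod[OF H S_lform[OF l(1)]])
    obtain P where P: "P \<in> S" "\<And>v. N v = P (J.f_map v)"
      using generated_algebra_substitution[OF x, of N f] N f by blast
    have dvd: "\<exists>R\<in>S. \<forall>y. P y * R y = x k y ^ card H" if k: "k < n" "\<chi> g ^ a k \<noteq> 1" for k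
    proof -
      have "f k v = 0" if "l v = 0" for v
      proof -
        have "f k v = \<chi> g ^ a k * f k v" using a[OF k(1) g, of v] l(3)[OF that] by simp
        then show ?thesis using k(2) by simp
      qed
      moreover obtain u where "l u \<noteq> 0" using l(2) by blast
      ultimately obtain s where s: "s \<in> S" "\<And>v. f k v = l v * s v"
        using lform_dvd_if_vanishes[OF l(1) _ fS[OF k(1)]] by blast
      define R where "R v = (\<Prod>h\<in>H. s (h v))" for v
      have "R \<in> Inv H" unfolding R_def[abs_def] by (rule Inv_orbit_prod[OF H s(1)])
      then obtain R' where R': "R' \<in> S" "\<And>v. R v = R' (J.f_map v)"
        using generated_algebra_substitution[OF x, of R f] f by blast
      \<comment> \<open>\<open>N v * R v\<close> is the product of the \<open>f k (h v)\<close> over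
        \<open>H\<close>, that is \<open>f k v ^ card H\<close>. Independence of the generators
        lifts this to an identity in coordinates.\<close>
      have "P y * R' y - x k y ^ card H = 0" for y
      proof (rule J.f_functionally_independent)
        show "(\<lambda>y. P y * R' y - x k y ^ card H) \<in> S"
          using P(1) R'(1) J.x_S[OF k(1)] by (intro S_diff S_mult S_power) auto
        fix v
        have "P (J.f_map v) * R' (J.f_map v) = (\<Prod>h\<in>H. l (h v) * s (h v))"
          unfolding P(2)[symmetric] R'(2)[symmetric] N_def R_def prod.distrib ..
        also have "\<dots> = (\<Prod>h\<in>H. f k v)"
          using Inv_apply[OF J.f_Inv[OF k(1)]] by (intro prod.cong) (simp_all add: s(2)[symmetric])
        finally show "P (J.f_map v) * R' (J.f_map v) - x k (J.f_map v) ^ card H = 0"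
          using coords_combination[OF x k(1), of "\<lambda>i. f i v"] by simp
      qed
      then show ?thesis using R'(1) by (intro bexI[of _ R']) auto
    qed
    obtain R1 where R1: "R1 \<in> S" "\<And>y. P y * R1 y = x i y ^ card H" using dvd[OF ij(1)] nt by blast
    obtain R2 where R2: "\<And>y. P y * R2 y = x j y ^ card H" using dvd[OF ij(2)] nt by blast
    have "card H > 0" using J.finite_G J.id_G card_gt_0_iff by blast
    \<comment> \<open>\<open>P\<close> divides powers of two coordinates and so vanishes nowhere,
      whereas the norm \<open>N\<close> vanishes at the origin together with
      \<open>l\<close>.\<close>
    then have "P (J.f_map 0) \<noteq> 0"
      using common_divisor_of_powers_nonzero[OF x ij P(1) R1(1) _ R1(2) R2] by blast
    moreover have "N 0 = 0"
      unfolding N_def using J.finite_G J.id_G lform_zero[OF l(1)] by (intro prod_zero) (auto intro!: bexI[of _ id])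
    ultimately show False using P(2)[of 0] by simp
  qed
  define trivial where "trivial k \<longleftrightarrow> (\<forall>g\<in>G. \<chi> g ^ k = 1)" for k :: nat
  have trivial_m: "trivial (k * m)" for k
    using root_power[OF chi_root] by (simp add: trivial_def power_mult mult.commute[of k])
  have m_pos: "m > 0" using m_nonzero by (metis neq0_conv of_nat_0)
  \<comment> \<open>The order of the character by which \<open>G\<close> acts on \<open>f i\<close>,
    so \<open>F i\<close> is the least positive power of \<open>f i\<close> whose character is
    trivial.\<close>
  define e where "e i = (LEAST e. e > 0 \<and> trivial (a i * e))" for i
  have e: "e i > 0" "trivial (a i * e i)" for i
    using LeastI_ex[of "\<lambda>e. e > 0 \<and> trivial (a i * e)"] m_pos trivial_m by (auto simp: e_def)
  have e_dvd: "e i dvd k" if "trivial (a i * k)" for i k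
  proof -
    have "trivial (a i * (k mod e i))"
      unfolding trivial_def
    proof
      fix g assume g: "g \<in> G"
      have "a i * k = a i * e i * (k div e i) + a i * (k mod e i)"
        by (metis add_mult_distrib2 mult.assoc mult_div_mod_eq)
      then have "\<chi> g ^ (a i * k) = (\<chi> g ^ (a i * e i)) ^ (k div e i) * \<chi> g ^ (a i * (k mod e i))"
        by (simp add: power_add power_mult)
      then show "\<chi> g ^ (a i * (k mod e i)) = 1" using that e(2) g by (simp add: trivial_def)
    qed
    moreover have "k mod e i < e i" using e(1) by simp
    ultimately have "k mod e i = 0" using not_less_Least[of "k mod e i" "\<lambda>e. e > 0 \<and> trivial (a i * e)"]
      unfolding e_def by auto
    then show ?thesis by (simp add: dvd_eq_mod_eq_0)
  qed
  define F where "F i v = f i v ^ e i" for i v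
  have F_Inv: "F i \<in> Inv G" if "i < n" for i
    using a[OF that] e(2)[of i] S_power[OF fS[OF that]]
    by (auto simp: Inv_iff F_def[abs_def] power_mult_distrib power_mult[symmetric] trivial_def)
  have F_hom: "homogeneous (d i * e i) (F i)" if "i < n" for i
    using hom[OF that] S_power[OF fS[OF that]]
    by (auto simp: homogeneous_def F_def[abs_def] power_mult_distrib power_mult)
  \<comment> \<open>The averaging operator for \<open>G/H\<close>, available because
    \<open>m\<close> is invertible.\<close>
  define avg where "avg c v = inverse (of_nat m) * (\<Sum>q\<in>roots. c (rep q v))" for c :: "'v \<Rightarrow> 'k" and v
  have avg_monomial: "avg (\<lambda>v. C * (\<Prod>j<n. f j v ^ \<kappa> j)) \<in> generated_algebra (F ` {..<n})" for C \<kappa>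
  proof -
    define w where "w = (\<Sum>j<n. a j * \<kappa> j)"
    let ?c = "\<lambda>v. C * (\<Prod>j<n. f j v ^ \<kappa> j)"
    have cg: "?c (g v) = \<chi> g ^ w * ?c v" if g: "g \<in> G" for g v
    proof -
      have "(\<Prod>j<n. f j (g v) ^ \<kappa> j) = (\<Prod>j<n. \<chi> g ^ (a j * \<kappa> j) * f j v ^ \<kappa> j)"
        using a[OF _ g] by (intro prod.cong) (auto simp: power_mult_distrib power_mult)
      then show ?thesis by (simp add: prod.distrib power_sum w_def mult_ac)
    qed
    have avg_c: "avg ?c v = inverse (of_nat m) * (\<Sum>q\<in>roots. q ^ w) * ?c v" for v
    \<comment> \<open>An eigenvector of weight \<open>w\<close> is multiplied by the mean of
      \<open>q ^ w\<close> over \<open>roots\<close>, which is 1 if the weight is trivial and 0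
      otherwise.\<close>
    proof -
      have "(\<Sum>q\<in>roots. ?c (rep q v)) = (\<Sum>q\<in>roots. q ^ w * ?c v)"
      proof (rule sum.cong[OF refl])
        fix q assume q: "q \<in> roots"
        show "?c (rep q v) = q ^ w * ?c v" using cg[OF rep(1)[OF q], of v] unfolding rep(2)[OF q] .
      qed
      then show ?thesis unfolding avg_def by (simp only: sum_distrib_right mult.assoc)
    qed
    show ?thesis
    proof (cases "trivial w")
      case False
      then obtain g where g: "g \<in> G" "\<chi> g ^ w \<noteq> 1" by (auto simp: trivial_def)
      have "(\<Sum>q\<in>roots. q ^ w) = (\<Sum>q\<in>roots. (q * \<chi> g) ^ w)"
        using sum.reindex_bij_betw[OF roots_bij[OF chi_root[OF g(1)]], of "\<lambda>q. q ^ w"] by simp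
      also have "\<dots> = (\<Sum>q\<in>roots. q ^ w) * \<chi> g ^ w" by (simp add: power_mult_distrib sum_distrib_right)
      finally have "(\<Sum>q\<in>roots. q ^ w) = 0" using g(2) by (metis mult_cancel_left1)
      then have "avg ?c = (\<lambda>_. 0)" using avg_c by auto
      then show ?thesis by (simp only: generated_algebra.const)
    next
      case True
      have "(\<Sum>q\<in>roots. q ^ w) = of_nat m"
        using True rep unfolding trivial_def by (subst sum.cong[OF refl, of _ _ "\<lambda>_. 1"]) (metis, simp)
      then have avg_eq: "avg ?c = ?c" using avg_c m_nonzero by auto
      have "trivial (a j * \<kappa> j)" if j: "j < n" for j
      proof -
        \<comment> \<open>A reflection that fixes \<open>f j\<close> lies in \<open>W\<close>. One
          that moves \<open>f j\<close> fixes every other generator, so on it the trivial total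
          weight reduces to \<open>a j * \<kappa> j\<close>, and again it lies in \<open>W\<close>.
          Hence \<open>W = G\<close>, and \<open>e j\<close> divides the exponent of
          \<open>f j\<close>.\<close>
        define W where "W = {g \<in> G. \<chi> g ^ (a j * \<kappa> j) = 1}"
        have "linear_group W"
          unfolding linear_group_def
        proof (intro conjI ballI)
          show "finite W" "id \<in> W" using linear_groupD[OF G] chi_id by (auto simp: W_def)
          fix g assume g: "g \<in> W"
          then show "lmap g" using linear_groupD[OF G] by (auto simp: W_def)
          show "g \<circ> h \<in> W" if "h \<in> W" for h
            using g that linear_groupD(3)[OF G] chi_mult by (auto simp: W_def power_mult_distrib)
          obtain h where h: "h \<in> G" "h \<circ> g = id" "g \<circ> h = id" using linear_group_inverse[OF G] g W_def by blast
          have "(\<chi> h * \<chi> g) ^ (a j * \<kappa> j) = 1" using chi_mult[of h g] g h chi_id by (simp add: W_def)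
          then have "h \<in> W" using g h(1) by (simp add: W_def power_mult_distrib)
          then show "\<exists>h\<in>W. h \<circ> g = id \<and> g \<circ> h = id" using h by blast
        qed
        moreover have "W \<subseteq> G" by (auto simp: W_def)
        moreover have "g \<in> W" if g: "g \<in> G" and l: "lform l" "\<exists>u. l u \<noteq> 0" "\<And>u. l u = 0 \<Longrightarrow> g u = u" for g l
        proof (cases "\<chi> g ^ a j = 1")
          case True
          then show ?thesis using g by (simp add: W_def power_mult)
        next
          case False
          then have "\<chi> g ^ a i = 1" if "i < n" "i \<noteq> j" for i
            using one_moved[OF g l that(1) j that(2)] by blast
          then have "(\<Prod>i<n. \<chi> g ^ (a i * \<kappa> i)) = (\<Prod>i<n. if i = j then \<chi> g ^ (a j * \<kappa> j) else 1)"
            by (intro prod.cong) (auto simp: power_mult)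
          then have "\<chi> g ^ w = \<chi> g ^ (a j * \<kappa> j)" using j by (simp add: w_def power_sum)
          then show ?thesis using \<open>trivial w\<close> g by (simp add: trivial_def W_def)
        qed
        ultimately have "W = G" by (rule gen)
        then show ?thesis by (auto simp: trivial_def W_def)
      qed
      then have "f j v ^ \<kappa> j = F j v ^ (\<kappa> j div e j)" if "j < n" for j v
        using e_dvd[of j "\<kappa> j"] that by (simp add: F_def power_mult[symmetric])
      then have c_eq: "?c = (\<lambda>v. C * (\<Prod>j<n. F j v ^ (\<kappa> j div e j)))" by simp
      have power: "(\<lambda>v. F j v ^ k) \<in> generated_algebra (F ` {..<n})" if "j < n" for j k
      proof (induction k)
        case (Suc k)
        have "F j \<in> generated_algebra (F ` {..<n})" using that by (intro generated_algebra.gen) simp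
        from generated_algebra.mult[OF this Suc] show ?case by simp
      qed (simp add: generated_algebra.const)
      have "(\<lambda>v. \<Prod>j\<in>I. F j v ^ (\<kappa> j div e j)) \<in> generated_algebra (F ` {..<n})" if "finite I" "I \<subseteq> {..<n}" for I
        using that
      proof (induction I rule: finite_induct)
        case (insert i I)
        then show ?case using generated_algebra.mult[OF power[of i "\<kappa> i div e i"]] by simp
      qed (simp add: generated_algebra.const)
      from generated_algebra_cmult[OF this[of "{..<n}"]]
      show ?thesis unfolding avg_eq unfolding c_eq by simp
    qed
  qed
  have "Inv G \<subseteq> generated_algebra (F ` {..<n})"
  proof
    fix c assume c: "c \<in> Inv G"
    then have "c \<in> Inv H" by (auto simp: Inv_iff H_eq)
    then obtain P where P: "P \<in> S" "\<And>v. c v = P (J.f_map v)"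
      using generated_algebra_substitution[OF x, of c f] f by blast
    obtain D where "P \<in> monomial_span x D" using S_monomial_span[OF x P(1)] .
    then have "avg (\<lambda>v. P (J.f_map v)) \<in> generated_algebra (F ` {..<n})"
    proof (induction rule: monomial_span.induct)
      case (monomial \<kappa> C)
      have "(\<Prod>j<n. x j (J.f_map v) ^ \<kappa> j) = (\<Prod>j<n. f j v ^ \<kappa> j)" for v
        using coords_combination[OF x, of _ "\<lambda>i. f i v"] by (intro prod.cong) auto
      then show ?case using avg_monomial[of C \<kappa>] by simp
    next
      case (add P R)
      have "avg (\<lambda>v. P (J.f_map v) + R (J.f_map v)) = (\<lambda>v. avg (\<lambda>v. P (J.f_map v)) v + avg (\<lambda>v. R (J.f_map v)) v)"
        by (simp add: avg_def sum.distrib distrib_left fun_eq_iff)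
      then show ?case using generated_algebra.add[OF add.IH] by simp
    qed
    moreover have "avg c = c"
    proof
      show "avg c v = c v" for v unfolding avg_def using Inv_apply[OF c rep(1)] m_nonzero by simp
    qed
    moreover have "(\<lambda>v. P (J.f_map v)) = c" unfolding P(2)[symmetric] ..
    ultimately show "c \<in> generated_algebra (F ` {..<n})" by simp
  qed
  moreover have "generated_algebra (F ` {..<n}) \<subseteq> Inv G" using F_Inv by (intro generated_algebra_subset_Inv) auto
  ultimately have "generated_algebra (F ` {..<n}) = Inv G" by blast
  then show ?thesis by (rule polynomial_ring_if_homogeneous_generators[OF dim_pos G _ F_hom])
qed

end

text \<open>Over a finite field, 1 plus the product of all \<open>X - a\<close> would be a
  nonconstant polynomial without roots.\<close>

lemma infinite_alg_closed_field: "infinite (UNIV :: 'k::alg_closed_field set)"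
proof
  assume fin: "finite (UNIV :: 'k set)"
  let ?p = "(\<Prod>a\<in>UNIV. [:- a, 1:]) + 1 :: 'k poly"
  have "card (UNIV :: 'k set) > 0" using fin by (simp add: card_gt_0_iff)
  then have "degree ?p = card (UNIV :: 'k set)"
    using degree_coeff_prod_linear(1)[OF fin, of uminus] by (subst degree_add_eq_left) auto
  then obtain t where "poly ?p t = 0"
    using alg_closed_imp_poly_has_root[of ?p] \<open>card UNIV > 0\<close> by auto
  moreover have "poly (\<Prod>a\<in>UNIV. [:- a, 1:]) t = 0"
    unfolding poly_prod using fin by (intro prod_zero) (auto intro!: bexI[of _ t])
  ultimately show False by simp
qed

section \<open>Translation to \<open>GL\<close> and to pseudoreflections\<close>

context polynomial_space
begin

lemma subgroup_GL_iff: "subgroup G (GL (*s)) \<and> finite G \<longleftrightarrow> linear_group G"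
proof
  assume G: "subgroup G (GL (*s)) \<and> finite G"
  interpret GL: group "GL (*s)" by (rule group_GL[OF vector_space_axioms])
  interpret subgroup G "GL (*s)" using G by blast
  have "\<exists>h\<in>G. h \<circ> g = id \<and> g \<circ> h = id" if g: "g \<in> G" for g
    using GL.l_inv[OF mem_carrier[OF g]] GL.r_inv[OF mem_carrier[OF g]] m_inv_closed[OF g]
    by (intro bexI[of _ "inv\<^bsub>GL (*s)\<^esub> g"]) (auto simp: GL_def)
  then show "linear_group G"
    using G subset m_closed one_closed by (auto simp: linear_group_def GL_def)
next
  assume G: "linear_group G"
  interpret GL: group "GL (*s)" by (rule group_GL[OF vector_space_axioms])
  have bij: "bij g" if "g \<in> G" for g
    using linear_group_inverse[OF G that] o_bij by metis
  have "inv\<^bsub>GL (*s)\<^esub> g \<in> G" if g: "g \<in> G" for g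
  proof -
    obtain h where h: "h \<in> G" "h \<circ> g = id" using linear_group_inverse[OF G g] by metis
    then have "inv\<^bsub>GL (*s)\<^esub> g = h"
      using g bij linear_groupD(4)[OF G] by (intro GL.inv_equality) (auto simp: GL_def)
    then show ?thesis using h by simp
  qed
  then have "subgroup G (GL (*s))"
    using linear_groupD[OF G] bij by unfold_locales (auto simp: GL_def)
  then show "subgroup G (GL (*s)) \<and> finite G" using linear_groupD(1)[OF G] by blast
qed

lemma hyperplane_lform:
  assumes "is_hyperplane (*s) U"
  obtains l where "lform l" "\<exists>u. l u \<noteq> 0" "\<And>v. l v = 0 \<Longrightarrow> v \<in> U"
proof -
  have U: "subspace U" "dim U + 1 = n" using assms by (auto simp: is_hyperplane_def)
  obtain B where B: "B \<subseteq> U" "independent B" "U \<subseteq> span B" "card B = dim U" using basis_exists by metis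
  have finB: "finite B" using B(2) by (rule finiteI_independent)
  have "span B \<noteq> UNIV"
  proof
    assume "span B = UNIV"
    then have "dim (UNIV :: 'v set) \<le> card B" using dim_le_card[of UNIV B] finB by simp
    then show False using U B by simp
  qed
  then obtain z where z: "z \<notin> span B" by blast
  then have zB: "z \<notin> B" using span_base by blast
  have ind: "independent (insert z B)" using z B(2) by (rule independent_insertI)
  have span: "span (insert z B) = UNIV"
    using card_ge_dim_independent[of "insert z B" UNIV] ind U B(4) finB zB by auto
  define l where "l v = representation (insert z B) v z" for v
  have "lform l"
    using ind span by (auto simp: lform_iff l_def representation_add representation_scale)
  moreover have "l z \<noteq> 0" using representation_basis[OF ind, of z] by (simp add: l_def)
  moreover have "v \<in> U" if "l v = 0" for v
  proof -
    have "(\<Sum>u\<in>insert z B. representation (insert z B) v u *s u) = v"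
      using ind span finB by (intro sum_representation_eq) auto
    then have "v = (\<Sum>u\<in>B. representation (insert z B) v u *s u)" using finB zB that by (simp add: l_def)
    also have "\<dots> \<in> U" using B(1) U(1) by (intro subspace_sum subspace_scale) auto
    finally show ?thesis .
  qed
  ultimately show ?thesis using that by blast
qed

text \<open>If \<open>g\<close> fixed a vector off the hyperplane as well, it would be the identity.
  Finite order follows from the pigeonhole principle for the powers of \<open>g\<close>.\<close>

lemma pseudoreflection_if_fixes_hyperplane:
  assumes G: "linear_group G" and g: "g \<in> G" "g \<noteq> id"
    and l: "lform l" "\<exists>u. l u \<noteq> 0" "\<And>u. l u = 0 \<Longrightarrow> g u = u"
  shows "pseudoreflection (*s) g"
proof -
  have gl: "lmap g" using linear_groupD(4)[OF G g(1)] .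
  have fixed: "{v. g v = v} = {v. l v = 0}"
  proof (intro equalityI subsetI; clarsimp simp: l(3))
    fix u assume u: "g u = u"
    show "l u = 0"
    proof (rule ccontr)
      assume lu: "l u \<noteq> 0"
      have "g v = v" for v
      proof -
        let ?w = "v - (l v / l u) *s u"
        have "l ?w = 0" using lu by (simp add: lform_diff[OF l(1)] lform_scale[OF l(1)])
        then have "g ?w = ?w" by (rule l(3))
        then show ?thesis using u by (simp add: lmap_diff[OF gl] lmap_scale[OF gl])
      qed
      then show False using g(2) by auto
    qed
  qed
  let ?U = "{v. l v = 0}"
  have U: "subspace ?U" by (rule subspace_lform_kernel[OF l(1)])
  obtain u where u: "l u \<noteq> 0" using l(2) by blast
  have "v \<in> span (insert u ?U)" for v
  proof -
    have "l (v - (l v / l u) *s u) = 0" using u by (simp add: lform_diff[OF l(1)] lform_scale[OF l(1)])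
    then have "v - (l v / l u) *s u \<in> span (insert u ?U)" by (intro span_base) simp
    moreover have "(l v / l u) *s u \<in> span (insert u ?U)" by (intro span_scale span_base) simp
    ultimately show ?thesis using span_add by fastforce
  qed
  then have "span (insert u ?U) = UNIV" by blast
  then have "dim (insert u ?U) = dim (UNIV :: 'v set)" by (metis dim_span)
  moreover have "u \<notin> span ?U"
  proof -
    have spanU: "span ?U = ?U" using U by (simp only: span_eq_iff)
    show ?thesis unfolding spanU using u by simp
  qed
  ultimately have "dim ?U + 1 = dim (UNIV :: 'v set)" using dim_insert[of u ?U] by simp
  then have "is_hyperplane (*s) {v. g v = v}" unfolding fixed is_hyperplane_def using U by blast
  moreover have "\<exists>k>0. g ^^ k = id"
  proof -
    have "g ^^ k \<in> G" for k
      using g(1) linear_groupD(2,3)[OF G] by (induction k) auto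
    then have "range (\<lambda>k. g ^^ k) \<subseteq> G" by auto
    then have "\<not> inj (\<lambda>k. g ^^ k)"
      using linear_groupD(1)[OF G] finite_subset range_inj_infinite by blast
    then obtain i j where ij: "g ^^ i = g ^^ j" "i < j" unfolding inj_def by (metis linorder_neqE_nat)
    have "inj g" using linear_group_inverse[OF G g(1)] by (metis inj_on_id inj_on_imageI2)
    then have "inj (g ^^ i)" by (rule inj_fn)
    moreover have "(g ^^ i) ((g ^^ (j - i)) v) = (g ^^ i) v" for v
      using ij funpow_add[of i "j - i" g] by (metis comp_apply le_add_diff_inverse less_imp_le)
    ultimately have "g ^^ (j - i) = id" by (auto simp: inj_def)
    then show ?thesis using ij(2) by (intro exI[of _ "j - i"]) simp
  qed
  ultimately show ?thesis using gl by (simp add: pseudoreflection_def)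
qed

text \<open>Generation as minimality among subgroups. Elements fixing a hyperplane pointwise are the
  pseudoreflections and \<open>id\<close>, and \<open>id\<close> lies in every subgroup.\<close>

lemma generated_by_pseudoreflections_iff:
  assumes G: "linear_group G"
  shows "generate (GL (*s)) {g \<in> G. pseudoreflection (*s) g} = G \<longleftrightarrow>
    (\<forall>W. linear_group W \<longrightarrow> W \<subseteq> G \<longrightarrow>
      (\<forall>g l. g \<in> G \<longrightarrow> lform l \<longrightarrow> (\<exists>u. l u \<noteq> 0) \<longrightarrow> (\<forall>u. l u = 0 \<longrightarrow> g u = u) \<longrightarrow> g \<in> W) \<longrightarrow> W = G)"
    (is "generate _ ?R = G \<longleftrightarrow> ?rhs")
proof
  interpret GL: group "GL (*s)" by (rule group_GL[OF vector_space_axioms])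
  have sub_G: "subgroup G (GL (*s))" using subgroup_GL_iff G by blast
  then have R: "?R \<subseteq> carrier (GL (*s))" using subgroup.subset by blast
  show ?rhs if gen: "generate (GL (*s)) ?R = G"
  proof (intro allI impI)
    fix W assume W: "linear_group W" "W \<subseteq> G"
      and refl: "\<forall>g l. g \<in> G \<longrightarrow> lform l \<longrightarrow> (\<exists>u. l u \<noteq> 0) \<longrightarrow> (\<forall>u. l u = 0 \<longrightarrow> g u = u) \<longrightarrow> g \<in> W"
    have "?R \<subseteq> W"
    proof
      fix g assume "g \<in> ?R"
      then have g: "g \<in> G" "is_hyperplane (*s) {v. g v = v}" by (auto simp: pseudoreflection_def)
      obtain l where "lform l" "\<exists>u. l u \<noteq> 0" "\<And>v. l v = 0 \<Longrightarrow> v \<in> {v. g v = v}"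
        using hyperplane_lform[OF g(2)] by blast
      then show "g \<in> W" using refl g(1) by blast
    qed
    then have "generate (GL (*s)) ?R \<subseteq> W"
      using GL.generate_subgroup_incl subgroup_GL_iff W(1) by blast
    then show "W = G" using gen W(2) by blast
  qed
  show "generate (GL (*s)) ?R = G" if rhs: ?rhs
  proof -
    let ?W = "generate (GL (*s)) ?R"
    have "?W \<subseteq> G" by (rule GL.generate_subgroup_incl[OF _ sub_G]) auto
    moreover have "subgroup ?W (GL (*s))" by (rule GL.generate_is_subgroup[OF R])
    ultimately have W: "linear_group ?W" "?W \<subseteq> G"
      using subgroup_GL_iff linear_groupD(1)[OF G] finite_subset by blast+
    have "g \<in> ?W" if "g \<in> G" "lform l" "\<exists>u. l u \<noteq> 0" "\<forall>u. l u = 0 \<longrightarrow> g u = u" for g l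
    proof (cases "g = id")
      case True
      then show ?thesis using linear_groupD(2)[OF W(1)] by simp
    next
      case False
      then have "pseudoreflection (*s) g" using pseudoreflection_if_fixes_hyperplane[OF G] that by blast
      then show ?thesis using that(1) by (intro generate.incl) simp
    qed
    then have "\<forall>g l. g \<in> G \<longrightarrow> lform l \<longrightarrow> (\<exists>u. l u \<noteq> 0) \<longrightarrow> (\<forall>u. l u = 0 \<longrightarrow> g u = u) \<longrightarrow> g \<in> ?W"
      by (intro allI impI)
    with rhs W show ?thesis by (elim allE[of _ ?W]) (simp only: simp_thms)
  qed
qed

end

theorem lemma3p1:
  fixes scale :: "'k::alg_closed_field \<Rightarrow> 'v::ab_group_add \<Rightarrow> 'v"
    and Basis :: "'v set"
    and G :: "('v \<Rightarrow> 'v) set"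
  assumes "finite_dimensional_vector_space scale Basis"
    and "subgroup G (GL scale)"
    and "finite G"
    and "\<exists>L. module.subspace scale L \<and> vector_space.dim scale L = 1 \<and> (\<forall>g\<in>G. g ` L \<subseteq> L)"
  shows "is_polynomial_ring (invariants scale G) \<longleftrightarrow>
    generate (GL scale) {g \<in> G. pseudoreflection scale g} = G \<and>
    (\<forall>W. module.subspace scale W \<and> W \<noteq> {0} \<longrightarrow>
      is_polynomial_ring (invariants scale (pointwise_stabilizer G W)))"
proof -
  interpret finite_dimensional_vector_space scale Basis by fact
  interpret polynomial_space scale Basis by unfold_locales (rule infinite_alg_closed_field)
  have G: "linear_group G" using subgroup_GL_iff assms(2,3) by blast
  obtain L where L: "subspace L" "dim L = 1" "\<forall>g\<in>G. g ` L \<subseteq> L" using assms(4) by blast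
  \<comment> \<open>The invariant line makes the dimension positive, as the Jacobian setting
    requires.\<close>
  have n_pos: "n > 0" using L(2) dim_subset_UNIV[of L] by (simp add: dimension_def)
  have L0: "L \<noteq> {0}" using L(2) dim_eq_0[of L] by auto
  show ?thesis
    unfolding generated_by_pseudoreflections_iff[OF G]
  proof (intro iffI conjI allI impI)
    assume poly: "is_polynomial_ring (Inv G)"
    show "is_polynomial_ring (Inv (pointwise_stabilizer G W))" if "subspace W \<and> W \<noteq> {0}" for W
      using polynomial_ring_pointwise_stabilizer[OF n_pos G poly] that by blast
    show "W = G" if "linear_group W" "W \<subseteq> G"
      "\<forall>g l. g \<in> G \<longrightarrow> lform l \<longrightarrow> (\<exists>u. l u \<noteq> 0) \<longrightarrow> (\<forall>u. l u = 0 \<longrightarrow> g u = u) \<longrightarrow> g \<in> W" for W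
      using that(3) by (intro polynomial_ring_reflection_group[OF n_pos G poly that(1,2)]) blast
  next
    assume rhs: "(\<forall>W. linear_group W \<longrightarrow> W \<subseteq> G \<longrightarrow>
        (\<forall>g l. g \<in> G \<longrightarrow> lform l \<longrightarrow> (\<exists>u. l u \<noteq> 0) \<longrightarrow> (\<forall>u. l u = 0 \<longrightarrow> g u = u) \<longrightarrow> g \<in> W) \<longrightarrow> W = G) \<and>
      (\<forall>W. subspace W \<and> W \<noteq> {0} \<longrightarrow> is_polynomial_ring (Inv (pointwise_stabilizer G W)))"
    obtain \<chi> :: "('v \<Rightarrow> 'v) \<Rightarrow> 'k" where \<chi>: "\<chi> id = 1" "\<And>g. g \<in> G \<Longrightarrow> \<chi> g \<noteq> 0"
      "\<And>g h. g \<in> G \<Longrightarrow> h \<in> G \<Longrightarrow> \<chi> (g \<circ> h) = \<chi> g * \<chi> h"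
      "pointwise_stabilizer G L = {g \<in> G. \<chi> g = (1 :: 'k)}" by (rule line_character[OF G L]) (rule that)
    interpret line_stabilizer scale Basis G "pointwise_stabilizer G L" \<chi>
      by unfold_locales (use n_pos G \<chi> in auto)
    show "is_polynomial_ring (Inv G)"
    proof (rule polynomial_ring_from_line_stabilizer)
      \<comment> \<open>The hypothesis on stabilizers is applied to the invariant line
        itself.\<close>
      show "is_polynomial_ring (Inv (pointwise_stabilizer G L))" using rhs L(1) L0 by blast
      show "W = G" if "linear_group W" "W \<subseteq> G"
        "\<And>g l. g \<in> G \<Longrightarrow> lform l \<Longrightarrow> \<exists>u. l u \<noteq> 0 \<Longrightarrow> (\<And>u. l u = 0 \<Longrightarrow> g u = u) \<Longrightarrow> g \<in> W" for W
        by (rule conjunct1[OF rhs, rule_format, OF that(1,2)], rule that(3))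
    qed
  qed
qed

end
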